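(* Let $\Omega\subset\mathbf{R}^d$ be a nonempty bounded open set, and let $P:\mathbf{R}^d\to\mathcal{M}_{M\times N}(\mathbf{C})$ and $Q:\mathbf{R}^d\to\mathcal{M}_{L\times N}(\mathbf{C})$ be matrix polynomials. The following are equivalent: (1) There is a constant $C>0$ such that $$\|Q(D)u\|_{L^2}\leq C\|P(D)u\|_{L^2}\quad\text{for all }u\in C_c^\infty(\Omega)^N.$$ (2) $P$ dominates $Q$.
   Context: All functions are complex-valued. $\mathcal{M}_{M\times N}(\mathbf{C})$ is the space of complex $M\times N$ matrices; a matrix polynomial is a map $P(\xi)=\sum_{|\alpha|\leq k}\xi^\alpha P_\alpha$, $\xi\in\mathbf{R}^d$, with constant complex matrix coefficients $P_\alpha$. The associated differential operator is $P(D)u=\sum_{|\alpha|\le k}(-i)^{|\alpha|}P_\alpha\partial^\alpha u$, i.e. $D=-i\nabla$, so that the Fourier transform of $P(D)u$ is $P(\xi)\hat u(\xi)$. Scalar domination: for a scalar polynomial $p:\mathbf{R}^d\to\mathbf{C}$ put $\tilde p(\xi)=\left(\sum_{\alpha\in\mathbf{N}^d}|\partial^\alpha p(\xi)|^2\right)^{1/2}$. For scalar polynomials $p,q$, one says $p$ dominates $q$ if there is a constant $C>0$ with $\tilde q(\xi)\leq C\tilde p(\xi)$ for all $\xi\in\mathbf{R}^d$. Matrix domination: $A^+\in\mathcal{M}_{N\times M}(\mathbf{C})$ denotes the Moore--Penrose pseudoinverse of $A\in\mathcal{M}_{M\times N}(\mathbf{C})$. The pointwise pseudoinverse $P^+(\xi)=P(\xi)^+$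 of a matrix polynomial agrees for almost every $\xi\in\mathbf{R}^d$ with a matrix of rational functions, so one can write $Q(\xi)P^+(\xi)=\left(q_{lj}(\xi)/\Delta(\xi)\right)_{l,j}$ for a.e. $\xi$, where $q_{lj}$ ($1\le l\le L$, $1\le j\le M$) and $\Delta\not\equiv0$ are scalar polynomials. Fix any such representation (the notion below does not depend on the choice). One says that $P$ dominates $Q$ if (i) $\Delta$ dominates $q_{lj}$ for all $l,j$, and (ii) $\ker P(\xi)\subset\ker Q(\xi)$ for almost every $\xi\in\mathbf{R}^d$. *)

theory Defs
  imports "HOL-Analysis.Analysis" "HOL-Library.Poly_Mapping"
begin

type_synonym 'd multi_index = "nat ^ 'd"

text \<open>A polynomial is its finitely supported family of coefficients. Coefficients are
  complex numbers for scalar polynomials and matrices of type \<open>complex^'n^'m\<close>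
  (\<open>'m\<close> rows, \<open>'n\<close> columns) for matrix polynomials.\<close>

type_synonym ('d, 'a) mpolynomial = "'d multi_index \<Rightarrow>\<^sub>0 'a"

definition mi_order :: "'d::finite multi_index \<Rightarrow> nat" where
  "mi_order \<alpha> = (\<Sum>i\<in>UNIV. \<alpha> $ i)"

definition mi_power :: "real^'d::finite \<Rightarrow> 'd multi_index \<Rightarrow> real" where
  "mi_power \<xi> \<alpha> = (\<Prod>i\<in>UNIV. (\<xi> $ i) ^ (\<alpha> $ i))"

definition mpoly_eval :: "('d::finite, 'a::real_vector) mpolynomial \<Rightarrow> real^'d \<Rightarrow> 'a" where
  "mpoly_eval P \<xi> = (\<Sum>\<alpha>\<in>Poly_Mapping.keys P. mi_power \<xi> \<alpha> *\<^sub>R Poly_Mapping.lookup P \<alpha>)"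

definition partial_deriv ::
    "'d::finite \<Rightarrow> (real^'d \<Rightarrow> 'a::real_normed_vector) \<Rightarrow> real^'d \<Rightarrow> 'a" where
  "partial_deriv i f x = vector_derivative (\<lambda>t. f (x + t *\<^sub>R axis i 1)) (at 0)"

definition iter_partial_deriv ::
    "'d::finite list \<Rightarrow> (real^'d \<Rightarrow> 'a::real_normed_vector) \<Rightarrow> real^'d \<Rightarrow> 'a" where
  "iter_partial_deriv is f = foldr partial_deriv is f"

text \<open>The index type \<open>'d\<close> carries no order, so the partial derivatives making up
  \<open>\<partial>\<^sup>\<alpha>\<close> are taken in an arbitrary order. All orders agree on smooth functions,
  the only ones to which the operator is applied.\<close>

definition mi_deriv ::
    "'d::finite multi_index \<Rightarrow> (real^'d \<Rightarrow> 'a::real_normed_vector) \<Rightarrow> real^'d \<Rightarrow> 'a" where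
  "mi_deriv \<alpha> = iter_partial_deriv (SOME is. \<forall>i. count_list is i = \<alpha> $ i)"

text \<open>Differentiability of every iterated partial derivative makes all of them continuous
  as well, so this is the class of infinitely differentiable functions.\<close>

definition smooth :: "(real^'d::finite \<Rightarrow> 'a::real_normed_vector) \<Rightarrow> bool" where
  "smooth f \<longleftrightarrow> (\<forall>is x. iter_partial_deriv is f differentiable (at x))"

definition test_functions :: "(real^'d::finite) set \<Rightarrow> (real^'d \<Rightarrow> complex^'n::finite) set" where
  "test_functions \<Omega> =
    {u. smooth u \<and> compact (closure {x. u x \<noteq> 0}) \<and> closure {x. u x \<noteq> 0} \<subseteq> \<Omega>}"

definition diff_operator ::
    "('d::finite, complex^'n::finite^'m::finite) mpolynomial
      \<Rightarrow> (real^'d \<Rightarrow> complex^'n) \<Rightarrow> real^'d \<Rightarrow> complex^'m" where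
  "diff_operator P u x =
    (\<Sum>\<alpha>\<in>Poly_Mapping.keys P.
      (- \<i>) ^ mi_order \<alpha> *s (Poly_Mapping.lookup P \<alpha> *v mi_deriv \<alpha> u x))"

definition L2_norm_fun :: "(real^'d::finite \<Rightarrow> complex^'m::finite) \<Rightarrow> real" where
  "L2_norm_fun f = sqrt (\<integral>x. (norm (f x))\<^sup>2 \<partial>lborel)"

text \<open>The sum has finite support: derivatives of order above the degree vanish.\<close>

definition poly_tilde :: "('d::finite, complex) mpolynomial \<Rightarrow> real^'d \<Rightarrow> real" where
  "poly_tilde p \<xi> = sqrt (\<Sum>\<^sub>\<infinity>\<alpha>\<in>UNIV. (cmod (mi_deriv \<alpha> (mpoly_eval p) \<xi>))\<^sup>2)"

definition scalar_dominates ::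
    "('d::finite, complex) mpolynomial \<Rightarrow> ('d, complex) mpolynomial \<Rightarrow> bool" where
  "scalar_dominates p q \<longleftrightarrow> (\<exists>C>0. \<forall>\<xi>. poly_tilde q \<xi> \<le> C * poly_tilde p \<xi>)"

definition conj_transpose :: "complex^'n::finite^'m::finite \<Rightarrow> complex^'m^'n" where
  "conj_transpose A = (\<chi> i j. cnj (A $ j $ i))"

text \<open>The Moore--Penrose pseudoinverse, as the unique solution of the four Penrose equations.\<close>

definition is_pseudoinverse ::
    "complex^'n::finite^'m::finite \<Rightarrow> complex^'m^'n \<Rightarrow> bool" where
  "is_pseudoinverse A X \<longleftrightarrow>
    A ** X ** A = A \<and> X ** A ** X = X \<and>
    conj_transpose (A ** X) = A ** X \<and> conj_transpose (X ** A) = X ** A"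

definition pseudoinverse :: "complex^'n::finite^'m::finite \<Rightarrow> complex^'m^'n" where
  "pseudoinverse A = (THE X. is_pseudoinverse A X)"

definition kernel :: "complex^'n::finite^'m::finite \<Rightarrow> (complex^'n) set" where
  "kernel A = {v. A *v v = 0}"

definition rational_rep ::
    "('d::finite, complex^'n::finite^'m::finite) mpolynomial
      \<Rightarrow> ('d, complex^'n^'l::finite) mpolynomial
      \<Rightarrow> ('l \<Rightarrow> 'm \<Rightarrow> ('d, complex) mpolynomial) \<Rightarrow> ('d, complex) mpolynomial \<Rightarrow> bool" where
  "rational_rep P Q q \<Delta> \<longleftrightarrow>
    (\<exists>\<xi>. mpoly_eval \<Delta> \<xi> \<noteq> 0) \<and>
    (AE \<xi> in lborel. mpoly_eval Q \<xi> ** pseudoinverse (mpoly_eval P \<xi>) =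
      (\<chi> l j. mpoly_eval (q l j) \<xi> / mpoly_eval \<Delta> \<xi>))"

text \<open>A representation always exists and whether \<open>\<Delta>\<close> dominates all the \<open>q l j\<close>
  does not depend on which one is used, so the existential quantifier could equally well be universal.\<close>

definition dominates ::
    "('d::finite, complex^'n::finite^'m::finite) mpolynomial
      \<Rightarrow> ('d, complex^'n^'l::finite) mpolynomial \<Rightarrow> bool" where
  "dominates P Q \<longleftrightarrow>
    (\<exists>q \<Delta>. rational_rep P Q q \<Delta> \<and> (\<forall>l j. scalar_dominates \<Delta> (q l j))) \<and>
    (AE \<xi> in lborel. kernel (mpoly_eval P \<xi>) \<subseteq> kernel (mpoly_eval Q \<xi>))"

end

theory Submission
  imports Defs "HOL-Complex_Analysis.Complex_Analysis" "HOL-Probability.Probability"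
    "HOL-Computational_Algebra.Fundamental_Theorem_Algebra"
begin

text \<open>Everything is read off on the Fourier side. Write \<open>f^\<close> for the Fourier transform of \<open>f\<close>. The
  transform of \<open>P(D) u\<close> is \<open>P(\<xi>) u^(\<xi>)\<close>, and by Plancherel's theorem (\<open>plancherel\<close>) the estimate
  compares the \<open>L\<^sup>2\<close> norms of \<open>Q u^\<close> and \<open>P u^\<close>.

  Sufficiency. The kernel condition says that \<open>Q = (Q P\<^sup>+) P\<close> almost everywhere, so
  \<open>\<Delta> Q = q P\<close> as polynomials, on real and hence on complex points. With \<open>v = Q(D) u\<close> and
  \<open>f = P(D) u\<close> this is \<open>\<Delta> v^ = q f^\<close>, an identity between entire functions. One cannot divide by
  \<open>\<Delta>\<close> where it is small; instead one recovers \<open>v^\<close> from \<open>\<Delta> v^\<close> at nearby complex frequencies.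
  For a polynomial \<open>p\<close> of one variable and an entire function \<open>h\<close>, Malgrange's inequality bounds
  \<open>|h(0) p'(0)|\<close> by a constant, depending only on the degree, times the quadratic mean of \<open>h p\<close>
  over the unit circle (\<open>poly_coeff_circle_mean\<close>). Iterated along the coordinate directions in
  \<open>L\<^sup>2\<close> with a slowly varying weight (\<open>weighted_pdl\<close>), it controls the norm of \<open>v^\<close> times any derivative of
  \<open>\<Delta>\<close> by that of \<open>\<Delta> v^ = q f^\<close> on shifted copies of real space. With the weight \<open>\<Delta>~\<^sup>-\<^sup>2\<close>
  domination of \<open>q\<close> by \<open>\<Delta>\<close> leaves \<open>f^\<close> on these copies, which is the transform of
  \<open>f\<close> times an exponential that is bounded on the bounded set \<open>\<Omega>\<close>. This is
  \<open>quotient_estimate\<close>.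

  Necessity. Away from a null set \<open>P\<^sup>+ = S / \<Delta>\<close> with a polynomial matrix \<open>S\<close>
  (\<open>pseudoinverse_rational\<close>). Put \<open>u = S(D) (w e\<^sub>j)\<close>. Since \<open>P S = \<Delta> P P\<^sup>+\<close> and \<open>P P\<^sup>+\<close> is an
  orthogonal projection, the estimate gives \<open>\<parallel>q\<^sub>l\<^sub>j(D) w\<parallel> \<le> C \<parallel>\<Delta>(D) w\<parallel>\<close> for scalar test functions \<open>w\<close>.
  For \<open>w(x) = exp(i x \<bullet> \<eta>) \<phi>(x)\<close> the right-hand side is at most a constant times \<open>\<Delta>~(\<eta>)\<close> by Taylor's
  formula, and Malgrange's inequality at the frequency \<open>\<eta>\<close> bounds \<open>q~(\<eta>)\<close> by a constant times the left-hand
  side (\<open>scalar_dominates_necessary\<close>). For the kernels put \<open>u = K(D) (\<phi> e\<^sub>k)\<close> with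
  \<open>K = \<Delta> (1 - P\<^sup>+ P)\<close>; as \<open>P K = 0\<close>, the estimate forces \<open>Q K = 0\<close>, which is the kernel condition.\<close>

section \<open>Polynomials and their derivatives at complex points\<close>

definition cvec :: "real^'d::finite \<Rightarrow> complex^'d" where
  "cvec \<xi> = (\<chi> i. complex_of_real (\<xi> $ i))"

lemma cvec_nth [simp]: "cvec \<xi> $ i = complex_of_real (\<xi> $ i)"
  by (simp add: cvec_def)

text \<open>Fourier transforms of compactly supported functions are entire, and Malgrange's inequality
  compares values at real and complex frequencies, so polynomials are needed at complex points.\<close>

definition ceval :: "('d::finite, complex) mpolynomial \<Rightarrow> complex^'d \<Rightarrow> complex" where
  "ceval p z = (\<Sum>\<alpha>\<in>Poly_Mapping.keys p. Poly_Mapping.lookup p \<alpha> * (\<Prod>i\<in>UNIV. (z $ i) ^ (\<alpha> $ i)))"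

lemma mpoly_eval_eq_ceval: "mpoly_eval p \<xi> = ceval p (cvec \<xi>)"
  by (simp add: mpoly_eval_def ceval_def mi_power_def scaleR_conv_of_real mult.commute)

lemma ceval_superset:
  assumes "finite A" "Poly_Mapping.keys p \<subseteq> A"
  shows "ceval p z = (\<Sum>\<alpha>\<in>A. Poly_Mapping.lookup p \<alpha> * (\<Prod>i\<in>UNIV. (z $ i) ^ (\<alpha> $ i)))"
  unfolding ceval_def
  by (rule sum.mono_neutral_left) (use assms in \<open>auto simp: in_keys_iff\<close>)

lemma ceval_zero [simp]: "ceval 0 z = 0"
  by (simp add: ceval_def)

lemma ceval_add: "ceval (p + q) z = ceval p z + ceval q z"
proof -
  let ?A = "Poly_Mapping.keys p \<union> Poly_Mapping.keys q"
  have "ceval (p+q) z = (\<Sum>\<alpha>\<in>?A. Poly_Mapping.lookup (p+q) \<alpha> * (\<Prod>i\<in>UNIV. (z $ i) ^ (\<alpha> $ i)))"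
    by (rule ceval_superset) (auto simp: Poly_Mapping.keys_add)
  also have "\<dots> = (\<Sum>\<alpha>\<in>?A. Poly_Mapping.lookup p \<alpha> * (\<Prod>i\<in>UNIV. (z $ i) ^ (\<alpha> $ i)))
     + (\<Sum>\<alpha>\<in>?A. Poly_Mapping.lookup q \<alpha> * (\<Prod>i\<in>UNIV. (z $ i) ^ (\<alpha> $ i)))"
    by (simp add: lookup_add algebra_simps sum.distrib)
  also have "\<dots> = ceval p z + ceval q z"
    by (subst (1 2) ceval_superset[of ?A]) auto
  finally show ?thesis .
qed

lemma ceval_single: "ceval (Poly_Mapping.single \<alpha> c) z = c * (\<Prod>i\<in>UNIV. (z $ i) ^ (\<alpha> $ i))"
  by (subst ceval_superset[of "{\<alpha>}"]) auto

definition deg_le :: "nat \<Rightarrow> ('d::finite, complex) mpolynomial \<Rightarrow> bool" where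
  "deg_le m p \<longleftrightarrow> (\<forall>\<alpha>\<in>Poly_Mapping.keys p. mi_order \<alpha> \<le> m)"

lemma deg_le_exists: "\<exists>m. deg_le m p"
proof -
  have "finite (mi_order ` Poly_Mapping.keys p)" by simp
  then obtain m where "\<forall>n\<in>mi_order ` Poly_Mapping.keys p. n \<le> m"
    using finite_nat_set_iff_bounded_le by blast
  then show ?thesis unfolding deg_le_def by blast
qed

lemma deg_le_mono: "deg_le m p \<Longrightarrow> m \<le> n \<Longrightarrow> deg_le n p"
  unfolding deg_le_def by (meson order_trans)

text \<open>The formal partial derivative. Reading it off from the coefficients makes commutation and the
  drop of the degree immediate.\<close>

definition pd :: "'d::finite \<Rightarrow> ('d, complex) mpolynomial \<Rightarrow> ('d, complex) mpolynomial" where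
  "pd i p = Poly_Mapping.Abs_poly_mapping
     (\<lambda>\<beta>. of_nat (\<beta> $ i + 1) * Poly_Mapping.lookup p (\<beta> + axis i 1))"

lemma lookup_pd: "Poly_Mapping.lookup (pd i p) \<beta> = of_nat (\<beta> $ i + 1) * Poly_Mapping.lookup p (\<beta> + axis i 1)"
proof -
  have "finite {\<beta>. Poly_Mapping.lookup p (\<beta> + axis i 1) \<noteq> 0}"
  proof (rule finite_imageD)
    show "finite ((\<lambda>\<beta>. \<beta> + axis i 1) ` {\<beta>. Poly_Mapping.lookup p (\<beta> + axis i 1) \<noteq> 0})"
      by (rule finite_subset[of _ "{\<alpha>. Poly_Mapping.lookup p \<alpha> \<noteq> 0}"]) auto
    show "inj_on (\<lambda>\<beta>. \<beta> + axis i 1) {\<beta>. Poly_Mapping.lookup p (\<beta> + axis i 1) \<noteq> 0}"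
      by (auto simp: inj_on_def vec_eq_iff)
  qed
  then have "finite {\<beta>. of_nat (\<beta> $ i + 1) * Poly_Mapping.lookup p (\<beta> + axis i 1) \<noteq> 0}"
    by (rule finite_subset[rotated]) auto
  then show ?thesis unfolding pd_def by simp
qed

lemma keys_pd: "Poly_Mapping.keys (pd i p) = {\<beta>. \<beta> + axis i 1 \<in> Poly_Mapping.keys p}"
  by (auto simp: in_keys_iff lookup_pd simp del: of_nat_Suc)

lemma pd_commute: "pd i (pd j p) = pd j (pd i p)"
proof (rule poly_mapping_eqI)
  fix \<beta> :: "'a multi_index"
  show "Poly_Mapping.lookup (pd i (pd j p)) \<beta> = Poly_Mapping.lookup (pd j (pd i p)) \<beta>"
    by (cases "i = j") (simp_all add: lookup_pd axis_def algebra_simps del: of_nat_Suc)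
qed

lemma mi_order_add_axis: "mi_order (\<beta> + axis i 1) = Suc (mi_order \<beta>)"
proof -
  have "(\<Sum>j\<in>UNIV. (axis i (1::nat) :: nat^'a) $ j) = (\<Sum>j\<in>UNIV. if j = i then 1 else 0)"
    by (rule sum.cong) (auto simp: axis_def)
  also have "\<dots> = 1" by simp
  finally show ?thesis by (simp add: mi_order_def sum.distrib)
qed

lemma ceval_pd:
  "ceval (pd i p) z = (\<Sum>\<alpha>\<in>Poly_Mapping.keys p. Poly_Mapping.lookup p \<alpha> *
     (of_nat (\<alpha> $ i) * (z $ i) ^ (\<alpha> $ i - 1) * (\<Prod>k\<in>UNIV - {i}. (z $ k) ^ (\<alpha> $ k))))"
proof -
  let ?t = "\<lambda>\<alpha>. Poly_Mapping.lookup p \<alpha> *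
     (of_nat (\<alpha> $ i) * (z $ i) ^ (\<alpha> $ i - 1) * (\<Prod>k\<in>UNIV - {i}. (z $ k) ^ (\<alpha> $ k)))"
  have "ceval (pd i p) z = (\<Sum>\<beta>\<in>{\<beta>. \<beta> + axis i 1 \<in> Poly_Mapping.keys p}. ?t (\<beta> + axis i 1))"
    unfolding ceval_def keys_pd
  proof (rule sum.cong[OF refl])
    fix \<beta> :: "'a multi_index"
    have *: "(\<Prod>k\<in>UNIV. z $ k ^ \<beta> $ k) = z $ i ^ \<beta> $ i * (\<Prod>k\<in>UNIV-{i}. z $ k ^ \<beta> $ k)"
      by (rule prod.remove) auto
    have **: "(\<Prod>k\<in>UNIV-{i}. z $ k ^ (\<beta> + axis i 1) $ k) = (\<Prod>k\<in>UNIV-{i}. z $ k ^ \<beta> $ k)"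
      by (rule prod.cong) (auto simp: axis_def)
    have e: "(\<beta> + axis i 1) $ i = \<beta> $ i + 1" by (simp add: axis_def)
    show "Poly_Mapping.lookup (pd i p) \<beta> * (\<Prod>k\<in>UNIV. z $ k ^ \<beta> $ k) = ?t (\<beta> + axis i 1)"
      unfolding lookup_pd * ** e by (simp only: add_diff_cancel_right' mult_ac)
  qed
  also have "\<dots> = sum ?t ((\<lambda>\<beta>. \<beta> + axis i 1) ` {\<beta>. \<beta> + axis i 1 \<in> Poly_Mapping.keys p})"
    by (rule sum.reindex_cong[OF _ refl refl, symmetric]) (simp add: inj_on_def)
  also have "\<dots> = sum ?t (Poly_Mapping.keys p)"
  proof (rule sum.mono_neutral_left)
    show "\<forall>\<alpha>\<in>Poly_Mapping.keys p - (\<lambda>\<beta>. \<beta> + axis i 1) ` {\<beta>. \<beta> + axis i 1 \<in> Poly_Mapping.keys p}. ?t \<alpha> = 0"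
    proof
      fix \<alpha> assume a: "\<alpha> \<in> Poly_Mapping.keys p - (\<lambda>\<beta>. \<beta> + axis i 1) ` {\<beta>. \<beta> + axis i 1 \<in> Poly_Mapping.keys p}"
      have "\<alpha> $ i = 0"
      proof (rule ccontr)
        assume "\<alpha> $ i \<noteq> 0"
        then have e: "\<alpha> = (\<chi> k. if k = i then \<alpha> $ i - 1 else \<alpha> $ k) + axis i 1" (is "_ = ?\<beta> + _")
          by (auto simp: vec_eq_iff axis_def)
        have "?\<beta> + axis i 1 \<in> Poly_Mapping.keys p" unfolding e[symmetric] using a by simp
        then have "\<alpha> \<in> (\<lambda>\<beta>. \<beta> + axis i 1) ` {\<beta>. \<beta> + axis i 1 \<in> Poly_Mapping.keys p}"
          using e by (intro image_eqI[where x="?\<beta>"]) auto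
        with a show False by simp
      qed
      then show "?t \<alpha> = 0" by simp
    qed
  qed auto
  finally show ?thesis .
qed

text \<open>The restriction of a polynomial to the complex line \<open>z + s y\<close>, as a polynomial in \<open>s\<close>.\<close>

definition line_poly :: "('d::finite, complex) mpolynomial \<Rightarrow> complex^'d \<Rightarrow> complex^'d \<Rightarrow> complex poly" where
  "line_poly p z y = (\<Sum>\<alpha>\<in>Poly_Mapping.keys p. smult (Poly_Mapping.lookup p \<alpha>) (\<Prod>k\<in>UNIV. [:z $ k, y $ k:] ^ (\<alpha> $ k)))"

lemma poly_line_poly: "poly (line_poly p z y) s = ceval p (z + s *s y)"
  by (simp add: line_poly_def ceval_def poly_sum poly_prod poly_power)

lemma degree_line_poly: 
  assumes "deg_le m p" shows "degree (line_poly p z y) \<le> m"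
  unfolding line_poly_def
proof (rule degree_sum_le, simp)
  fix \<alpha> assume a: "\<alpha> \<in> Poly_Mapping.keys p"
  have "degree (smult (Poly_Mapping.lookup p \<alpha>) (\<Prod>k\<in>UNIV. [:z $ k, y $ k:] ^ (\<alpha> $ k)))
     \<le> degree (\<Prod>k\<in>UNIV. [:z $ k, y $ k:] ^ (\<alpha> $ k))" by (rule degree_smult_le)
  also have "\<dots> \<le> (\<Sum>k\<in>UNIV. degree ([:z $ k, y $ k:] ^ (\<alpha> $ k)))"
    using degree_prod_sum_le[of UNIV "\<lambda>k. [:z $ k, y $ k:] ^ (\<alpha> $ k)"] by (simp add: o_def)
  also have "\<dots> \<le> (\<Sum>k\<in>UNIV. \<alpha> $ k)"
  proof (rule sum_mono)
    fix k
    have "degree ([:z $ k, y $ k:] ^ (\<alpha> $ k)) \<le> degree [:z $ k, y $ k:] * (\<alpha> $ k)"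
      by (rule degree_power_le)
    also have "\<dots> \<le> 1 * (\<alpha> $ k)" by (rule mult_right_mono) auto
    finally show "degree ([:z $ k, y $ k:] ^ (\<alpha> $ k)) \<le> \<alpha> $ k" by simp
  qed
  also have "\<dots> \<le> m" using assms a by (simp add: deg_le_def mi_order_def)
  finally show "degree (smult (Poly_Mapping.lookup p \<alpha>) (\<Prod>k\<in>UNIV. [:z $ k, y $ k:] ^ (\<alpha> $ k))) \<le> m" .
qed

lemma pderiv_sum: "pderiv (sum f A) = (\<Sum>a\<in>A. pderiv (f a :: 'a::idom poly))"
  by (induction A rule: infinite_finite_induct) (auto simp: pderiv_add)

lemma prod_const_poly: "(\<Prod>k\<in>A. [:f k:]) = [:\<Prod>k\<in>A. (f k :: complex):]"
  by (induction A rule: infinite_finite_induct) simp_all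

lemma pderiv_line_poly: "pderiv (line_poly p z (axis i 1)) = line_poly (pd i p) z (axis i 1)"
proof -
  have split: "(\<Prod>k\<in>UNIV. [:z $ k, axis i 1 $ k:] ^ (\<alpha> $ k))
      = smult (\<Prod>k\<in>UNIV-{i}. (z $ k) ^ (\<alpha> $ k)) ([:z $ i, 1:] ^ (\<alpha> $ i))" for \<alpha> :: "'a multi_index"
  proof -
    have "(\<Prod>k\<in>UNIV. [:z $ k, axis i 1 $ k:] ^ (\<alpha> $ k))
      = [:z $ i, axis i 1 $ i:] ^ (\<alpha> $ i) * (\<Prod>k\<in>UNIV-{i}. [:z $ k, axis i 1 $ k:] ^ (\<alpha> $ k))"
      by (rule prod.remove) auto
    also have "(\<Prod>k\<in>UNIV-{i}. [:z $ k, axis i 1 $ k:] ^ (\<alpha> $ k)) = (\<Prod>k\<in>UNIV-{i}. [:(z $ k) ^ (\<alpha> $ k):])"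
      by (rule prod.cong) (auto simp: axis_def poly_const_pow)
    also have "\<dots> = [:\<Prod>k\<in>UNIV-{i}. (z $ k) ^ (\<alpha> $ k):]"
      by (rule prod_const_poly)
    finally show ?thesis by (simp add: axis_def)
  qed
  show ?thesis
  proof (rule poly_eq_poly_eq_iff[THEN iffD1], rule ext)
    fix s
    let ?w = "z + s *s axis i 1"
    have w: "?w $ i = z $ i + s" "k \<noteq> i \<Longrightarrow> ?w $ k = z $ k" for k by (auto simp: axis_def)
    have P: "(\<Prod>k\<in>UNIV-{i}. (?w $ k) ^ (\<alpha> $ k)) = (\<Prod>k\<in>UNIV-{i}. (z $ k) ^ (\<alpha> $ k))" for \<alpha> :: "'a multi_index"
      by (rule prod.cong) (auto simp: axis_def)
    have D: "poly (pderiv (smult c (smult d ([:a, 1:] ^ n)))) s = c * (of_nat n * (a + s) ^ (n - 1) * d)"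
      for c d a :: complex and n
      by (simp add: pderiv_smult pderiv_power pderiv_pCons poly_power)
    have "poly (pderiv (line_poly p z (axis i 1))) s = (\<Sum>\<alpha>\<in>Poly_Mapping.keys p. Poly_Mapping.lookup p \<alpha> *
     (of_nat (\<alpha> $ i) * (z $ i + s) ^ (\<alpha> $ i - 1) * (\<Prod>k\<in>UNIV - {i}. (z $ k) ^ (\<alpha> $ k))))"
      unfolding line_poly_def split pderiv_sum poly_sum D by (rule refl)
    also have "\<dots> = poly (line_poly (pd i p) z (axis i 1)) s"
      unfolding poly_line_poly ceval_pd P w(1) by (rule refl)
    finally show "poly (pderiv (line_poly p z (axis i 1))) s = poly (line_poly (pd i p) z (axis i 1)) s" .
  qed
qed

text \<open>Taylor's formula in one coordinate direction, for the polynomial \<open>line_poly p z (axis i 1)\<close>.\<close>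

lemma ceval_axis_expand:
  assumes "deg_le m p"
  shows "ceval p (z + s *s axis i 1) = (\<Sum>k\<le>m. ceval ((pd i ^^ k) p) z / fact k * s ^ k)"
proof -
  let ?r = "line_poly p z (axis i 1)"
  have it: "(pderiv ^^ k) ?r = line_poly ((pd i ^^ k) p) z (axis i 1)" for k
    by (induction k) (auto simp: pderiv_line_poly)
  have c: "coeff ?r k = ceval ((pd i ^^ k) p) z / fact k" for k
  proof -
    have "coeff ((pderiv ^^ k) ?r) 0 = fact k * coeff ?r k"
      by (simp add: coeff_higher_pderiv pochhammer_fact)
    moreover have "coeff ((pderiv ^^ k) ?r) 0 = ceval ((pd i ^^ k) p) z"
      using poly_line_poly[of "(pd i ^^ k) p" z "axis i 1" 0]
      unfolding it poly_0_coeff_0[symmetric] by simp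
    ultimately show ?thesis by simp
  qed
  have "ceval p (z + s *s axis i 1) = (\<Sum>k\<le>m. coeff ?r k * s ^ k)"
    unfolding poly_line_poly[symmetric] poly_altdef
    by (rule sum.mono_neutral_left) (use degree_line_poly[OF assms, of z "axis i 1"] in \<open>auto simp: coeff_eq_0\<close>)
  then show ?thesis by (simp add: c)
qed

definition pdl :: "'d::finite list \<Rightarrow> ('d, complex) mpolynomial \<Rightarrow> ('d, complex) mpolynomial" where
  "pdl is p = foldr pd is p"

lemma pdl_simps [simp]: "pdl [] p = p" "pdl (i # is) p = pd i (pdl is p)"
  by (simp_all add: pdl_def)

lemma pdl_append: "pdl (is @ js) p = pdl is (pdl js p)"
  by (simp add: pdl_def)

lemma pdl_replicate: "pdl (replicate k i) p = (pd i ^^ k) p"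
  by (induction k) auto

lemma pdl_permute:
  assumes "mset is = mset js"
  shows "pdl is p = pdl js p"
proof -
  have "fold pd (rev is) = fold pd (rev js)"
    by (rule fold_multiset_equiv) (use assms in \<open>auto simp: fun_eq_iff pd_commute\<close>)
  then show ?thesis by (simp add: pdl_def foldr_conv_fold)
qed

lemma pdl_keys:
  assumes "deg_le m p" "\<beta> \<in> Poly_Mapping.keys (pdl is p)"
  shows "mi_order \<beta> + length is \<le> m"
  using assms(2)
proof (induction "is" arbitrary: \<beta>)
  case Nil
  then show ?case using assms(1) by (simp add: deg_le_def)
next
  case (Cons i js)
  have "mi_order (\<beta> + axis i 1) + length js \<le> m"
    by (rule Cons.IH) (use Cons.prems in \<open>simp add: keys_pd\<close>)
  then show ?case by (simp add: mi_order_add_axis[unfolded One_nat_def])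
qed

lemma deg_le_pdl: "deg_le m p \<Longrightarrow> deg_le m (pdl is p)"
  using pdl_keys[of m p] by (fastforce simp: deg_le_def)

lemma pdl_eq_0:
  assumes "deg_le m p" "length is > m"
  shows "pdl is p = 0"
proof -
  have "Poly_Mapping.keys (pdl is p) = {}"
    using pdl_keys[OF assms(1)] assms(2) by fastforce
  then show ?thesis by simp
qed

definition lists_le :: "nat \<Rightarrow> 'd list set" where
  "lists_le m = {is. length is \<le> m}"

lemma finite_lists_le [simp]: "finite (lists_le m :: 'd::finite list set)"
  using finite_lists_length_le[of "UNIV :: 'd set" m] by (simp add: lists_le_def)

text \<open>A substitute for \<open>p~\<close> that also makes sense at complex points. Summing over lists of
  directions rather than over multi-indices allows a coordinate to be shifted without reordering
  derivatives; at real points the two are comparable once \<open>m\<close> bounds the degree.\<close>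

definition deriv_sum :: "nat \<Rightarrow> ('d::finite, complex) mpolynomial \<Rightarrow> complex^'d \<Rightarrow> real" where
  "deriv_sum m p z = (\<Sum>is\<in>lists_le m. cmod (ceval (pdl is p) z))"

lemma deriv_sum_nonneg [simp]: "deriv_sum m p z \<ge> 0"
  by (simp add: deriv_sum_def sum_nonneg)

lemma pdl_le_deriv_sum:
  assumes "deg_le m p"
  shows "cmod (ceval (pdl is p) z) \<le> deriv_sum m p z"
proof (cases "length is \<le> m")
  case True
  then show ?thesis unfolding deriv_sum_def
    by (intro member_le_sum[of "is" _ "\<lambda>is. cmod (ceval (pdl is p) z)"] finite_lists_le) (simp_all add: lists_le_def)
next
  case False
  then show ?thesis using pdl_eq_0[OF assms, of "is"] by simp
qed

text \<open>In Taylor's formula along one axis every coefficient is, up to a factorial, a derivative of \<open>p\<close>. Either its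
  order exceeds \<open>m\<close> and it vanishes, or its modulus is a summand of \<open>deriv_sum m p z\<close>.\<close>

lemma pdl_axis_shift:
  fixes p :: "('d::finite, complex) mpolynomial"
  assumes "deg_le m p"
  shows "cmod (ceval (pdl is p) (z + s *s axis i 1)) \<le> real (m + 1) * (1 + cmod s) ^ m * deriv_sum m p z"
proof -
  have "cmod (ceval (pdl is p) (z + s *s axis i 1))
     = cmod (\<Sum>k\<le>m. ceval ((pd i ^^ k) (pdl is p)) z / fact k * s ^ k)"
    using ceval_axis_expand[OF deg_le_pdl[OF assms]] by metis
  also have "\<dots> \<le> (\<Sum>k\<le>m. cmod (ceval ((pd i ^^ k) (pdl is p)) z / fact k * s ^ k))"
    by (rule norm_sum)
  also have "\<dots> \<le> (\<Sum>k\<le>m. (1 + cmod s) ^ m * deriv_sum m p z)"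
  proof (rule sum_mono)
    fix k assume k: "k \<in> {..m}"
    have "(pd i ^^ k) (pdl is p) = pdl (replicate k i @ is) p"
      by (simp add: pdl_append pdl_replicate)
    then have 1: "cmod (ceval ((pd i ^^ k) (pdl is p)) z) \<le> deriv_sum m p z"
      using pdl_le_deriv_sum[OF assms, of "replicate k i @ is" z] by simp
    have "cmod (ceval ((pd i ^^ k) (pdl is p)) z) / fact k \<le> deriv_sum m p z"
    proof -
      have "cmod (ceval ((pd i ^^ k) (pdl is p)) z) / fact k \<le> cmod (ceval ((pd i ^^ k) (pdl is p)) z) / 1"
        by (rule divide_left_mono) auto
      then show ?thesis using 1 by linarith
    qed
    moreover have "cmod s ^ k \<le> (1 + cmod s) ^ m"
    proof -
      have "cmod s ^ k \<le> (1 + cmod s) ^ k" by (rule power_mono) auto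
      also have "\<dots> \<le> (1 + cmod s) ^ m" using k by (intro power_increasing) auto
      finally show ?thesis .
    qed
    ultimately have "cmod (ceval ((pd i ^^ k) (pdl is p)) z) / fact k * cmod s ^ k \<le> deriv_sum m p z * (1 + cmod s) ^ m"
      by (intro mult_mono) auto
    then show "cmod (ceval ((pd i ^^ k) (pdl is p)) z / fact k * s ^ k) \<le> (1 + cmod s) ^ m * deriv_sum m p z"
      by (simp add: norm_mult norm_divide norm_power mult.commute)
  qed
  also have "\<dots> = real (m + 1) * (1 + cmod s) ^ m * deriv_sum m p z" by simp
  finally show ?thesis .
qed

lemma deriv_sum_axis_shift:
  fixes p :: "('d::finite, complex) mpolynomial"
  assumes "deg_le m p"
  shows "deriv_sum m p (z + s *s axis i 1) \<le> (real (card (lists_le m :: 'd list set)) * real (m+1)) * (1 + cmod s) ^ m * deriv_sum m p z"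
proof -
  have "deriv_sum m p (z + s *s axis i 1) \<le> (\<Sum>is\<in>(lists_le m :: 'd list set). real (m + 1) * (1 + cmod s) ^ m * deriv_sum m p z)"
    unfolding deriv_sum_def[of m p "z + s *s axis i 1"] by (rule sum_mono) (rule pdl_axis_shift[OF assms])
  then show ?thesis by (simp add: mult.assoc)
qed

text \<open>The coordinates of \<open>y\<close> are shifted one after the other. At bounded distance \<open>deriv_sum\<close> thus changes
  by at most a bounded factor, with a constant depending only on \<open>m\<close> and the dimension.\<close>

lemma deriv_sum_shift:
  fixes p :: "('d::finite, complex) mpolynomial"
  obtains K where "K > 0" "\<And>p z y. deg_le m p \<Longrightarrow> 
    deriv_sum m (p::('d::finite, complex) mpolynomial) (z + y) \<le> K * (\<Prod>i\<in>UNIV. (1 + cmod (y $ i)) ^ m) * deriv_sum m p z"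
proof -
  let ?N = "real (card (lists_le m :: 'd list set)) * real (m+1)"
  have "[] \<in> (lists_le m :: 'd list set)" by (simp add: lists_le_def)
  then have "card (lists_le m :: 'd list set) > 0" by (subst card_gt_0_iff) auto
  then have N: "?N > 0" by simp
  have *: "deriv_sum m p (z + (\<Sum>i\<in>A. (y $ i) *s axis i 1)) \<le> ?N ^ card A * (\<Prod>i\<in>A. (1 + cmod (y $ i)) ^ m) * deriv_sum m p z"
    if "deg_le m p" "finite A" for p :: "('d, complex) mpolynomial" and z y A
    using that(2)
  proof (induction A rule: finite_induct)
    case empty
    then show ?case by simp
  next
    case (insert j A)
    have "deriv_sum m p (z + (\<Sum>i\<in>insert j A. (y $ i) *s axis i 1)) = deriv_sum m p ((z + (\<Sum>i\<in>A. (y $ i) *s axis i 1)) + (y $ j) *s axis j 1)"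
      using insert.hyps by (simp add: ac_simps)
    also have "\<dots> \<le> ?N * (1 + cmod (y $ j)) ^ m * deriv_sum m p (z + (\<Sum>i\<in>A. (y $ i) *s axis i 1))"
      by (rule deriv_sum_axis_shift[OF that(1)])
    also have "\<dots> \<le> ?N * (1 + cmod (y $ j)) ^ m * (?N ^ card A * (\<Prod>i\<in>A. (1 + cmod (y $ i)) ^ m) * deriv_sum m p z)"
      by (rule mult_left_mono[OF insert.IH]) auto
    also have "\<dots> = ?N ^ card (insert j A) * (\<Prod>i\<in>insert j A. (1 + cmod (y $ i)) ^ m) * deriv_sum m p z"
      using insert.hyps by (simp add: mult_ac)
    finally show ?case .
  qed
  show ?thesis
  proof (rule that[of "?N ^ CARD('d)"])
    show "?N ^ CARD('d) > 0" using N by (rule zero_less_power)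
    fix p :: "('d, complex) mpolynomial" and z y :: "complex^'d" assume "deg_le m p"
    have "(\<Sum>i\<in>UNIV. (y $ i) *s axis i 1) = y" by (rule basis_expansion)
    then show "deriv_sum m p (z + y) \<le> ?N ^ CARD('d) * (\<Prod>i\<in>UNIV. (1 + cmod (y $ i)) ^ m) * deriv_sum m p z"
      using *[OF \<open>deg_le m p\<close> finite, where A=UNIV and z=z and y=y] by metis
  qed
qed


lemma cvec_add_axis: "cvec (\<xi> + t *\<^sub>R axis i 1) = cvec \<xi> + complex_of_real t *s axis i 1"
  by (auto simp: vec_eq_iff axis_def)

lemma has_vector_derivative_mpoly_line:
  "((\<lambda>t. mpoly_eval p (\<xi> + t *\<^sub>R axis i 1)) has_vector_derivative mpoly_eval (pd i p) \<xi>) (at 0)"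
proof -
  let ?r = "line_poly p (cvec \<xi>) (axis i 1)"
  have "((\<lambda>t. poly ?r (complex_of_real t)) has_vector_derivative poly (pderiv ?r) (complex_of_real 0)) (at 0)"
    by (rule has_vector_derivative_real_field) (rule poly_DERIV)
  then show ?thesis
    by (simp add: poly_line_poly pderiv_line_poly mpoly_eval_eq_ceval cvec_add_axis)
qed

lemma partial_deriv_mpoly_eval: "partial_deriv i (mpoly_eval p) = mpoly_eval (pd i p)"
  unfolding partial_deriv_def
  by (rule ext) (rule vector_derivative_at[OF has_vector_derivative_mpoly_line])

lemma iter_partial_deriv_mpoly_eval: "iter_partial_deriv is (mpoly_eval p) = mpoly_eval (pdl is p)"
  unfolding iter_partial_deriv_def
  by (induction "is") (auto simp: partial_deriv_mpoly_eval)

text \<open>The order in which \<open>mi_deriv\<close> takes the partial derivatives.\<close>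

definition mi_list :: "'d::finite multi_index \<Rightarrow> 'd list" where
  "mi_list \<alpha> = (SOME is. \<forall>i. count_list is i = \<alpha> $ i)"

lemma count_mi_list: "count_list (mi_list \<alpha>) i = \<alpha> $ i"
proof -
  obtain xs where xs: "mset xs = (\<Sum>i\<in>UNIV. replicate_mset (\<alpha> $ i) i)"
    using ex_mset by blast
  have "\<forall>i. count_list xs i = \<alpha> $ i"
    by (simp add: count_mset[symmetric] xs count_sum if_distrib cong: if_cong)
  then show ?thesis unfolding mi_list_def by (rule someI2) simp
qed

lemma length_mi_list: "length (mi_list \<alpha>) = mi_order \<alpha>"
  using sum_count_set[of "mi_list \<alpha>" UNIV] by (simp add: count_mi_list mi_order_def)

lemma inj_mi_list: "inj mi_list"
  by (rule injI) (metis count_mi_list vec_eq_iff)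

lemma mset_mi_list_count: "mset (mi_list (\<chi> i. count_list is i)) = mset is"
  by (rule multiset_eqI) (simp add: count_mset count_mi_list)

lemma mi_deriv_mi_list: "mi_deriv \<alpha> = iter_partial_deriv (mi_list \<alpha>)"
  by (simp add: mi_deriv_def mi_list_def)

lemma mi_list_lists_le: "mi_list ` {\<alpha>. mi_order \<alpha> \<le> m} \<subseteq> lists_le m"
  by (auto simp: lists_le_def length_mi_list)

lemma finite_mi_order_le: "finite {\<alpha> :: 'd::finite multi_index. mi_order \<alpha> \<le> m}"
  by (rule finite_imageD[OF finite_subset[OF mi_list_lists_le finite_lists_le]])
     (rule inj_on_subset[OF inj_mi_list subset_UNIV])

lemma poly_tilde_eq:
  assumes "deg_le m p"
  shows "poly_tilde p \<xi> = L2_set (\<lambda>\<alpha>. cmod (ceval (pdl (mi_list \<alpha>) p) (cvec \<xi>))) {\<alpha>. mi_order \<alpha> \<le> m}"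
proof -
  let ?f = "\<lambda>\<alpha>. (cmod (mi_deriv \<alpha> (mpoly_eval p) \<xi>))\<^sup>2"
  have e: "mi_deriv \<alpha> (mpoly_eval p) \<xi> = ceval (pdl (mi_list \<alpha>) p) (cvec \<xi>)" for \<alpha>
    by (simp add: mi_deriv_mi_list iter_partial_deriv_mpoly_eval mpoly_eval_eq_ceval)
  have "infsum ?f UNIV = infsum ?f {\<alpha>. mi_order \<alpha> \<le> m}"
    by (rule infsum_cong_neutral) (use pdl_eq_0[OF assms] in \<open>auto simp: e length_mi_list not_le\<close>)
  also have "\<dots> = sum ?f {\<alpha>. mi_order \<alpha> \<le> m}"
    by (rule infsum_finite) (rule finite_mi_order_le)
  finally show ?thesis unfolding poly_tilde_def L2_set_def by (simp add: e)
qed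

lemma poly_tilde_le_deriv_sum:
  assumes "deg_le m p"
  shows "poly_tilde p \<xi> \<le> deriv_sum m p (cvec \<xi>)"
proof -
  let ?S = "{\<alpha> :: 'a multi_index. mi_order \<alpha> \<le> m}"
  have "poly_tilde p \<xi> \<le> (\<Sum>\<alpha>\<in>?S. cmod (ceval (pdl (mi_list \<alpha>) p) (cvec \<xi>)))"
    unfolding poly_tilde_eq[OF assms] by (rule L2_set_le_sum) simp
  also have "\<dots> = (\<Sum>is\<in>mi_list ` ?S. cmod (ceval (pdl is p) (cvec \<xi>)))"
    by (subst sum.reindex) (auto intro: inj_on_subset[OF inj_mi_list])
  also have "\<dots> \<le> deriv_sum m p (cvec \<xi>)"
    unfolding deriv_sum_def by (rule sum_mono2) (use mi_list_lists_le in auto)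
  finally show ?thesis .
qed

lemma deriv_sum_le_poly_tilde:
  assumes "deg_le m p"
  shows "deriv_sum m (p::('d::finite, complex) mpolynomial) (cvec \<xi>) \<le> real (card (lists_le m :: 'd list set)) * poly_tilde p \<xi>"
proof -
  have "cmod (ceval (pdl is p) (cvec \<xi>)) \<le> poly_tilde p \<xi>" if "is \<in> lists_le m" for "is" :: "'d list"
  proof -
    let ?\<alpha> = "\<chi> i. count_list is i"
    have "pdl is p = pdl (mi_list ?\<alpha>) p" by (rule pdl_permute) (simp add: mset_mi_list_count)
    moreover have "mi_order ?\<alpha> \<le> m"
      using that mset_eq_length[OF mset_mi_list_count, of "is"] by (simp add: lists_le_def length_mi_list)
    ultimately show ?thesis unfolding poly_tilde_eq[OF assms]
      using member_le_L2_set[OF finite_mi_order_le[of m], of ?\<alpha> "\<lambda>\<alpha>. cmod (ceval (pdl (mi_list \<alpha>) p) (cvec \<xi>))"]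
      by simp
  qed
  then show ?thesis unfolding deriv_sum_def
    by (rule sum_bounded_above)
qed

lemma scalar_dominates_iff_deriv_sum:
  assumes p: "deg_le m p" and q: "deg_le n q"
  shows "scalar_dominates p q \<longleftrightarrow> (\<exists>C>0. \<forall>\<xi>. deriv_sum n q (cvec \<xi>) \<le> C * deriv_sum m p (cvec \<xi>))"
    (is "_ \<longleftrightarrow> ?R")
proof
  let ?N = "\<lambda>m. real (card (lists_le m :: 'a list set))"
  have "[] \<in> (lists_le m :: 'a list set)" for m by (simp add: lists_le_def)
  then have "card (lists_le m :: 'a list set) > 0" for m by (subst card_gt_0_iff) auto
  then have N: "?N m > 0" for m by simp
  {
    assume "scalar_dominates p q"
    then obtain C where C: "C > 0" "\<And>\<xi>. poly_tilde q \<xi> \<le> C * poly_tilde p \<xi>"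
      unfolding scalar_dominates_def by blast
    have "deriv_sum n q (cvec \<xi>) \<le> (?N n * C) * deriv_sum m p (cvec \<xi>)" for \<xi>
    proof -
      have "deriv_sum n q (cvec \<xi>) \<le> ?N n * poly_tilde q \<xi>" by (rule deriv_sum_le_poly_tilde[OF q])
      also have "\<dots> \<le> ?N n * (C * poly_tilde p \<xi>)" using C(2) by (rule mult_left_mono) simp
      also have "\<dots> \<le> ?N n * (C * deriv_sum m p (cvec \<xi>))"
        using C(1) poly_tilde_le_deriv_sum[OF p] by (intro mult_left_mono) auto
      finally show ?thesis by (simp add: mult.assoc)
    qed
    then show ?R using N[of n] C(1) by (intro exI[of _ "?N n * C"]) auto
  }
  {
    assume ?R
    then obtain C where C: "C > 0" "\<And>\<xi>. deriv_sum n q (cvec \<xi>) \<le> C * deriv_sum m p (cvec \<xi>)" by blast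
    have "poly_tilde q \<xi> \<le> (C * ?N m) * poly_tilde p \<xi>" for \<xi>
    proof -
      have "poly_tilde q \<xi> \<le> deriv_sum n q (cvec \<xi>)" by (rule poly_tilde_le_deriv_sum[OF q])
      also have "\<dots> \<le> C * deriv_sum m p (cvec \<xi>)" by (rule C)
      also have "\<dots> \<le> C * (?N m * poly_tilde p \<xi>)"
        using C(1) deriv_sum_le_poly_tilde[OF p] by (intro mult_left_mono) auto
      finally show ?thesis by (simp add: mult.assoc)
    qed
    then show "scalar_dominates p q" unfolding scalar_dominates_def
      using N[of m] C(1) by (intro exI[of _ "C * ?N m"]) auto
  }
qed

text \<open>Polynomial functions of real variables without named coefficients. Because the variables are
  real, they are closed under complex conjugation.\<close>

definition polyfun :: "(real^'d::finite \<Rightarrow> complex) \<Rightarrow> bool" where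
  "polyfun f \<longleftrightarrow> (\<exists>p. f = mpoly_eval p)"

lemma polyfun_mpoly_eval [simp, intro]: "polyfun (mpoly_eval p)"
  unfolding polyfun_def by blast

lemma polyfunE:
  assumes "polyfun f" obtains p where "f = mpoly_eval p"
  using assms unfolding polyfun_def by blast

lemma polyfun_monomial: "polyfun (\<lambda>\<xi>. c * (\<Prod>i\<in>UNIV. complex_of_real (\<xi> $ i) ^ (\<alpha> $ i)))"
proof -
  have "(\<lambda>\<xi>. c * (\<Prod>i\<in>UNIV. complex_of_real (\<xi> $ i) ^ (\<alpha> $ i))) = mpoly_eval (Poly_Mapping.single \<alpha> c)"
    by (rule ext) (simp add: mpoly_eval_eq_ceval ceval_single)
  then show ?thesis by simp
qed

lemma polyfun_add [intro]: "polyfun f \<Longrightarrow> polyfun g \<Longrightarrow> polyfun (\<lambda>\<xi>. f \<xi> + g \<xi>)"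
proof (elim polyfunE)
  fix p q assume "f = mpoly_eval p" "g = mpoly_eval q"
  then have "(\<lambda>\<xi>. f \<xi> + g \<xi>) = mpoly_eval (p + q)" by (auto simp: mpoly_eval_eq_ceval ceval_add)
  then show ?thesis by simp
qed

lemma polyfun_const [intro]: "polyfun (\<lambda>\<xi>. c)"
  using polyfun_monomial[of c 0] by simp

lemma polyfun_coord [intro]: "polyfun (\<lambda>\<xi>. complex_of_real (\<xi> $ k))"
proof -
  have "(\<Prod>i\<in>UNIV. complex_of_real (\<xi> $ i) ^ ((axis k 1 :: nat^'a) $ i)) = complex_of_real (\<xi> $ k)" for \<xi> :: "real^'a"
    by (subst prod.remove[of _ k]) (auto simp: axis_def intro!: prod.neutral)
  then show ?thesis using polyfun_monomial[of 1 "axis k 1"] by simp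
qed

lemma polyfun_sum [intro]: "(\<And>a. a \<in> A \<Longrightarrow> polyfun (f a)) \<Longrightarrow> polyfun (\<lambda>\<xi>. \<Sum>a\<in>A. f a \<xi>)"
  by (induction A rule: infinite_finite_induct) auto

lemma mpoly_eval_expand:
  "mpoly_eval p = (\<lambda>\<xi>. \<Sum>\<alpha>\<in>Poly_Mapping.keys p. Poly_Mapping.lookup p \<alpha> * (\<Prod>i\<in>UNIV. complex_of_real (\<xi> $ i) ^ (\<alpha> $ i)))"
  by (rule ext) (simp add: mpoly_eval_eq_ceval ceval_def)

lemma polyfun_mult [intro]: 
  assumes "polyfun f" "polyfun g" shows "polyfun (\<lambda>\<xi>. f \<xi> * g \<xi>)"
proof -
  obtain p q where pq: "f = mpoly_eval p" "g = mpoly_eval q" using assms by (auto elim!: polyfunE)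
  have e: "(\<lambda>\<xi>. f \<xi> * g \<xi>) = (\<lambda>\<xi>. \<Sum>\<alpha>\<in>Poly_Mapping.keys p. \<Sum>\<beta>\<in>Poly_Mapping.keys q.
      (Poly_Mapping.lookup p \<alpha> * Poly_Mapping.lookup q \<beta>) * (\<Prod>i\<in>UNIV. complex_of_real (\<xi> $ i) ^ ((\<alpha> + \<beta>) $ i)))"
    unfolding pq mpoly_eval_expand sum_product
    by (simp add: power_add prod.distrib mult_ac)
  show ?thesis unfolding e by (intro polyfun_sum polyfun_monomial)
qed

lemma polyfun_prod [intro]: "(\<And>a. a \<in> A \<Longrightarrow> polyfun (f a)) \<Longrightarrow> polyfun (\<lambda>\<xi>. \<Prod>a\<in>A. f a \<xi>)"
  by (induction A rule: infinite_finite_induct) auto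

lemma polyfun_power [intro]: "polyfun f \<Longrightarrow> polyfun (\<lambda>\<xi>. f \<xi> ^ k)"
  by (induction k) auto

lemma polyfun_diff [intro]: "polyfun f \<Longrightarrow> polyfun g \<Longrightarrow> polyfun (\<lambda>\<xi>. f \<xi> - g \<xi>)"
  using polyfun_add[of f "\<lambda>\<xi>. (-1) * g \<xi>"] polyfun_mult[OF polyfun_const, of g "-1"] by simp

lemma polyfun_cnj [intro]:
  assumes "polyfun f" shows "polyfun (\<lambda>\<xi>. cnj (f \<xi>))"
proof -
  obtain p where p: "f = mpoly_eval p" using assms by (auto elim!: polyfunE)
  have e: "(\<lambda>\<xi>. cnj (f \<xi>)) = (\<lambda>\<xi>. \<Sum>\<alpha>\<in>Poly_Mapping.keys p. cnj (Poly_Mapping.lookup p \<alpha>) * (\<Prod>i\<in>UNIV. complex_of_real (\<xi> $ i) ^ (\<alpha> $ i)))"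
    unfolding p mpoly_eval_expand by simp
  show ?thesis unfolding e by (intro polyfun_sum polyfun_monomial)
qed

lemma continuous_on_ceval [continuous_intros]:
  "continuous_on A f \<Longrightarrow> continuous_on A (\<lambda>x. ceval p (f x))"
  unfolding ceval_def by (intro continuous_intros)

lemma continuous_on_cvec [continuous_intros]:
  "continuous_on A f \<Longrightarrow> continuous_on A (\<lambda>x. cvec (f x))"
  unfolding cvec_def by (intro continuous_intros)

lemma continuous_on_mpoly_eval [continuous_intros]:
  "continuous_on A f \<Longrightarrow> continuous_on A (\<lambda>x. mpoly_eval (p :: (_, complex) mpolynomial) (f x))"
  unfolding mpoly_eval_eq_ceval by (intro continuous_intros)

text \<open>Every line through a point where the polynomial does not vanish meets its zero set in finitely
  many points. By Fubini's theorem almost every dilate of the zero set about that point is null,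
  and dilations preserve null sets.\<close>

lemma AE_mpoly_eval_nonzero:
  fixes p :: "('d::finite, complex) mpolynomial"
  assumes "mpoly_eval p \<xi>0 \<noteq> 0"
  shows "AE \<xi> in lborel. mpoly_eval p \<xi> \<noteq> 0"
proof -
  have line: "AE s in lborel. mpoly_eval p (\<xi>0 + s *\<^sub>R x) \<noteq> 0" for x
  proof -
    let ?r = "line_poly p (cvec \<xi>0) (cvec x)"
    have e: "mpoly_eval p (\<xi>0 + s *\<^sub>R x) = poly ?r (complex_of_real s)" for s
    proof -
      have "cvec (\<xi>0 + s *\<^sub>R x) = cvec \<xi>0 + complex_of_real s *s cvec x" by (simp add: vec_eq_iff)
      then show ?thesis by (simp add: poly_line_poly mpoly_eval_eq_ceval)
    qed
    have "?r \<noteq> 0" using assms e[of 0] by auto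
    then have "finite {z. poly ?r z = 0}" by (rule poly_roots_finite)
    then have "finite (complex_of_real -` {z. poly ?r z = 0})"
      by (rule finite_vimageI) (simp add: inj_on_def)
    then have "finite {s. mpoly_eval p (\<xi>0 + s *\<^sub>R x) = 0}"
      by (simp add: e vimage_def)
    then have "{s. mpoly_eval p (\<xi>0 + s *\<^sub>R x) = 0} \<in> null_sets lborel"
      by (rule finite_imp_null_set_lborel)
    then show ?thesis by (rule AE_I') auto
  qed
  have psf: "pair_sigma_finite (lborel :: (real^'d) measure) (lborel :: real measure)" ..
  have m: "(\<lambda>(x,s). mpoly_eval p (\<xi>0 + s *\<^sub>R x)) \<in> borel_measurable (lborel \<Otimes>\<^sub>M lborel)"
  proof -
    have "continuous_on UNIV (\<lambda>xs :: (real^'d) \<times> real. mpoly_eval p (\<xi>0 + snd xs *\<^sub>R fst xs))"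
      by (intro continuous_intros)
    then have "(\<lambda>xs :: (real^'d) \<times> real. mpoly_eval p (\<xi>0 + snd xs *\<^sub>R fst xs)) \<in> borel_measurable borel"
      by (rule borel_measurable_continuous_onI)
    moreover have "sets (lborel \<Otimes>\<^sub>M lborel) = sets (borel :: ((real^'d) \<times> real) measure)"
      by (simp add: borel_prod[symmetric] cong: sets_pair_measure_cong)
    ultimately show ?thesis by (simp add: case_prod_beta' cong: measurable_cong_sets)
  qed
  have "AE s in lborel. AE x in lborel. mpoly_eval p (\<xi>0 + s *\<^sub>R x) \<noteq> 0"
  proof (subst pair_sigma_finite.AE_commute[OF psf, symmetric])
    have "{xs \<in> space (lborel \<Otimes>\<^sub>M lborel). (\<lambda>(x,s). mpoly_eval p (\<xi>0 + s *\<^sub>R x)) xs \<noteq> 0} \<in> sets (lborel \<Otimes>\<^sub>M lborel)"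
      using m by measurable
    then show "{xs \<in> space (lborel \<Otimes>\<^sub>M lborel). mpoly_eval p (\<xi>0 + snd xs *\<^sub>R fst xs) \<noteq> 0} \<in> sets (lborel \<Otimes>\<^sub>M lborel)"
      by (simp add: case_prod_beta')
  qed (simp add: line)
  moreover have "AE s in lborel. s \<noteq> (0::real)" by (rule AE_lborel_singleton)
  ultimately have "AE s in lborel. s \<noteq> 0 \<and> (AE x in lborel. mpoly_eval p (\<xi>0 + s *\<^sub>R x) \<noteq> 0)"
    by eventually_elim auto
  moreover have "ae_filter (lborel :: real measure) \<noteq> bot"
    by (simp add: ae_filter_eq_bot_iff)
  ultimately obtain s where s: "s \<noteq> 0" "AE x in lborel. mpoly_eval p (\<xi>0 + s *\<^sub>R x) \<noteq> 0"
    using eventually_happens' by blast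
  have "AE \<xi> in distr lborel borel (\<lambda>x. \<xi>0 + s *\<^sub>R x). mpoly_eval p \<xi> \<noteq> 0"
  proof (subst AE_distr_iff)
    have "(mpoly_eval p) \<in> borel_measurable borel"
      by (intro borel_measurable_continuous_onI continuous_on_mpoly_eval continuous_on_id)
    then show "{x \<in> space borel. mpoly_eval p x \<noteq> 0} \<in> sets borel" by measurable
  qed (use s in auto)
  then have "AE \<xi> in density (distr lborel borel (\<lambda>x. \<xi>0 + s *\<^sub>R x)) (\<lambda>_. ennreal (\<bar>s\<bar> ^ DIM(real^'d))). mpoly_eval p \<xi> \<noteq> 0"
    by (subst AE_density) (auto elim: eventually_mono)
  then show ?thesis by (subst lborel_affine[OF s(1), of \<xi>0])
qed

lemma polyfun_eq_0_if_AE: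
  assumes "polyfun f" "AE \<xi> in lborel. f \<xi> = 0" shows "f \<xi> = 0"
proof (rule ccontr)
  assume nz: "f \<xi> \<noteq> 0"
  obtain p where p: "f = mpoly_eval p" using assms(1) by (rule polyfunE)
  have "AE \<xi> in lborel. f \<xi> \<noteq> 0" unfolding p by (rule AE_mpoly_eval_nonzero) (use nz p in simp)
  with assms(2) have "AE \<xi> in (lborel :: (real^'a) measure). False" by eventually_elim simp
  moreover have "ae_filter (lborel :: (real^'a) measure) \<noteq> bot" by (simp add: ae_filter_eq_bot_iff)
  ultimately show False using eventually_happens' by blast
qed

text \<open>Some polynomial inducing a given polynomial function.\<close>

definition poly_of :: "(real^'d::finite \<Rightarrow> complex) \<Rightarrow> ('d, complex) mpolynomial" where
  "poly_of f = (SOME p. f = mpoly_eval p)"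

lemma mpoly_eval_poly_of: "polyfun f \<Longrightarrow> mpoly_eval (poly_of f) \<xi> = f \<xi>"
  unfolding polyfun_def poly_of_def by (drule someI_ex) simp

section \<open>A one-variable inequality of Malgrange\<close>

definition circle_mean :: "(complex \<Rightarrow> complex) \<Rightarrow> real" where
  "circle_mean f = integral {0..1} (\<lambda>t. (cmod (f (cis (2 * pi * t))))\<^sup>2)"

lemma circle_mean_integrable:
  assumes "f holomorphic_on UNIV"
  shows "(\<lambda>t. (cmod (f (cis (2 * pi * t))))\<^sup>2) integrable_on {0..1}"
proof -
  have "continuous_on UNIV f" by (rule holomorphic_on_imp_continuous_on[OF assms])
  then have "continuous_on {0..1} (\<lambda>t. (cmod (f (cis (2 * pi * t))))\<^sup>2)"
    by (intro continuous_intros continuous_on_compose2[where f = "\<lambda>t. cis (2 * pi * t)" and g = f and t = UNIV]) auto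
  then show ?thesis by (rule integrable_continuous_real)
qed

lemma circle_mean_cong:
  assumes "\<And>z. cmod z = 1 \<Longrightarrow> cmod (f z) = cmod (g z)"
  shows "circle_mean f = circle_mean g"
  unfolding circle_mean_def using assms by simp

lemma mean_value_circle:
  assumes "h holomorphic_on UNIV"
  shows "((\<lambda>t. h (cis (2 * pi * t))) has_integral h 0) {0..1}"
proof -
  have "((\<lambda>u. h u / (u - 0)) has_contour_integral (2 * of_real pi * \<i> * h 0)) (circlepath 0 1)"
    by (rule Cauchy_integral_circlepath_simple) (use assms holomorphic_on_subset in auto)
  then have "((\<lambda>t. h (circlepath 0 1 t) / (circlepath 0 1 t - 0) * (2 * pi * \<i> * 1 * exp (2 * of_real pi * \<i> * t)))
      has_integral (2 * of_real pi * \<i> * h 0)) {0..1}"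
    by (simp add: has_contour_integral vector_derivative_circlepath)
  moreover have "circlepath 0 1 t = cis (2 * pi * t)" "exp (2 * of_real pi * \<i> * complex_of_real t) = cis (2 * pi * t)" for t
    by (simp_all add: circlepath cis_conv_exp mult_ac)
  ultimately have "((\<lambda>t. (2 * of_real pi * \<i>) * h (cis (2 * pi * t))) has_integral (2 * of_real pi * \<i> * h 0)) {0..1}"
    by (simp add: mult_ac)
  from has_integral_mult_right[OF this, of "1 / (2 * of_real pi * \<i>)"] show ?thesis
    by simp
qed

lemma circle_mean_ge:
  assumes "h holomorphic_on UNIV"
  shows "(cmod (h 0))\<^sup>2 \<le> circle_mean h"
proof -
  have h2: "(\<lambda>z. h z * h z) holomorphic_on UNIV" by (intro holomorphic_intros assms)
  have "norm (h 0 * h 0) = norm (integral {0..1} (\<lambda>t. h (cis (2 * pi * t)) * h (cis (2 * pi * t))))"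
    using mean_value_circle[OF h2] by (simp add: integral_unique)
  also have "\<dots> \<le> integral {0..1} (\<lambda>t. (cmod (h (cis (2 * pi * t))))\<^sup>2)"
    by (rule integral_norm_bound_integral)
       (use mean_value_circle[OF h2] circle_mean_integrable[OF assms] in \<open>auto simp: norm_mult power2_eq_square\<close>)
  finally show ?thesis by (simp add: circle_mean_def norm_mult power2_eq_square)
qed

lemma circle_mean_nonneg:
  assumes "f holomorphic_on UNIV"
  shows "0 \<le> circle_mean f"
  using circle_mean_ge[OF assms] zero_le_power2[of "cmod (f 0)"] by linarith

text \<open>By induction on the degree. If \<open>a\<close> is a root and \<open>p = (z - a) r\<close>, the coefficients of \<open>p\<close> are
  \<open>r\<^bsub>k-1\<^esub> - a r\<^sub>k\<close>. On the unit circle \<open>|z - a| = |1 - cnj a z|\<close>. The induction hypothesis for \<open>r\<close>, used with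
  \<open>h(z) (1 - cnj a z)\<close>, which is \<open>h(0)\<close> at \<open>0\<close>, bounds the first term, and used with
  \<open>h(z) (z - a)\<close>, which is \<open>- a h(0)\<close> at \<open>0\<close>, it bounds the second, both by the same mean. The base
  case is the mean value property of \<open>(h p)\<^sup>2\<close>.\<close>

lemma poly_coeff_circle_mean:
  assumes "h holomorphic_on UNIV" "degree p \<le> m"
  shows "(cmod (h 0 * coeff p k))\<^sup>2 \<le> 4 ^ m * circle_mean (\<lambda>z. h z * poly p z)"
  using assms
proof (induction m arbitrary: p h k)
  case 0
  then obtain c where p: "p = [:c:]" by (metis degree_eq_zeroE le_zero_eq)
  have hol: "(\<lambda>z. h z * poly p z) holomorphic_on UNIV" by (intro holomorphic_intros 0)
  have "(cmod (h 0 * poly p 0))\<^sup>2 \<le> circle_mean (\<lambda>z. h z * poly p z)"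
    by (rule circle_mean_ge[OF hol])
  moreover have "(cmod (h 0 * coeff p k))\<^sup>2 \<le> (cmod (h 0 * poly p 0))\<^sup>2"
    by (cases k) (auto simp: p)
  ultimately show ?case unfolding power_0 mult_1 by (rule order_trans[rotated])
next
  case (Suc m)
  show ?case
  proof (cases "degree p \<le> m")
    case True
    have "(cmod (h 0 * coeff p k))\<^sup>2 \<le> 4 ^ m * circle_mean (\<lambda>z. h z * poly p z)"
      by (rule Suc.IH) (use Suc.prems True in auto)
    moreover have "0 \<le> circle_mean (\<lambda>z. h z * poly p z)"
      by (rule circle_mean_nonneg) (intro holomorphic_intros Suc.prems)
    then have "0 \<le> 4 ^ m * circle_mean (\<lambda>z. h z * poly p z)" by simp
    ultimately show ?thesis unfolding power_Suc mult.assoc by linarith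
  next
    case False
    then obtain a where "poly p a = 0" using alg_closed_imp_poly_has_root[of p] by auto
    then obtain r where r: "p = [:- a, 1:] * r" by (auto simp: poly_eq_0_iff_dvd dvd_def)
    have "r \<noteq> 0" using False r by auto
    then have deg: "degree r \<le> m" using Suc.prems(2) unfolding r by (subst (asm) degree_mult_eq) auto
    define h1 where "h1 = (\<lambda>z. h z * (1 - cnj a * z))"
    define h2 where "h2 = (\<lambda>z. h z * (z - a))"
    have hol: "h1 holomorphic_on UNIV" "h2 holomorphic_on UNIV"
      unfolding h1_def h2_def by (intro holomorphic_intros Suc.prems)+
    let ?M = "circle_mean (\<lambda>z. h z * poly p z)"
    have pr: "poly p z = (z - a) * poly r z" for z by (simp add: r algebra_simps)
    have m1: "circle_mean (\<lambda>z. h1 z * poly r z) = ?M"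
    proof (rule circle_mean_cong)
      fix z :: complex assume z: "cmod z = 1"
      then have "z * cnj z = 1" by (simp add: complex_norm_square[symmetric])
      then have "1 - cnj a * z = z * cnj (z - a)" by (simp add: algebra_simps)
      then have "cmod (1 - cnj a * z) = cmod (z - a)" using z by (simp only: norm_mult complex_mod_cnj)
      then show "cmod (h1 z * poly r z) = cmod (h z * poly p z)"
        by (simp add: h1_def pr norm_mult)
    qed
    have m2: "circle_mean (\<lambda>z. h2 z * poly r z) = ?M"
      by (rule circle_mean_cong) (simp add: h2_def pr norm_mult)
    have b1: "(cmod (h 0 * coeff r j))\<^sup>2 \<le> 4 ^ m * ?M" for j
      using Suc.IH[OF hol(1) deg, of j] by (simp add: m1) (simp add: h1_def)
    have b2: "(cmod (a * (h 0 * coeff r j)))\<^sup>2 \<le> 4 ^ m * ?M" for j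
      using Suc.IH[OF hol(2) deg, of j] unfolding m2 by (simp add: h2_def norm_mult mult_ac)
    obtain c where c: "coeff p k = c - a * coeff r k" "c = 0 \<or> (\<exists>j. c = coeff r j)"
      unfolding r by (cases k) (auto simp: coeff_pCons)
    have bc: "(cmod (h 0 * c))\<^sup>2 \<le> 4 ^ m * ?M"
      using c(2) b1 order_trans[OF zero_le_power2 b1] by auto
    have "(cmod (h 0 * coeff p k))\<^sup>2 = (cmod (h 0 * c - a * (h 0 * coeff r k)))\<^sup>2"
      by (simp add: c(1) algebra_simps)
    also have "\<dots> \<le> (cmod (h 0 * c) + cmod (a * (h 0 * coeff r k)))\<^sup>2"
      by (rule power_mono[OF norm_triangle_ineq4]) simp
    also have "\<dots> \<le> 2 * (cmod (h 0 * c))\<^sup>2 + 2 * (cmod (a * (h 0 * coeff r k)))\<^sup>2"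
      using sum_squares_bound[of "cmod (h 0 * c)" "cmod (a * (h 0 * coeff r k))"]
      by (simp add: power2_sum)
    also have "\<dots> \<le> 2 * (4 ^ m * ?M) + 2 * (4 ^ m * ?M)"
      using bc b2[of k] by linarith
    finally show ?thesis by simp
  qed
qed

lemma poly_coeff_circle_sup:
  assumes "h holomorphic_on UNIV" "degree p \<le> m"
  shows "\<exists>z. cmod z = 1 \<and> (cmod (h 0 * coeff p k))\<^sup>2 \<le> 4 ^ m * (cmod (h z * poly p z))\<^sup>2"
proof -
  define g where "g t = (cmod (h (cis (2 * pi * t)) * poly p (cis (2 * pi * t))))\<^sup>2" for t :: real
  have hol: "(\<lambda>z. h z * poly p z) holomorphic_on UNIV" by (intro holomorphic_intros assms)
  have "continuous_on UNIV h" by (rule holomorphic_on_imp_continuous_on[OF assms(1)])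
  then have "continuous_on {0..1} g"
    unfolding g_def by (intro continuous_intros continuous_on_compose2[where f = "\<lambda>t. cis (2 * pi * t)" and g = h and t = UNIV]) auto
  then obtain t where t: "t \<in> {0..1}" "\<And>s. s \<in> {0..1} \<Longrightarrow> g s \<le> g t"
    using continuous_attains_sup[of "{0..1}" g] by auto
  have "circle_mean (\<lambda>z. h z * poly p z) = integral {0..1} g"
    by (simp add: circle_mean_def g_def[abs_def])
  also have "\<dots> \<le> integral {0..1} (\<lambda>_ :: real. g t)"
    by (rule Henstock_Kurzweil_Integration.integral_le) (use t circle_mean_integrable[OF hol] in \<open>auto simp: g_def[abs_def]\<close>)
  also have "\<dots> = g t" by simp
  finally have "4 ^ m * circle_mean (\<lambda>z. h z * poly p z) \<le> 4 ^ m * g t" by simp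
  with poly_coeff_circle_mean[OF assms, of k] have "(cmod (h 0 * coeff p k))\<^sup>2 \<le> 4 ^ m * g t" by linarith
  then show ?thesis by (intro exI[of _ "cis (2 * pi * t)"]) (auto simp: g_def)
qed

lemma poly_coeff_circle_nn:
  assumes "h holomorphic_on UNIV" "degree p \<le> m"
  shows "ennreal ((cmod (h 0 * coeff p k))\<^sup>2) \<le> 
    4 ^ m * (\<integral>\<^sup>+t. indicator {0..1} t * ennreal ((cmod (h (cis (2 * pi * t)) * poly p (cis (2 * pi * t))))\<^sup>2) \<partial>lborel)"
proof -
  have hol: "(\<lambda>z. h z * poly p z) holomorphic_on UNIV" by (intro holomorphic_intros assms)
  let ?f = "\<lambda>t. (cmod (h (cis (2 * pi * t)) * poly p (cis (2 * pi * t))))\<^sup>2"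
  have i: "(?f has_integral circle_mean (\<lambda>z. h z * poly p z)) {0..1}"
    unfolding circle_mean_def by (rule integrable_integral) (use circle_mean_integrable[OF hol] in simp)
  have "(\<integral>\<^sup>+t. indicator {0..1} t * ennreal (?f t) \<partial>lborel) = circle_mean (\<lambda>z. h z * poly p z)"
    using nn_integral_has_integral_lebesgue[OF _ i] by (simp add: ennreal_mult' ennreal_indicator)
  moreover have "ennreal ((cmod (h 0 * coeff p k))\<^sup>2) \<le> ennreal (4 ^ m * circle_mean (\<lambda>z. h z * poly p z))"
    by (rule ennreal_leI[OF poly_coeff_circle_mean[OF assms]])
  ultimately show ?thesis by (simp add: ennreal_mult' ennreal_power[symmetric])
qed

section \<open>The Fourier transform and Plancherel's theorem\<close>

definition zdot :: "complex^'d::finite \<Rightarrow> real^'d \<Rightarrow> complex" where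
  "zdot z x = (\<Sum>i\<in>UNIV. z $ i * complex_of_real (x $ i))"



definition axis_index :: "real^'d::finite \<Rightarrow> 'd" where
  "axis_index b = (SOME i. b = axis i 1)"

lemma axis_index_axis [simp]: "axis_index (axis i 1) = i"
  unfolding axis_index_def by (rule some_equality) (auto simp: axis_eq_axis)

lemma prod_Basis_vec: "(\<Prod>b\<in>(Basis :: (real^'d::finite) set). G b) = (\<Prod>i\<in>UNIV. G (axis i 1))"
proof -
  have B: "(Basis :: (real^'d) set) = range (\<lambda>i. axis i 1)" by (auto simp: Basis_vec_def)
  have inj: "inj (\<lambda>i. axis i (1::real) :: real^'d)" by (auto simp: inj_on_def axis_eq_axis)
  show ?thesis unfolding B by (subst prod.reindex[OF inj]) (simp add: o_def)
qed

text \<open>Lebesgue measure on \<open>real^'d\<close> is the image of the product measure indexed by the standard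
  basis.\<close>

lemma integral_lborel_prod_vec:
  fixes F :: "'d::finite \<Rightarrow> real \<Rightarrow> complex"
  assumes int: "\<And>i. integrable lborel (F i)"
  shows "(LINT x|lborel. (\<Prod>i\<in>UNIV. F i ((x :: real^'d) $ i))) = (\<Prod>i\<in>UNIV. LINT t|lborel. F i t)"
proof -
  have [measurable]: "F i \<in> borel_measurable borel" for i
    using borel_measurable_integrable[OF int[of i]] by simp
  interpret product_sigma_finite "\<lambda>_ :: real^'d. lborel :: real measure" ..
  have nth: "(\<Sum>b\<in>Basis. f b *\<^sub>R b) $ i = f (axis i 1)" for f :: "real^'d \<Rightarrow> real" and i
  proof -
    have "(\<Sum>b\<in>Basis. f b *\<^sub>R b) \<bullet> axis i 1 = f (axis i 1)"
      by (rule inner_sum_left_Basis) (auto simp: Basis_vec_def)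
    then show ?thesis by (simp add: inner_axis)
  qed
  have meas: "(\<lambda>x :: real^'d. \<Prod>i\<in>UNIV. F i (x $ i)) \<in> borel_measurable borel"
    by measurable
  have "(LINT x|lborel. (\<Prod>i\<in>UNIV. F i ((x :: real^'d) $ i)))
    = (LINT f|(\<Pi>\<^sub>M b\<in>Basis. lborel). (\<Prod>i\<in>UNIV. F i (f (axis i (1::real)))))"
    by (subst lborel_eq, subst integral_distr) (use meas in \<open>simp_all add: nth del: sum_component vector_scaleR_component\<close>)
  also have "\<dots> = (LINT f|(\<Pi>\<^sub>M b\<in>Basis. lborel). (\<Prod>b\<in>Basis. F (axis_index b) (f b)))"
    by (simp add: prod_Basis_vec)
  also have "\<dots> = (\<Prod>b\<in>Basis. LINT t|lborel. F (axis_index b) t)"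
    by (rule product_integral_prod) (auto simp: int)
  also have "\<dots> = (\<Prod>i\<in>UNIV. LINT t|lborel. F i t)" by (simp add: prod_Basis_vec)
  finally show ?thesis .
qed

lemma integrable_lborel_prod_vec:
  fixes F :: "'d::finite \<Rightarrow> real \<Rightarrow> real"
  assumes int: "\<And>i. integrable lborel (F i)" and nn: "\<And>i t. F i t \<ge> 0"
  shows "integrable lborel (\<lambda>x :: real^'d. (\<Prod>i\<in>UNIV. F i (x $ i)))"
proof -
  have [measurable]: "F i \<in> borel_measurable borel" for i
    using borel_measurable_integrable[OF int[of i]] by simp
  have e: "(\<Prod>i\<in>UNIV. F i (x $ i)) = (\<Prod>b\<in>Basis. F (axis_index b) (x \<bullet> b))" for x :: "real^'d"
    by (simp add: prod_Basis_vec inner_axis)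
  have "(\<integral>\<^sup>+x. ennreal (\<Prod>i\<in>UNIV. F i ((x :: real^'d) $ i)) \<partial>lborel) = (\<integral>\<^sup>+x. (\<Prod>b\<in>Basis. ennreal (F (axis_index b) (x \<bullet> b))) \<partial>lborel)"
    by (simp add: e prod_ennreal nn)
  also have "\<dots> = (\<Prod>b\<in>Basis. \<integral>\<^sup>+t. ennreal (F (axis_index b) t) \<partial>lborel)"
    by (subst nn_integral_lborel_prod) auto
  also have "\<dots> < \<infinity>"
    using int nn by (simp add: nn_integral_eq_integral prod_ennreal)
  finally show ?thesis
    by (intro integrableI_nonneg) (auto intro!: prod_nonneg nn)
qed

definition gauss :: "real^'d::finite \<Rightarrow> real" where
  "gauss x = exp (- (norm x)\<^sup>2 / 2)"

lemma gauss_prod: "gauss x = (\<Prod>i\<in>UNIV. exp (- (x $ i)\<^sup>2 / 2))"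
proof -
  have "(norm x)\<^sup>2 = (\<Sum>i\<in>UNIV. (x $ i)\<^sup>2)"
    unfolding power2_norm_eq_inner inner_vec_def by (simp add: power2_eq_square)
  then show ?thesis by (simp add: gauss_def sum_negf sum_divide_distrib flip: exp_sum)
qed

lemma gauss_pos: "gauss x > 0" and gauss_le_1: "gauss x \<le> 1"
  by (auto simp: gauss_def)

lemma gauss1_integrable: "integrable lborel (\<lambda>t::real. exp (- t\<^sup>2 / 2))"
proof -
  have "integrable lborel (\<lambda>t. sqrt (2 * pi) * std_normal_density t)"
    by simp
  then show ?thesis by (simp add: std_normal_density_def)
qed

lemma gauss_integrable: "integrable lborel (gauss :: real^'d::finite \<Rightarrow> real)"
  unfolding gauss_prod[abs_def]
  by (rule integrable_lborel_prod_vec) (use gauss1_integrable in auto)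

lemma gauss1_ft: 
  "(LINT t|lborel. complex_of_real (exp (- t\<^sup>2 / 2)) * exp (- \<i> * complex_of_real (s * t)))
    = complex_of_real (sqrt (2 * pi) * exp (- s\<^sup>2 / 2))"
proof -
  have "complex_of_real (exp (- (- s)\<^sup>2 / 2)) = char std_normal_distribution (- s)"
    by (simp add: char_std_normal_distribution)
  also have "\<dots> = (LINT t|lborel. std_normal_density t *\<^sub>R iexp (- s * t))"
    unfolding char_def by (subst integral_density) (auto simp: normal_density_nonneg)
  also have "\<dots> = (LINT t|lborel. complex_of_real (1 / sqrt (2 * pi)) * (complex_of_real (exp (- t\<^sup>2 / 2)) * exp (- \<i> * complex_of_real (s * t))))"
    by (simp add: std_normal_density_def scaleR_conv_of_real mult_ac)
  also have "\<dots> = complex_of_real (1 / sqrt (2 * pi)) * (LINT t|lborel. complex_of_real (exp (- t\<^sup>2 / 2)) * exp (- \<i> * complex_of_real (s * t)))"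
    by simp
  finally show ?thesis by (simp add: field_simps)
qed

text \<open>The Gaussian factorises over the coordinates, and in one dimension this is the characteristic
  function of the standard normal distribution.\<close>

lemma gauss_ft:
  fixes y :: "real^'d::finite"
  shows "(LINT x|lborel. complex_of_real (gauss x) * exp (- \<i> * zdot (cvec y) x)) = complex_of_real (sqrt (2 * pi) ^ CARD('d) * gauss y)"
proof -
  have "complex_of_real (gauss x) * exp (- \<i> * zdot (cvec y) x)
     = (\<Prod>i\<in>UNIV. complex_of_real (exp (- (x $ i)\<^sup>2 / 2)) * exp (- \<i> * complex_of_real (y $ i * x $ i)))" for x
    by (simp add: gauss_prod zdot_def prod.distrib sum_distrib_left sum_negf exp_sum[symmetric] flip: of_real_prod)
  then have "(LINT x|lborel. complex_of_real (gauss x) * exp (- \<i> * zdot (cvec y) x))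
     = (LINT x|lborel. (\<Prod>i\<in>UNIV. complex_of_real (exp (- (x $ i)\<^sup>2 / 2)) * exp (- \<i> * complex_of_real (y $ i * x $ i))))"
    by simp
  also have "\<dots> = (\<Prod>i\<in>UNIV. complex_of_real (sqrt (2 * pi) * exp (- (y $ i)\<^sup>2 / 2)))"
  proof (subst integral_lborel_prod_vec)
    fix i
    show "integrable lborel (\<lambda>t. complex_of_real (exp (- t\<^sup>2 / 2)) * exp (- \<i> * complex_of_real (y $ i * t)))"
      by (rule Bochner_Integration.integrable_bound[OF gauss1_integrable]) (auto simp: norm_mult)
  qed (simp only: gauss1_ft)
  also have "\<dots> = complex_of_real (sqrt (2 * pi) ^ CARD('d) * gauss y)"
    unfolding gauss_prod of_real_prod[symmetric] prod.distrib by simp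
  finally show ?thesis .
qed


text \<open>Continuous functions with compact support, the class for which Plancherel's theorem is proved.\<close>

definition cc :: "('a::euclidean_space \<Rightarrow> complex) \<Rightarrow> bool" where
  "cc f \<longleftrightarrow> continuous_on UNIV f \<and> bounded {x. f x \<noteq> 0}"

lemma cc_continuous_on: "cc f \<Longrightarrow> continuous_on UNIV f"
  by (simp add: cc_def)

lemma cc_box:
  assumes "cc f" obtains a where "\<And>x. x \<notin> cbox (- a) a \<Longrightarrow> f x = 0"
proof -
  obtain a where "{x. f x \<noteq> 0} \<subseteq> cbox (- a) a"
    using assms bounded_subset_cbox_symmetric unfolding cc_def by metis
  then show ?thesis using that[of a] by blast
qed

lemma cc_borel_measurable: "cc f \<Longrightarrow> f \<in> borel_measurable borel"
  by (rule borel_measurable_continuous_onI) (simp add: cc_def)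

lemma cc_integrable:
  assumes "cc f" shows "integrable lborel f"
proof -
  obtain a where a: "\<And>x. x \<notin> cbox (- a) a \<Longrightarrow> f x = 0" using cc_box[OF assms] by blast
  have "integrable lborel (\<lambda>x. indicator (cbox (- a) a) x *\<^sub>R f x)"
    by (rule borel_integrable_compact) (use assms in \<open>auto simp: cc_def intro: continuous_on_subset\<close>)
  moreover have "(\<lambda>x. indicator (cbox (- a) a) x *\<^sub>R f x) = f"
    using a by (auto simp: indicator_def)
  ultimately show ?thesis by simp
qed

lemma cc_bounded:
  assumes "cc f" obtains C where "C > 0" "\<And>x. cmod (f x) \<le> C"
proof -
  obtain a where a: "\<And>x. x \<notin> cbox (- a) a \<Longrightarrow> f x = 0" using cc_box[OF assms] by blast
  have "compact (f ` cbox (- a) a)"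
    by (rule compact_continuous_image) (use assms in \<open>auto simp: cc_def intro: continuous_on_subset\<close>)
  then obtain C where C: "C > 0" "\<And>y. y \<in> f ` cbox (- a) a \<Longrightarrow> norm y \<le> C"
    using compact_imp_bounded bounded_pos by metis
  have "cmod (f x) \<le> C" for x
    using C a by (cases "x \<in> cbox (- a) a") force+
  with C(1) show ?thesis using that by blast
qed

lemma cc_mult_left: "cc f \<Longrightarrow> continuous_on UNIV g \<Longrightarrow> cc (\<lambda>x. g x * f x)"
  unfolding cc_def by (auto intro!: continuous_intros elim!: bounded_subset)

lemma cc_mult_right: "cc f \<Longrightarrow> continuous_on UNIV g \<Longrightarrow> cc (\<lambda>x. f x * g x)"
  unfolding cc_def by (auto intro!: continuous_intros elim!: bounded_subset)

lemma LINT_eq_integral_cbox: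
  fixes f :: "'a::euclidean_space \<Rightarrow> complex"
  assumes "cc f" "\<And>x. x \<notin> cbox a b \<Longrightarrow> f x = 0"
  shows "(LINT x|lborel. f x) = integral (cbox a b) f"
proof -
  have "(\<lambda>y. if y \<in> cbox a b then f y else 0) = f" using assms(2) by auto
  then have "integral (cbox a b) f = integral UNIV f" using integral_restrict_UNIV[of "cbox a b" f] by simp
  then show ?thesis using integral_lborel[OF cc_integrable[OF assms(1)]] by simp
qed

lemma continuous_on_LINT_param:
  fixes F :: "'p::topological_space \<Rightarrow> 'a::euclidean_space \<Rightarrow> complex"
  assumes cont: "continuous_on UNIV (\<lambda>(w, y). F w y)"
    and supp: "\<And>w y. y \<notin> cbox a b \<Longrightarrow> F w y = 0"
  shows "continuous_on UNIV (\<lambda>w. LINT y|lborel. F w y)"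
proof -
  have eq: "(LINT y|lborel. F w y) = integral (cbox a b) (F w)" for w
  proof (rule LINT_eq_integral_cbox)
    have "continuous_on UNIV (\<lambda>y. (\<lambda>(w, y). F w y) (w, y))"
      by (rule continuous_on_compose2[OF cont continuous_on_Pair[OF continuous_on_const continuous_on_id]]) simp
    then show "cc (F w)" unfolding cc_def
      using supp by (auto intro!: bounded_subset[OF bounded_cbox[of a b]])
  qed (rule supp)
  have "continuous_on UNIV (\<lambda>w. integral (cbox a b) (F w))"
    by (rule integral_continuous_on_param) (rule continuous_on_subset[OF cont], simp)
  then show ?thesis by (simp add: eq)
qed

lemma LINT_translate:
  fixes f :: "'a::euclidean_space \<Rightarrow> complex"
  assumes "f \<in> borel_measurable borel"
  shows "(LINT x|lborel. f (a + x)) = (LINT x|lborel. f x)"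
proof -
  have "(LINT x|lborel. f x) = (LINT x|distr lborel borel ((+) a). f x)"
    by (simp add: lborel_distr_plus)
  also have "\<dots> = (LINT x|lborel. f (a + x))"
    by (rule integral_distr) (use assms in auto)
  finally show ?thesis by simp
qed

lemma LINT_scale:
  fixes f :: "'a::euclidean_space \<Rightarrow> complex"
  assumes "f \<in> borel_measurable borel" "c > 0"
  shows "(LINT x|lborel. f x) = complex_of_real (c ^ DIM('a)) * (LINT x|lborel. f (c *\<^sub>R x))"
proof -
  have "(LINT x|lborel. f x) = (LINT x|density (distr lborel borel (\<lambda>x. 0 + c *\<^sub>R x)) (\<lambda>_. ennreal (\<bar>c\<bar> ^ DIM('a))). f x)"
    by (rule arg_cong[where f = "\<lambda>M. integral\<^sup>L M f"], rule lborel_affine) (use assms in simp)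
  also have "\<dots> = (LINT x|distr lborel borel (\<lambda>x. 0 + c *\<^sub>R x). (\<bar>c\<bar> ^ DIM('a)) *\<^sub>R f x)"
    by (rule integral_density) (use assms in auto)
  also have "\<dots> = (LINT x|lborel. (\<bar>c\<bar> ^ DIM('a)) *\<^sub>R f (0 + c *\<^sub>R x))"
    by (rule integral_distr) (use assms in auto)
  also have "\<dots> = complex_of_real (c ^ DIM('a)) * (LINT x|lborel. f (c *\<^sub>R x))"
    using assms by (simp add: scaleR_conv_of_real)
  finally show ?thesis .
qed

definition ft :: "(real^'d::finite \<Rightarrow> complex) \<Rightarrow> complex^'d \<Rightarrow> complex" where
  "ft f z = (LINT x|lborel. f x * exp (- \<i> * zdot z x))"

lemma continuous_on_zdot [continuous_intros]:
  "continuous_on A f \<Longrightarrow> continuous_on A g \<Longrightarrow> continuous_on A (\<lambda>x. zdot (f x) (g x))"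
  unfolding zdot_def by (intro continuous_intros)

lemma cc_ft_integrand: "cc f \<Longrightarrow> cc (\<lambda>x. f x * exp (- \<i> * zdot z x))"
  by (rule cc_mult_right) (auto intro!: continuous_intros)

lemma zdot_cvec: "zdot (cvec \<xi>) x = complex_of_real (\<xi> \<bullet> x)"
  by (simp add: zdot_def inner_vec_def)

lemma zdot_add_right: "zdot z (x + y) = zdot z x + zdot z y"
  by (simp add: zdot_def algebra_simps sum.distrib)

lemma zdot_add_left: "zdot (z + w) x = zdot z x + zdot w x"
  by (simp add: zdot_def algebra_simps sum.distrib)

lemma cnj_exp_zdot_cvec: "cnj (exp (- \<i> * zdot (cvec \<xi>) x)) = exp (\<i> * zdot (cvec \<xi>) x)"
  by (simp add: zdot_cvec exp_cnj)

lemma continuous_on_ft: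
  assumes "cc f" shows "continuous_on UNIV (ft f)"
proof -
  obtain a where a: "\<And>x. x \<notin> cbox (- a) a \<Longrightarrow> f x = 0" using cc_box[OF assms] by blast
  have c: "continuous_on UNIV (\<lambda>wy :: (complex^'a) \<times> (real^'a). f (snd wy))"
    by (rule continuous_on_compose2[OF cc_continuous_on[OF assms]]) (auto intro!: continuous_intros)
  show ?thesis unfolding ft_def[abs_def]
    by (rule continuous_on_LINT_param[of _ "- a" a])
       (use a in \<open>auto simp: case_prod_beta' intro!: continuous_intros c\<close>)
qed

definition autocorr :: "(real^'d::finite \<Rightarrow> complex) \<Rightarrow> real^'d \<Rightarrow> complex" where
  "autocorr f w = (LINT y|lborel. f (y + w) * cnj (f y))"

lemma cc_autocorr:
  assumes "cc f" shows "cc (autocorr f)"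
proof -
  obtain a where a: "\<And>x. x \<notin> cbox (- a) a \<Longrightarrow> f x = 0" using cc_box[OF assms] by blast
  have c: "continuous_on UNIV (\<lambda>wy :: (real^'a) \<times> (real^'a). f (snd wy))"
     "continuous_on UNIV (\<lambda>wy :: (real^'a) \<times> (real^'a). f (snd wy + fst wy))"
    by (rule continuous_on_compose2[OF cc_continuous_on[OF assms]], auto intro!: continuous_intros)+
  have "continuous_on UNIV (autocorr f)" unfolding autocorr_def[abs_def]
    by (rule continuous_on_LINT_param[of _ "- a" a])
       (use a in \<open>auto simp: case_prod_beta' intro!: continuous_intros c\<close>)
  moreover have "bounded {w. autocorr f w \<noteq> 0}"
  proof -
    have "bounded {x. f x \<noteq> 0}" using assms by (simp add: cc_def)
    then obtain B where B: "\<And>x. f x \<noteq> 0 \<Longrightarrow> norm x \<le> B" unfolding bounded_iff by blast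
    have "norm w \<le> 2 * B" if "autocorr f w \<noteq> 0" for w
    proof -
      have "\<exists>y. f (y + w) * cnj (f y) \<noteq> 0"
      proof (rule ccontr)
        assume "\<not> ?thesis"
        then have "(\<lambda>y. f (y + w) * cnj (f y)) = (\<lambda>y. 0)" by auto
        then have "autocorr f w = 0" unfolding autocorr_def by simp
        with that show False by simp
      qed
      then obtain y where "norm (y + w) \<le> B" "norm y \<le> B" using B by fastforce
      then show ?thesis using norm_triangle_ineq4[of "y + w" y] by simp
    qed
    then show ?thesis unfolding bounded_iff by blast
  qed
  ultimately show ?thesis by (simp add: cc_def)
qed

text \<open>The autocorrelation is the convolution of \<open>f\<close> with the reflection of its conjugate.\<close>

lemma ft_autocorr:
  fixes f :: "real^'d::finite \<Rightarrow> complex"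
  assumes "cc f" shows "ft (autocorr f) (cvec \<xi>) = complex_of_real ((cmod (ft f (cvec \<xi>)))\<^sup>2)"
proof -
  let ?e = "\<lambda>w. exp (- \<i> * zdot (cvec \<xi>) w)"
  define F where "F y w = f (y + w) * cnj (f y) * ?e w" for y w
  have psf: "pair_sigma_finite (lborel :: (real^'d) measure) (lborel :: (real^'d) measure)" ..
  have "cc (\<lambda>(y, w). F y w)"
    unfolding cc_def
  proof
    have c: "continuous_on UNIV (\<lambda>yw :: (real^'d) \<times> (real^'d). f (fst yw))"
       "continuous_on UNIV (\<lambda>yw :: (real^'d) \<times> (real^'d). f (fst yw + snd yw))"
      by (rule continuous_on_compose2[OF cc_continuous_on[OF assms]], auto intro!: continuous_intros)+
    show "continuous_on UNIV (\<lambda>(y, w). F y w)"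
      unfolding F_def case_prod_beta' by (intro continuous_intros c)
    have "bounded {x. f x \<noteq> 0}" using assms by (simp add: cc_def)
    then obtain B where B: "\<And>x. f x \<noteq> 0 \<Longrightarrow> norm x \<le> B" unfolding bounded_iff by blast
    have "norm yw \<le> B + 2 * B" if "(\<lambda>(y, w). F y w) yw \<noteq> 0" for yw
    proof -
      obtain y w where yw: "yw = (y, w)" by (cases yw)
      with that have 1: "norm (y + w) \<le> B" "norm y \<le> B" using B by (auto simp: F_def)
      then have "norm w \<le> 2 * B" using norm_triangle_ineq4[of "y + w" y] by simp
      then show ?thesis using 1 norm_Pair_le[of y w] by (simp add: yw)
    qed
    then show "bounded {yw. (\<lambda>(y, w). F y w) yw \<noteq> 0}" unfolding bounded_iff by blast
  qed
  then have int: "integrable (lborel \<Otimes>\<^sub>M lborel) (\<lambda>(y, w). F y w)"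
    unfolding lborel_prod by (rule cc_integrable)
  have m: "(\<lambda>x. f x * ?e x) \<in> borel_measurable borel"
    by (rule cc_borel_measurable[OF cc_ft_integrand[OF assms]])
  have inner: "(LINT w|lborel. F y w) = cnj (f y * ?e y) * ft f (cvec \<xi>)" for y
  proof -
    have "F y w = (cnj (f y) * exp (\<i> * zdot (cvec \<xi>) y)) * (f (y + w) * ?e (y + w))" for w
      by (simp add: F_def zdot_add_right distrib_left exp_add exp_diff exp_minus field_simps)
    then have "(LINT w|lborel. F y w) = (cnj (f y) * exp (\<i> * zdot (cvec \<xi>) y)) * (LINT w|lborel. f (y + w) * ?e (y + w))"
      by simp
    also have "(LINT w|lborel. f (y + w) * ?e (y + w)) = ft f (cvec \<xi>)"
      unfolding ft_def by (rule LINT_translate[OF m])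
    finally show ?thesis by (simp only: complex_cnj_mult cnj_exp_zdot_cvec)
  qed
  have "ft (autocorr f) (cvec \<xi>) = (LINT w|lborel. LINT y|lborel. F y w)"
    unfolding ft_def autocorr_def F_def by simp
  also have "\<dots> = (LINT y|lborel. LINT w|lborel. F y w)"
    by (rule pair_sigma_finite.Fubini_integral[OF psf int])
  also have "\<dots> = (LINT y|lborel. cnj (f y * ?e y)) * ft f (cvec \<xi>)"
    unfolding inner by simp
  also have "(LINT y|lborel. cnj (f y * ?e y)) = cnj (ft f (cvec \<xi>))"
    unfolding ft_def 
    by (rule integral_bounded_linear[OF bounded_linear_cnj cc_integrable[OF cc_ft_integrand[OF assms]]])
  finally show ?thesis unfolding complex_norm_square by (simp add: mult.commute)
qed


lemma gauss_scaled_integrable: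
  assumes "\<delta> > 0"
  shows "integrable lborel (\<lambda>\<xi> :: real^'d::finite. gauss (\<delta> *\<^sub>R \<xi>))"
proof -
  have "integrable lborel (\<lambda>t. exp (- (0 + \<delta> * t)\<^sup>2 / 2))"
    using lborel_integrable_real_affine[OF gauss1_integrable, of \<delta> 0] assms by simp
  then have i: "integrable lborel (\<lambda>t. exp (- (\<delta> * t)\<^sup>2 / 2))" by simp
  have "gauss (\<delta> *\<^sub>R \<xi>) = (\<Prod>i\<in>UNIV. exp (- (\<delta> * \<xi> $ i)\<^sup>2 / 2))" for \<xi> :: "real^'d"
    by (simp add: gauss_prod)
  then show ?thesis
    using integrable_lborel_prod_vec[of "\<lambda>_ :: 'd. \<lambda>t. exp (- (\<delta> * t)\<^sup>2 / 2)", OF i] by simp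
qed

lemma continuous_on_gauss [continuous_intros]:
  "continuous_on A f \<Longrightarrow> continuous_on A (\<lambda>x. gauss (f x))"
  unfolding gauss_def by (intro continuous_intros) auto

lemma gauss_scaled_ft:
  fixes w :: "real^'d::finite"
  assumes "\<delta> > 0"
  shows "complex_of_real (\<delta> ^ CARD('d)) * (LINT \<xi>|lborel. complex_of_real (gauss (\<delta> *\<^sub>R \<xi>)) * exp (- \<i> * zdot (cvec \<xi>) w))
    = complex_of_real (sqrt (2 * pi) ^ CARD('d) * gauss ((1 / \<delta>) *\<^sub>R w))"
proof -
  let ?F = "\<lambda>\<eta> :: real^'d. complex_of_real (gauss \<eta>) * exp (- \<i> * zdot (cvec ((1 / \<delta>) *\<^sub>R w)) \<eta>)"
  have "(LINT \<eta>|lborel. ?F \<eta>) = complex_of_real (\<delta> ^ CARD('d)) * (LINT \<xi>|lborel. ?F (\<delta> *\<^sub>R \<xi>))"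
    by (subst LINT_scale[OF _ assms]) (auto intro!: borel_measurable_continuous_onI continuous_intros)
  moreover have "zdot (cvec ((1 / \<delta>) *\<^sub>R w)) (\<delta> *\<^sub>R \<xi>) = zdot (cvec \<xi>) w" for \<xi>
    using assms by (simp add: zdot_cvec inner_commute)
  ultimately show ?thesis using gauss_ft[of "(1 / \<delta>) *\<^sub>R w"] by simp
qed

text \<open>Fubini's theorem moves the Fourier transform from \<open>c\<close> to the Gaussian. The two dilations, of \<open>\<xi>\<close>
  by \<open>\<delta>\<close> and of the transformed Gaussian by \<open>1 / \<delta>\<close>, have reciprocal Jacobians.\<close>

lemma gauss_regularised:
  fixes c :: "real^'d::finite \<Rightarrow> complex"
  assumes c: "cc c" and \<delta>: "\<delta> > 0"
  shows "(LINT \<xi>|lborel. complex_of_real (gauss (\<delta> *\<^sub>R \<xi>)) * ft c (cvec \<xi>))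
    = complex_of_real (sqrt (2 * pi) ^ CARD('d)) * (LINT s|lborel. c (\<delta> *\<^sub>R s) * complex_of_real (gauss s))"
proof -
  define H where "H \<xi> w = complex_of_real (gauss (\<delta> *\<^sub>R \<xi>)) * (c w * exp (- \<i> * zdot (cvec \<xi>) w))" for \<xi> w
  have psf: "pair_sigma_finite (lborel :: (real^'d) measure) (lborel :: (real^'d) measure)" ..
  have nH: "norm (H \<xi> w) = gauss (\<delta> *\<^sub>R \<xi>) * cmod (c w)" for \<xi> w
    by (simp add: H_def norm_mult gauss_pos less_imp_le zdot_cvec)
  have ccw: "continuous_on UNIV (\<lambda>yw :: (real^'d) \<times> (real^'d). c (snd yw))"
    by (rule continuous_on_compose2[OF cc_continuous_on[OF c]]) (auto intro!: continuous_intros)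
  have "continuous_on UNIV (\<lambda>(\<xi>, w). H \<xi> w)"
    unfolding H_def case_prod_beta' by (intro continuous_intros ccw)
  then have mH: "(\<lambda>(\<xi>, w). H \<xi> w) \<in> borel_measurable (lborel \<Otimes>\<^sub>M lborel)"
    unfolding lborel_prod by (simp add: borel_measurable_continuous_onI)
  have Hc: "cc (H \<xi>)" for \<xi>
    unfolding H_def[abs_def] by (rule cc_mult_left[OF cc_ft_integrand[OF c]]) (intro continuous_intros)
  have int: "integrable (lborel \<Otimes>\<^sub>M lborel) (\<lambda>(\<xi>, w). H \<xi> w)"
    by (rule pair_sigma_finite.Fubini_integrable[OF psf mH])
       (simp_all add: nH cc_integrable[OF Hc] gauss_scaled_integrable[OF \<delta>])
  define g where "g = complex_of_real (\<delta> ^ CARD('d))"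
  have g0: "g \<noteq> 0" using \<delta> by (simp add: g_def)
  have "g * (LINT \<xi>|lborel. complex_of_real (gauss (\<delta> *\<^sub>R \<xi>)) * ft c (cvec \<xi>)) = g * (LINT \<xi>|lborel. LINT w|lborel. H \<xi> w)"
    unfolding ft_def H_def by simp
  also have "(LINT \<xi>|lborel. LINT w|lborel. H \<xi> w) = (LINT w|lborel. LINT \<xi>|lborel. H \<xi> w)"
    by (rule pair_sigma_finite.Fubini_integral[OF psf int, symmetric])
  also have "\<dots> = (LINT w|lborel. c w * (LINT \<xi>|lborel. complex_of_real (gauss (\<delta> *\<^sub>R \<xi>)) * exp (- \<i> * zdot (cvec \<xi>) w)))"
  proof (rule Bochner_Integration.integral_cong[OF refl])
    fix w
    have "H \<xi> w = c w * (complex_of_real (gauss (\<delta> *\<^sub>R \<xi>)) * exp (- \<i> * zdot (cvec \<xi>) w))" for \<xi>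
      by (simp add: H_def mult_ac)
    then show "(LINT \<xi>|lborel. H \<xi> w) = c w * (LINT \<xi>|lborel. complex_of_real (gauss (\<delta> *\<^sub>R \<xi>)) * exp (- \<i> * zdot (cvec \<xi>) w))"
      by simp
  qed
  also have "g * \<dots> = (LINT w|lborel. c w * (g * (LINT \<xi>|lborel. complex_of_real (gauss (\<delta> *\<^sub>R \<xi>)) * exp (- \<i> * zdot (cvec \<xi>) w))))"
    by (subst integral_mult_right_zero[symmetric]) (simp add: mult_ac)
  also have "\<dots> = (LINT w|lborel. c w * complex_of_real (sqrt (2 * pi) ^ CARD('d) * gauss ((1 / \<delta>) *\<^sub>R w)))"
    unfolding g_def gauss_scaled_ft[OF \<delta>] ..
  also have "\<dots> = (LINT w|lborel. complex_of_real (sqrt (2 * pi) ^ CARD('d)) * (c w * complex_of_real (gauss ((1 / \<delta>) *\<^sub>R w))))"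
    by (simp add: mult_ac)
  also have "\<dots> = complex_of_real (sqrt (2 * pi) ^ CARD('d)) * (LINT w|lborel. c w * complex_of_real (gauss ((1 / \<delta>) *\<^sub>R w)))"
    by (rule integral_mult_right_zero)
  also have "(LINT w|lborel. c w * complex_of_real (gauss ((1 / \<delta>) *\<^sub>R w)))
     = g * (LINT s|lborel. c (\<delta> *\<^sub>R s) * complex_of_real (gauss s))"
    unfolding g_def using \<delta>
    by (subst LINT_scale[OF _ \<delta>]) (auto intro!: borel_measurable_continuous_onI continuous_intros cc_continuous_on[OF c])
  finally have "g * (LINT \<xi>|lborel. complex_of_real (gauss (\<delta> *\<^sub>R \<xi>)) * ft c (cvec \<xi>))
    = g * (complex_of_real (sqrt (2 * pi) ^ CARD('d)) * (LINT s|lborel. c (\<delta> *\<^sub>R s) * complex_of_real (gauss s)))"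
    by (simp add: mult_ac)
  then show ?thesis using g0 by simp
qed

lemma gauss_mono_scale:
  assumes "0 < a" "a \<le> b" shows "gauss (b *\<^sub>R x) \<le> gauss (a *\<^sub>R x)"
proof -
  have "norm (a *\<^sub>R x) \<le> norm (b *\<^sub>R x)" using assms by (simp add: mult_right_mono)
  then have "(norm (a *\<^sub>R x))\<^sup>2 \<le> (norm (b *\<^sub>R x))\<^sup>2" by (rule power_mono) simp
  then show ?thesis by (simp add: gauss_def)
qed

text \<open>Apply \<open>gauss_regularised\<close> to the autocorrelation of \<open>f\<close>, whose transform is the square of the
  modulus of that of \<open>f\<close>, and let \<open>\<delta> \<rightarrow> 0\<close>. The left-hand side converges monotonically; on the right
  the average concentrates at \<open>0\<close>, where the autocorrelation is the integral of \<open>|f|\<^sup>2\<close>.\<close>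

theorem plancherel:
  fixes f :: "real^'d::finite \<Rightarrow> complex"
  assumes f: "cc f"
  shows "(\<integral>\<^sup>+\<xi>. ennreal ((cmod (ft f (cvec \<xi>)))\<^sup>2) \<partial>lborel) = ennreal ((2 * pi) ^ CARD('d) * (LINT x|lborel. (cmod (f x))\<^sup>2))"
proof -
  let ?c = "autocorr f"
  have c: "cc ?c" by (rule cc_autocorr[OF f])
  define \<delta> where "\<delta> k = 1 / real (Suc k)" for k
  have \<delta>: "\<delta> k > 0" for k by (simp add: \<delta>_def)
  have \<delta>0: "\<delta> \<longlonglongrightarrow> 0" unfolding \<delta>_def[abs_def] using LIMSEQ_inverse_real_of_nat by (simp add: inverse_eq_divide)
  let ?L = "(2 * pi) ^ CARD('d) * (LINT x|lborel. (cmod (f x))\<^sup>2)"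
  let ?A = "\<lambda>k. LINT \<xi>|lborel. gauss (\<delta> k *\<^sub>R \<xi>) * (cmod (ft f (cvec \<xi>)))\<^sup>2"
  have c0: "?c 0 = complex_of_real (LINT x|lborel. (cmod (f x))\<^sup>2)"
    unfolding autocorr_def by (simp add: complex_norm_square[symmetric] del: of_real_power)
  have A: "complex_of_real (?A k) = complex_of_real (sqrt (2 * pi) ^ CARD('d)) * (LINT s|lborel. ?c (\<delta> k *\<^sub>R s) * complex_of_real (gauss s))" for k
  proof -
    have "complex_of_real (?A k) = (LINT \<xi>|lborel. complex_of_real (gauss (\<delta> k *\<^sub>R \<xi>)) * ft ?c (cvec \<xi>))"
      unfolding ft_autocorr[OF f] of_real_mult[symmetric] by (rule integral_complex_of_real[symmetric])
    then show ?thesis using gauss_regularised[OF c \<delta>] by simp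
  qed
  have lim1: "(\<lambda>k. LINT s|lborel. ?c (\<delta> k *\<^sub>R s) * complex_of_real (gauss s)) \<longlonglongrightarrow> (LINT s|lborel. ?c 0 * complex_of_real (gauss (s :: real^'d)))"
  proof -
    obtain B where B: "\<And>x. cmod (?c x) \<le> B" using cc_bounded[OF c] by blast
    have cont: "continuous_on UNIV ?c" by (rule cc_continuous_on[OF c])
    show ?thesis
    proof (rule integral_dominated_convergence[where w = "\<lambda>s :: real^'d. B * gauss s"])
      show "(\<lambda>s :: real^'d. ?c 0 * complex_of_real (gauss s)) \<in> borel_measurable lborel"
        by (auto intro!: borel_measurable_continuous_onI continuous_intros)
      show "(\<lambda>s. ?c (\<delta> k *\<^sub>R s) * complex_of_real (gauss s)) \<in> borel_measurable lborel" for k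
        by (auto intro!: borel_measurable_continuous_onI continuous_intros continuous_on_compose2[OF cont])
      show "integrable lborel (\<lambda>s :: real^'d. B * gauss s)" by (simp add: gauss_integrable)
      show "AE s in lborel. (\<lambda>k. ?c (\<delta> k *\<^sub>R s) * complex_of_real (gauss s)) \<longlonglongrightarrow> ?c 0 * complex_of_real (gauss s)"
      proof (rule AE_I2)
        fix s :: "real^'d"
        have "(\<lambda>k. \<delta> k *\<^sub>R s) \<longlonglongrightarrow> 0 *\<^sub>R s" by (intro tendsto_intros \<delta>0)
        then have "(\<lambda>k. ?c (\<delta> k *\<^sub>R s)) \<longlonglongrightarrow> ?c (0 *\<^sub>R s)"
          using cont by (intro isCont_tendsto_compose[of _ ?c]) (auto simp: continuous_on_eq_continuous_at)
        then show "(\<lambda>k. ?c (\<delta> k *\<^sub>R s) * complex_of_real (gauss s)) \<longlonglongrightarrow> ?c 0 * complex_of_real (gauss s)"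
          by (intro tendsto_intros) simp
      qed
      show "AE s in lborel. norm (?c (\<delta> k *\<^sub>R s) * complex_of_real (gauss s)) \<le> B * gauss s" for k
        using B by (auto simp: norm_mult gauss_pos less_imp_le intro!: mult_right_mono)
    qed
  qed
  have g: "(LINT s|lborel. complex_of_real (gauss (s::real^'d))) = complex_of_real (sqrt (2 * pi) ^ CARD('d))"
    using gauss_ft[of "0::real^'d"] by (simp add: zdot_cvec gauss_def)
  have "complex_of_real ?L = complex_of_real (sqrt (2 * pi) ^ CARD('d)) * (LINT s|lborel. ?c 0 * complex_of_real (gauss (s :: real^'d)))"
  proof -
    have "(2 * pi) ^ CARD('d) = sqrt (2 * pi) ^ CARD('d) * sqrt (2 * pi) ^ CARD('d)"
      by (subst power_mult_distrib[symmetric]) (subst real_sqrt_mult_self, simp)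
    moreover have "(LINT s|lborel. ?c 0 * complex_of_real (gauss (s :: real^'d))) = ?c 0 * complex_of_real (sqrt (2 * pi) ^ CARD('d))"
      by (subst integral_mult_right_zero) (simp only: g)
    ultimately show ?thesis unfolding c0 by (simp only: of_real_mult mult_ac)
  qed
  with lim1 have "(\<lambda>k. complex_of_real (?A k)) \<longlonglongrightarrow> complex_of_real ?L"
    unfolding A by (auto intro!: tendsto_intros)
  then have "(\<lambda>k. Re (complex_of_real (?A k))) \<longlonglongrightarrow> Re (complex_of_real ?L)" by (rule tendsto_Re)
  then have "?A \<longlonglongrightarrow> ?L" by simp
  then have lim2: "(\<lambda>k. ennreal (?A k)) \<longlonglongrightarrow> ennreal ?L" by (intro tendsto_intros)
  have cf: "continuous_on UNIV (\<lambda>\<xi>. ft f (cvec \<xi>))"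
    by (rule continuous_on_compose2[OF continuous_on_ft[OF f]]) (auto intro!: continuous_intros)
  have bd: "cmod (ft f (cvec \<xi>)) \<le> (LINT x|lborel. cmod (f x))" for \<xi>
  proof -
    have "cmod (ft f (cvec \<xi>)) \<le> (LINT x|lborel. cmod (f x * exp (- \<i> * zdot (cvec \<xi>) x)))"
      unfolding ft_def by (rule integral_norm_bound)
    then show ?thesis by (simp add: norm_mult zdot_cvec)
  qed
  have A': "ennreal (?A k) = (\<integral>\<^sup>+\<xi>. ennreal (gauss (\<delta> k *\<^sub>R \<xi>) * (cmod (ft f (cvec \<xi>)))\<^sup>2) \<partial>lborel)" for k
  proof (rule nn_integral_eq_integral[symmetric])
    show "integrable lborel (\<lambda>\<xi>. gauss (\<delta> k *\<^sub>R \<xi>) * (cmod (ft f (cvec \<xi>)))\<^sup>2)"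
    proof (rule Bochner_Integration.integrable_bound)
      show "integrable lborel (\<lambda>\<xi>. gauss (\<delta> k *\<^sub>R \<xi>) * (LINT x|lborel. cmod (f x))\<^sup>2)"
        using gauss_scaled_integrable[OF \<delta>] by (rule integrable_mult_left)
      show "(\<lambda>\<xi>. gauss (\<delta> k *\<^sub>R \<xi>) * (cmod (ft f (cvec \<xi>)))\<^sup>2) \<in> borel_measurable lborel"
        by (auto intro!: borel_measurable_continuous_onI continuous_intros cf)
      show "AE \<xi> in lborel. norm (gauss (\<delta> k *\<^sub>R \<xi>) * (cmod (ft f (cvec \<xi>)))\<^sup>2) \<le> norm (gauss (\<delta> k *\<^sub>R \<xi>) * (LINT x|lborel. cmod (f x))\<^sup>2)"
        using bd by (auto simp: norm_mult gauss_pos less_imp_le intro!: mult_left_mono power_mono)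
    qed
  qed (simp add: gauss_pos less_imp_le)
  have lim3: "(\<lambda>k. \<integral>\<^sup>+\<xi>. ennreal (gauss (\<delta> k *\<^sub>R \<xi>) * (cmod (ft f (cvec \<xi>)))\<^sup>2) \<partial>lborel)
     \<longlonglongrightarrow> (\<integral>\<^sup>+\<xi>. ennreal ((cmod (ft f (cvec \<xi>)))\<^sup>2) \<partial>lborel)"
  proof (rule nn_integral_LIMSEQ)
    show "incseq (\<lambda>k \<xi>. ennreal (gauss (\<delta> k *\<^sub>R \<xi>) * (cmod (ft f (cvec \<xi>)))\<^sup>2))"
    proof (intro incseq_SucI le_funI ennreal_leI mult_right_mono)
      fix k and \<xi> :: "real^'d"
      show "gauss (\<delta> k *\<^sub>R \<xi>) \<le> gauss (\<delta> (Suc k) *\<^sub>R \<xi>)"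
        by (rule gauss_mono_scale[OF \<delta>]) (simp add: \<delta>_def frac_le)
    qed simp
    show "(\<lambda>\<xi>. ennreal (gauss (\<delta> k *\<^sub>R \<xi>) * (cmod (ft f (cvec \<xi>)))\<^sup>2)) \<in> borel_measurable lborel" for k
      by (intro measurable_compose[OF _ measurable_ennreal]) (auto intro!: borel_measurable_continuous_onI continuous_intros cf)
    show "(\<lambda>k. ennreal (gauss (\<delta> k *\<^sub>R \<xi>) * (cmod (ft f (cvec \<xi>)))\<^sup>2)) \<longlonglongrightarrow> ennreal ((cmod (ft f (cvec \<xi>)))\<^sup>2)" for \<xi>
    proof -
      have "(\<lambda>k. gauss (\<delta> k *\<^sub>R \<xi>) * (cmod (ft f (cvec \<xi>)))\<^sup>2) \<longlonglongrightarrow> exp (- (norm (0 *\<^sub>R \<xi>))\<^sup>2 / 2) * (cmod (ft f (cvec \<xi>)))\<^sup>2"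
        unfolding gauss_def by (intro tendsto_intros \<delta>0) simp
      then show ?thesis by (intro tendsto_ennrealI) simp
    qed
  qed
  show ?thesis using LIMSEQ_unique[OF lim3[folded A'] lim2] .
qed

section \<open>Smooth functions\<close>

lemma partial_deriv_has_derivative:
  assumes "(f has_derivative D) (at x)"
  shows "partial_deriv i f x = D (axis i 1)"
proof -
  have "((\<lambda>t. x + t *\<^sub>R axis i 1) has_derivative (\<lambda>t. t *\<^sub>R axis i (1::real))) (at 0)"
    by (auto intro!: derivative_eq_intros)
  moreover have "(f has_derivative D) (at (x + 0 *\<^sub>R axis i 1))" using assms by simp
  ultimately have "((\<lambda>t. f (x + t *\<^sub>R axis i 1)) has_derivative (\<lambda>t. D (t *\<^sub>R axis i 1))) (at 0)"
    using diff_chain_at[of "\<lambda>t. x + t *\<^sub>R axis i 1" _ 0 f D] by (simp add: o_def)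
  moreover have "D (t *\<^sub>R axis i 1) = t *\<^sub>R D (axis i 1)" for t
    using has_derivative_linear[OF assms] by (simp add: linear_scale)
  ultimately have "((\<lambda>t. f (x + t *\<^sub>R axis i 1)) has_vector_derivative D (axis i 1)) (at 0)"
    by (simp add: has_vector_derivative_def)
  then show ?thesis unfolding partial_deriv_def by (rule vector_derivative_at)
qed

lemma has_vector_derivative_line:
  assumes "f differentiable (at (x + s *\<^sub>R axis i 1))"
  shows "((\<lambda>t. f (x + t *\<^sub>R axis i 1)) has_vector_derivative partial_deriv i f (x + s *\<^sub>R axis i 1)) (at s)"
proof -
  obtain D where D: "(f has_derivative D) (at (x + s *\<^sub>R axis i 1))" using assms by (auto simp: differentiable_def)
  have "((\<lambda>t. x + t *\<^sub>R axis i 1) has_derivative (\<lambda>t. t *\<^sub>R axis i (1::real))) (at s)"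
    by (auto intro!: derivative_eq_intros)
  then have "((\<lambda>t. f (x + t *\<^sub>R axis i 1)) has_derivative (\<lambda>t. D (t *\<^sub>R axis i 1))) (at s)"
    using diff_chain_at[of "\<lambda>t. x + t *\<^sub>R axis i 1" _ s f D] D by (simp add: o_def)
  moreover have "D (t *\<^sub>R axis i 1) = t *\<^sub>R D (axis i 1)" for t
    using has_derivative_linear[OF D] by (simp add: linear_scale)
  ultimately show ?thesis
    by (simp add: has_vector_derivative_def partial_deriv_has_derivative[OF D])
qed

lemma iter_partial_deriv_simps [simp]:
  "iter_partial_deriv [] f = f"
  "iter_partial_deriv (i # is) f = partial_deriv i (iter_partial_deriv is f)"
  by (simp_all add: iter_partial_deriv_def)

lemma iter_partial_deriv_append: "iter_partial_deriv (is @ js) f = iter_partial_deriv is (iter_partial_deriv js f)"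
  by (simp add: iter_partial_deriv_def)

lemma smooth_differentiable: "smooth f \<Longrightarrow> f differentiable (at x)"
  unfolding smooth_def by (metis iter_partial_deriv_simps(1))

lemma smooth_iter: "smooth f \<Longrightarrow> smooth (iter_partial_deriv js f)"
  unfolding smooth_def by (metis iter_partial_deriv_append)

lemma smooth_partial: "smooth f \<Longrightarrow> smooth (partial_deriv i f)"
  using smooth_iter[of f "[i]"] by simp

lemma smooth_continuous_on: "smooth f \<Longrightarrow> continuous_on A f"
  by (meson continuous_at_imp_continuous_on differentiable_imp_continuous_within smooth_differentiable)

text \<open>The smooth functions are the largest class of differentiable functions closed under partial
  derivatives, so it suffices to exhibit some such class.\<close>

lemma smooth_coinduct:
  assumes "f \<in> F" "\<And>g x. g \<in> F \<Longrightarrow> g differentiable (at x)" "\<And>g i. g \<in> F \<Longrightarrow> partial_deriv i g \<in> F"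
  shows "smooth f"
proof -
  have "iter_partial_deriv is f \<in> F" for "is"
    by (induction "is") (use assms in auto)
  then show ?thesis unfolding smooth_def using assms(2) by blast
qed


text \<open>The algebra generated by all smooth functions and \<open>S\<close>. It serves to prove functions smooth whose
  derivatives are products of functions in \<open>S\<close> with smooth ones.\<close>

inductive_set smooth_alg :: "(real^'d::finite \<Rightarrow> complex) set \<Rightarrow> (real^'d \<Rightarrow> complex) set" for S where
  gen: "g \<in> S \<Longrightarrow> g \<in> smooth_alg S"
| smooth: "smooth g \<Longrightarrow> g \<in> smooth_alg S"
| add: "g \<in> smooth_alg S \<Longrightarrow> h \<in> smooth_alg S \<Longrightarrow> (\<lambda>x. g x + h x) \<in> smooth_alg S"
| mult: "g \<in> smooth_alg S \<Longrightarrow> h \<in> smooth_alg S \<Longrightarrow> (\<lambda>x. g x * h x) \<in> smooth_alg S"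

lemma partial_deriv_add:
  fixes f g :: "real^'d::finite \<Rightarrow> complex"
  assumes "f differentiable (at x)" "g differentiable (at x)"
  shows "partial_deriv i (\<lambda>x. f x + g x) x = partial_deriv i f x + partial_deriv i g x"
proof -
  obtain D E where D: "(f has_derivative D) (at x)" and E: "(g has_derivative E) (at x)"
    using assms by (auto simp: differentiable_def)
  show ?thesis
    using partial_deriv_has_derivative[OF has_derivative_add[OF D E]]
    by (simp add: partial_deriv_has_derivative[OF D] partial_deriv_has_derivative[OF E])
qed

lemma partial_deriv_mult:
  fixes f g :: "real^'d::finite \<Rightarrow> complex"
  assumes "f differentiable (at x)" "g differentiable (at x)"
  shows "partial_deriv i (\<lambda>x. f x * g x) x = f x * partial_deriv i g x + partial_deriv i f x * g x"
proof -
  obtain D E where D: "(f has_derivative D) (at x)" and E: "(g has_derivative E) (at x)"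
    using assms by (auto simp: differentiable_def)
  show ?thesis
    using partial_deriv_has_derivative[OF has_derivative_mult[OF D E]]
    by (simp add: partial_deriv_has_derivative[OF D] partial_deriv_has_derivative[OF E])
qed

text \<open>By the Leibniz rule the algebra is closed under partial derivatives as soon as it contains those of its
  generators.\<close>

lemma smooth_algI:
  assumes f: "f \<in> smooth_alg S"
    and diff: "\<And>g x. g \<in> S \<Longrightarrow> g differentiable (at x)"
    and pd: "\<And>g i. g \<in> S \<Longrightarrow> partial_deriv i g \<in> smooth_alg S"
  shows "smooth f"
proof (rule smooth_coinduct[OF f])
  have d: "\<forall>x. g differentiable (at x)" if "g \<in> smooth_alg S" for g
    using that by induction (auto simp: diff smooth_differentiable intro!: differentiable_add differentiable_mult)
  show "g differentiable (at x)" if "g \<in> smooth_alg S" for g x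
    using d[OF that] by blast
  show "partial_deriv i g \<in> smooth_alg S" if "g \<in> smooth_alg S" for g i
    using that
  proof induction
    case (gen g)
    then show ?case by (rule pd)
  next
    case (smooth g)
    then show ?case by (intro smooth_alg.smooth smooth_partial)
  next
    case (add g h)
    have "partial_deriv i (\<lambda>x. g x + h x) = (\<lambda>x. partial_deriv i g x + partial_deriv i h x)"
      by (rule ext) (intro partial_deriv_add d[OF add(1), rule_format] d[OF add(2), rule_format])
    then show ?case using add by (simp add: smooth_alg.add)
  next
    case (mult g h)
    have "partial_deriv i (\<lambda>x. g x * h x) = (\<lambda>x. g x * partial_deriv i h x + partial_deriv i g x * h x)"
      by (rule ext) (intro partial_deriv_mult d[OF mult(1), rule_format] d[OF mult(2), rule_format])
    then show ?case using mult by (simp add: smooth_alg.add smooth_alg.mult)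
  qed
qed

lemma smooth_add: "smooth f \<Longrightarrow> smooth g \<Longrightarrow> smooth (\<lambda>x. f x + g x :: complex)"
  by (rule smooth_algI[of _ "{}"]) (auto intro: smooth_alg.add smooth_alg.smooth)

lemma smooth_mult: "smooth f \<Longrightarrow> smooth g \<Longrightarrow> smooth (\<lambda>x. f x * g x :: complex)"
  by (rule smooth_algI[of _ "{}"]) (auto intro: smooth_alg.mult smooth_alg.smooth)

lemma partial_deriv_const: "partial_deriv i (\<lambda>x. c) = (\<lambda>x. 0)"
  by (rule ext) (rule partial_deriv_has_derivative[OF has_derivative_const])

lemma smooth_const: "smooth (\<lambda>x. c :: complex)"
  by (rule smooth_coinduct[of _ "range (\<lambda>c x. c)"]) (auto simp: partial_deriv_const)

lemma has_derivative_exp_zdot: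
  "((\<lambda>x. exp (zdot z x)) has_derivative (\<lambda>h. zdot z h * exp (zdot z x))) (at x)"
proof -
  have "((\<lambda>x. zdot z x) has_derivative zdot z) (at x)"
    unfolding zdot_def[abs_def]
    by (auto intro!: derivative_eq_intros bounded_linear.has_derivative[OF bounded_linear_vec_nth] simp: bounded_linear_vec_nth)
  from has_derivative_compose[OF this DERIV_exp[unfolded has_field_derivative_def]]
  show ?thesis by (simp add: mult.commute)
qed

lemma zdot_axis: "zdot z (axis i 1) = z $ i"
proof -
  have "zdot z (axis i 1) = (\<Sum>j\<in>UNIV. if j = i then z $ i else 0)"
    unfolding zdot_def by (rule sum.cong) (auto simp: axis_def)
  then show ?thesis by simp
qed

lemma partial_deriv_exp_zdot: "partial_deriv i (\<lambda>x. exp (zdot z x)) x = z $ i * exp (zdot z x)"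
  using partial_deriv_has_derivative[OF has_derivative_exp_zdot, of i z x] by (simp add: zdot_axis)

lemma smooth_exp_zdot: "smooth (\<lambda>x. exp (zdot z x))"
proof -
  have "smooth (\<lambda>x. 1 * exp (zdot z x))"
  proof (rule smooth_coinduct[of _ "range (\<lambda>a x. a * exp (zdot z x))"])
    fix g :: "real^'a \<Rightarrow> complex" and x i assume "g \<in> range (\<lambda>a x. a * exp (zdot z x))"
    then obtain a where g: "g = (\<lambda>x. a * exp (zdot z x))" by auto
    have d: "(\<lambda>x. exp (zdot z x)) differentiable (at x)" for x
      using has_derivative_exp_zdot by (auto simp: differentiable_def)
    show "g differentiable (at x)" unfolding g by (intro differentiable_mult d differentiable_const)
    have "partial_deriv i g = (\<lambda>x. (a * z $ i) * exp (zdot z x))"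
      unfolding g by (rule ext) (simp add: partial_deriv_mult d partial_deriv_exp_zdot partial_deriv_const)
    then show "partial_deriv i g \<in> range (\<lambda>a x. a * exp (zdot z x))" by auto
  qed (rule rangeI)
  then show ?thesis by simp
qed

lemma smooth_coord: "smooth (\<lambda>x. complex_of_real (x $ k))"
proof (rule smooth_coinduct[of _ "insert (\<lambda>x. complex_of_real (x $ k)) (range (\<lambda>c x. c))"])
  fix g :: "real^'a \<Rightarrow> complex" and x i assume g: "g \<in> insert (\<lambda>x. complex_of_real (x $ k)) (range (\<lambda>c x. c))"
  have d: "((\<lambda>x :: real^'a. complex_of_real (x $ k)) has_derivative (\<lambda>h. complex_of_real (h $ k))) (at x)" for x
    by (auto intro!: derivative_eq_intros bounded_linear.has_derivative[OF bounded_linear_vec_nth])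
  show "g differentiable (at x)" using g d by (auto simp: differentiable_def intro: has_derivative_const)
  show "partial_deriv i g \<in> insert (\<lambda>x. complex_of_real (x $ k)) (range (\<lambda>c x. c))"
    using g
  proof
    assume "g = (\<lambda>x. complex_of_real (x $ k))"
    then have "partial_deriv i g = (\<lambda>x. complex_of_real (axis i 1 $ k))"
      by (auto simp: partial_deriv_has_derivative[OF d])
    then show ?thesis by blast
  qed (auto simp: partial_deriv_const)
qed simp

lemma has_derivative_chi:
  fixes f :: "'n::finite \<Rightarrow> real^'d::finite \<Rightarrow> complex"
  assumes "\<And>n. (f n has_derivative f' n) (at x)"
  shows "((\<lambda>x. \<chi> n. f n x) has_derivative (\<lambda>h. \<chi> n. f' n h)) (at x)"
proof -
  have L: "bounded_linear (axis n :: complex \<Rightarrow> complex^'n)" for n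
    by (rule linear_conv_bounded_linear[THEN iffD1]) (auto intro!: linearI simp: vec_eq_iff axis_def)
  have e: "(\<chi> n. g n) = (\<Sum>n\<in>UNIV. axis n (g n))" for g :: "'n \<Rightarrow> complex"
    by (simp add: vec_eq_iff axis_def)
  show ?thesis unfolding e
    by (intro has_derivative_sum bounded_linear.has_derivative[OF L] assms)
qed

lemma iter_partial_deriv_nth:
  fixes u :: "real^'d::finite \<Rightarrow> complex^'n::finite"
  assumes "smooth u"
  shows "iter_partial_deriv is u x $ j = iter_partial_deriv is (\<lambda>x. u x $ j) x"
proof -
  have pd: "partial_deriv i v x $ j = partial_deriv i (\<lambda>x. v x $ j) x" if v: "v differentiable (at x)" for v :: "real^'d \<Rightarrow> complex^'n" and i x
  proof -
    obtain D where D: "(v has_derivative D) (at x)" using v by (auto simp: differentiable_def)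
    have "((\<lambda>x. v x $ j) has_derivative (\<lambda>h. D h $ j)) (at x)"
      by (rule bounded_linear.has_derivative[OF bounded_linear_vec_nth D])
    then show ?thesis by (simp add: partial_deriv_has_derivative[OF D] partial_deriv_has_derivative)
  qed
  have "(\<lambda>x. iter_partial_deriv is u x $ j) = iter_partial_deriv is (\<lambda>x. u x $ j)"
  proof (induction "is")
    case (Cons i "is")
    have "(\<lambda>x. iter_partial_deriv (i # is) u x $ j) = partial_deriv i (\<lambda>x. iter_partial_deriv is u x $ j)"
      using pd[of "iter_partial_deriv is u"] assms by (auto simp: smooth_def)
    then show ?case by (simp add: Cons)
  qed simp
  then show ?thesis by metis
qed

lemma smooth_nth:
  fixes u :: "real^'d::finite \<Rightarrow> complex^'n::finite"
  assumes "smooth u" shows "smooth (\<lambda>x. u x $ j)"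
  unfolding smooth_def
proof (intro allI)
  fix "is" x
  have "iter_partial_deriv is u differentiable (at x)" using assms by (auto simp: smooth_def)
  then obtain D where "(iter_partial_deriv is u has_derivative D) (at x)" by (auto simp: differentiable_def)
  then have "((\<lambda>x. iter_partial_deriv is u x $ j) has_derivative (\<lambda>h. D h $ j)) (at x)"
    by (rule bounded_linear.has_derivative[OF bounded_linear_vec_nth])
  then show "iter_partial_deriv is (\<lambda>x. u x $ j) differentiable (at x)"
    unfolding iter_partial_deriv_nth[OF assms] by (auto simp: differentiable_def)
qed

lemma smooth_chi:
  fixes f :: "'n::finite \<Rightarrow> real^'d::finite \<Rightarrow> complex"
  assumes "\<And>n. smooth (f n)" shows "smooth (\<lambda>x. \<chi> n. f n x)"
proof -
  have "iter_partial_deriv is (\<lambda>x. \<chi> n. f n x) = (\<lambda>x. \<chi> n. iter_partial_deriv is (f n) x)" for "is"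
  proof (induction "is")
    case (Cons i "is")
    show ?case unfolding iter_partial_deriv_simps Cons
    proof
      fix x
      have "\<exists>D. (iter_partial_deriv is (f n) has_derivative D) (at x)" for n
        using assms[of n] by (auto simp: smooth_def differentiable_def)
      then obtain D where D: "\<And>n. (iter_partial_deriv is (f n) has_derivative D n) (at x)" by metis
      show "partial_deriv i (\<lambda>x. \<chi> n. iter_partial_deriv is (f n) x) x = (\<chi> n. partial_deriv i (iter_partial_deriv is (f n)) x)"
        by (simp add: partial_deriv_has_derivative[OF has_derivative_chi[OF D]] partial_deriv_has_derivative[OF D])
    qed
  qed simp
  moreover have "(\<lambda>x. \<chi> n. iter_partial_deriv is (f n) x) differentiable (at x)" for "is" x
  proof -
    have "\<exists>D. (iter_partial_deriv is (f n) has_derivative D) (at x)" for n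
      using assms[of n] by (auto simp: smooth_def differentiable_def)
    then obtain D where D: "\<And>n. (iter_partial_deriv is (f n) has_derivative D n) (at x)" by metis
    have "((\<lambda>x. \<chi> n. iter_partial_deriv is (f n) x) has_derivative (\<lambda>h. \<chi> n. D n h)) (at x)"
      by (rule has_derivative_chi) (rule D)
    then show ?thesis by (auto simp: differentiable_def)
  qed
  ultimately show ?thesis by (simp add: smooth_def)
qed

section \<open>Test functions and their Fourier transforms\<close>

text \<open>The building blocks of bump functions: smooth functions vanishing on a half-line. The polynomial
  factor makes the family closed under differentiation.\<close>

definition flat :: "real poly \<Rightarrow> real \<Rightarrow> real" where
  "flat r t = (if t > 0 then poly r (1 / t) * exp (- (1 / t)) else 0)"

lemma poly_times_exp_tendsto_0: "((\<lambda>y. poly r y * exp (- y)) \<longlongrightarrow> (0 :: real)) at_top"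
proof -
  have "((\<lambda>y. \<Sum>k\<le>degree r. coeff r k * (y ^ k / exp y)) \<longlongrightarrow> (\<Sum>k\<le>degree r. coeff r k * 0)) at_top"
    by (intro tendsto_intros tendsto_power_div_exp_0)
  then show ?thesis by (simp add: poly_altdef sum_distrib_right exp_minus divide_inverse mult.assoc)
qed

lemma flat_tendsto_0: "(flat r \<longlongrightarrow> 0) (at 0)"
proof (rule filterlim_split_at)
  have "((\<lambda>t. poly r (inverse t) * exp (- inverse t)) \<longlongrightarrow> 0) (at_right 0)"
    by (rule filterlim_compose[OF poly_times_exp_tendsto_0 filterlim_inverse_at_top_right])
  moreover have "eventually (\<lambda>t. poly r (inverse t) * exp (- inverse t) = flat r t) (at_right 0)"
    by (simp add: eventually_at_right[of 0 1] flat_def inverse_eq_divide exI[of _ 1])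
  ultimately show "(flat r \<longlongrightarrow> 0) (at_right 0)" by (rule Lim_transform_eventually)
  have "eventually (\<lambda>t. 0 = flat r t) (at_left 0)"
    by (simp add: eventually_at_left[of "-1" 0] flat_def exI[of _ "-1"])
  then show "(flat r \<longlongrightarrow> 0) (at_left 0)" by (rule Lim_transform_eventually[OF tendsto_const])
qed

lemma flat_has_field_derivative:
  "(flat r has_field_derivative flat ((r - pderiv r) * [:0, 0, 1:]) t) (at t)"
proof -
  consider "t > 0" | "t < 0" | "t = 0" by linarith
  then show ?thesis
  proof cases
    case 1
    have "((\<lambda>t. poly r (1 / t) * exp (- (1 / t))) has_field_derivative
      (poly (pderiv r) (1 / t) * (- 1 / t\<^sup>2) * exp (- (1 / t)) + (exp (- (1 / t)) * (1 / t\<^sup>2)) * poly r (1 / t))) (at t)"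
      using 1 by (auto intro!: derivative_eq_intros DERIV_chain2[OF poly_DERIV] simp: power2_eq_square)
    moreover have "poly (pderiv r) (1 / t) * (- 1 / t\<^sup>2) * exp (- (1 / t)) + (exp (- (1 / t)) * (1 / t\<^sup>2)) * poly r (1 / t)
       = flat ((r - pderiv r) * [:0, 0, 1:]) t"
      using 1 by (simp add: flat_def field_simps power2_eq_square)
    ultimately have "((\<lambda>t. poly r (1 / t) * exp (- (1 / t))) has_field_derivative flat ((r - pderiv r) * [:0, 0, 1:]) t) (at t)"
      by simp
    then show ?thesis
      by (rule has_field_derivative_transform_within_open[where S = "{0<..}"]) (use 1 in \<open>auto simp: flat_def\<close>)
  next
    case 2
    then have "((\<lambda>t. 0) has_field_derivative flat ((r - pderiv r) * [:0, 0, 1:]) t) (at t)"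
      by (simp add: flat_def)
    then show ?thesis
      by (rule has_field_derivative_transform_within_open[where S = "{..<0}"]) (use 2 in \<open>auto simp: flat_def\<close>)
  next
    case 3
    have "(flat r h - flat r 0) / h = flat ([:0, 1:] * r) h" for h
      by (auto simp: flat_def)
    moreover have "flat ((r - pderiv r) * [:0, 0, 1:]) 0 = 0" by (simp add: flat_def)
    ultimately show ?thesis using flat_tendsto_0[of "[:0, 1:] * r"]
      unfolding 3 DERIV_def add_0 by (simp only:)
  qed
qed

definition test_fun :: "(real^'d::finite) set \<Rightarrow> (real^'d \<Rightarrow> complex) \<Rightarrow> bool" where
  "test_fun \<Omega> f \<longleftrightarrow> smooth f \<and> compact (closure {x. f x \<noteq> 0}) \<and> closure {x. f x \<noteq> 0} \<subseteq> \<Omega>"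

lemma test_fun_smooth: "test_fun \<Omega> f \<Longrightarrow> smooth f" by (simp add: test_fun_def)

lemma test_fun_subset:
  assumes "test_fun \<Omega> f" "smooth g" "{x. g x \<noteq> 0} \<subseteq> closure {x. f x \<noteq> 0}"
  shows "test_fun \<Omega> g"
proof -
  have s: "closure {x. g x \<noteq> 0} \<subseteq> closure {x. f x \<noteq> 0}"
    using closure_mono[OF assms(3)] by simp
  moreover have "compact (closure {x. g x \<noteq> 0})"
  proof (rule compact_closure[THEN iffD2])
    have "bounded (closure {x. f x \<noteq> 0})" using assms(1) by (simp add: test_fun_def compact_imp_bounded)
    then show "bounded {x. g x \<noteq> 0}" using assms(3) by (rule bounded_subset)
  qed
  ultimately show ?thesis using assms by (auto simp: test_fun_def)
qed

lemma test_fun_cc: "test_fun \<Omega> f \<Longrightarrow> cc f"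
  unfolding test_fun_def cc_def by (auto intro: smooth_continuous_on simp: compact_closure)

lemma test_fun_support: "test_fun \<Omega> f \<Longrightarrow> f x \<noteq> 0 \<Longrightarrow> x \<in> \<Omega>"
  unfolding test_fun_def using closure_subset by fastforce

text \<open>The composition of \<open>flat 1\<close> with \<open>\<rho>\<^sup>2 - |x - c|\<^sup>2\<close> is positive exactly on a ball. Derivatives of such
  compositions are again such compositions times affine functions, hence lie in the algebra that they
  generate.\<close>

lemma exists_test_fun_integral_nonzero:
  fixes \<Omega> :: "(real^'d::finite) set"
  assumes "open \<Omega>" "\<Omega> \<noteq> {}"
  shows "\<exists>\<phi>. test_fun \<Omega> \<phi> \<and> ft \<phi> 0 \<noteq> 0"
proof -
  obtain c where "c \<in> \<Omega>" using assms by blast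
  then obtain \<rho> where \<rho>: "\<rho> > 0" "cball c \<rho> \<subseteq> \<Omega>" using assms(1) open_contains_cball by blast
  define b where "b r x = complex_of_real (flat r (\<rho>\<^sup>2 - (x - c) \<bullet> (x - c)))" for r x
  have der: "(b r has_derivative (\<lambda>h. complex_of_real (flat ((r - pderiv r) * [:0, 0, 1:]) (\<rho>\<^sup>2 - (x - c) \<bullet> (x - c)) * (- 2 * ((x - c) \<bullet> h))))) (at x)" for r x
  proof -
    have "((\<lambda>x. \<rho>\<^sup>2 - (x - c) \<bullet> (x - c)) has_derivative (\<lambda>h. - 2 * ((x - c) \<bullet> h))) (at x)"
      by (auto intro!: derivative_eq_intros simp: inner_commute)
    from has_derivative_compose[OF this flat_has_field_derivative[unfolded has_field_derivative_def, of r]]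
    show ?thesis unfolding b_def[abs_def] by (rule has_derivative_of_real)
  qed
  have sm: "smooth (b r)" for r
  proof (rule smooth_algI[of _ "range b"])
    show "b r \<in> smooth_alg (range b)" by (rule smooth_alg.gen) simp
    show "g differentiable (at x)" if "g \<in> range b" for g x
      using that der by (auto simp: differentiable_def)
    show "partial_deriv i g \<in> smooth_alg (range b)" if g: "g \<in> range b" for g i
    proof -
      obtain r where r: "g = b r" using g by auto
      have ax: "y \<bullet> axis i 1 = y $ i" for y :: "real^'d" by (simp add: inner_axis)
      have "partial_deriv i g = (\<lambda>x. b ((r - pderiv r) * [:0, 0, 1:]) x * ((-2) * complex_of_real (x $ i) + complex_of_real (2 * c $ i)))"
        unfolding r by (rule_tac ext) (simp add: partial_deriv_has_derivative[OF der] b_def ax algebra_simps)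
      moreover have "smooth (\<lambda>x. (-2) * complex_of_real (x $ i) + complex_of_real (2 * c $ i))"
        by (intro smooth_add smooth_mult smooth_const smooth_coord)
      ultimately show ?thesis
        by (simp only: smooth_alg.mult[OF smooth_alg.gen smooth_alg.smooth] rangeI)
    qed
  qed
  have supp: "{x. b 1 x \<noteq> 0} = ball c \<rho>"
  proof -
    have "(b 1 x \<noteq> 0) = (dist c x < \<rho>)" for x
    proof -
      have "(b 1 x \<noteq> 0) = ((norm (x - c))\<^sup>2 < \<rho>\<^sup>2)"
        by (simp add: b_def flat_def power2_norm_eq_inner)
      also have "\<dots> = (norm (x - c) < \<rho>)"
      proof
        show "norm (x - c) < \<rho>" if "(norm (x - c))\<^sup>2 < \<rho>\<^sup>2"
          by (rule power2_less_imp_less[OF that]) (use \<rho>(1) in simp)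
        show "(norm (x - c))\<^sup>2 < \<rho>\<^sup>2" if "norm (x - c) < \<rho>"
          by (rule power_strict_mono[OF that]) auto
      qed
      finally show ?thesis by (simp add: dist_norm norm_minus_commute)
    qed
    then show ?thesis unfolding ball_def by (intro Collect_cong)
  qed
  have t: "test_fun \<Omega> (b 1)"
    unfolding test_fun_def supp using sm \<rho> by (auto simp: compact_closure)
  moreover have "ft (b 1) 0 \<noteq> 0"
  proof
    let ?g = "\<lambda>x. flat 1 (\<rho>\<^sup>2 - (x - c) \<bullet> (x - c))"
    assume "ft (b 1) 0 = 0"
    then have "(LINT x|lborel. b 1 x) = 0" by (simp add: ft_def zdot_def)
    then have 0: "(LINT x|lborel. ?g x) = 0" by (simp add: b_def)
    have "integrable lborel (b 1)" by (rule cc_integrable[OF test_fun_cc[OF t]])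
    then have "integrable lborel ?g" by (simp add: b_def[abs_def] complex_of_real_integrable_eq)
    then have "AE x in lborel. ?g x = 0"
      using 0 integral_nonneg_eq_0_iff_AE[of lborel ?g] by (simp add: flat_def)
    then have "AE x in lborel. \<not> (b 1 x \<noteq> 0)" by eventually_elim (simp add: b_def)
    then have "emeasure lborel (ball c \<rho>) = 0"
      by (subst (asm) AE_iff_measurable[of "ball c \<rho>"]) (use supp in auto)
    then have "measure lborel (ball c \<rho>) = 0" by (simp add: measure_def)
    then show False using content_ball_pos[OF \<rho>(1), of c] by simp
  qed
  ultimately show ?thesis by blast
qed

lemma partial_deriv_support: "{x. partial_deriv i f x \<noteq> 0} \<subseteq> closure {x. f x \<noteq> 0}"
proof
  fix x assume x: "x \<in> {x. partial_deriv i f x \<noteq> 0}"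
  show "x \<in> closure {x. f x \<noteq> 0}"
  proof (rule ccontr)
    assume n: "x \<notin> closure {x. f x \<noteq> 0}"
    have z: "f y = 0" if "y \<notin> closure {x. f x \<noteq> 0}" for y
      using that closure_subset[of "{x. f x \<noteq> 0}"] by (metis (mono_tags) mem_Collect_eq subsetD)
    have "((\<lambda>x. 0) has_derivative (\<lambda>h. 0)) (at x)" by simp
    then have "(f has_derivative (\<lambda>h. 0)) (at x)"
    proof (rule has_derivative_transform_within_open[where s = "- closure {x. f x \<noteq> 0}"])
      show "open (- closure {x. f x \<noteq> 0})" by (rule open_Compl) (rule closed_closure)
      show "x \<in> - closure {x. f x \<noteq> 0}" unfolding Compl_iff by (rule n)
      show "0 = f y" if "y \<in> - closure {x. f x \<noteq> 0}" for y
        using z[OF ComplD[OF that]] by (rule sym)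
    qed
    then have "partial_deriv i f x = 0" by (rule partial_deriv_has_derivative)
    with x show False by simp
  qed
qed

lemma test_fun_partial: "test_fun \<Omega> f \<Longrightarrow> test_fun \<Omega> (partial_deriv i f)"
  by (rule test_fun_subset[OF _ _ partial_deriv_support]) (auto simp: test_fun_smooth smooth_partial)

lemma test_fun_iter: "test_fun \<Omega> f \<Longrightarrow> test_fun \<Omega> (iter_partial_deriv is f)"
  by (induction "is") (auto intro: test_fun_partial)

lemma test_fun_mult: "test_fun \<Omega> f \<Longrightarrow> smooth g \<Longrightarrow> test_fun \<Omega> (\<lambda>x. g x * f x)"
  by (rule test_fun_subset[of \<Omega> f]) (use closure_subset[of "{x. f x \<noteq> 0}"] in \<open>auto intro: smooth_mult test_fun_smooth\<close>)

lemma test_fun_zero: "test_fun \<Omega> (\<lambda>x. 0)"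
  by (simp add: test_fun_def smooth_const)

lemma test_fun_add:
  assumes "test_fun \<Omega> f" "test_fun \<Omega> g" shows "test_fun \<Omega> (\<lambda>x. f x + g x)"
proof -
  have s: "{x. f x + g x \<noteq> 0} \<subseteq> {x. f x \<noteq> 0} \<union> {x. g x \<noteq> 0}" by auto
  have "closure {x. f x + g x \<noteq> 0} \<subseteq> closure {x. f x \<noteq> 0} \<union> closure {x. g x \<noteq> 0}"
    using closure_mono[OF s] by (simp add: closure_Un)
  moreover have "bounded {x. f x + g x \<noteq> 0}"
    by (rule bounded_subset[OF _ s]) (use assms in \<open>auto simp: test_fun_def compact_closure\<close>)
  ultimately show ?thesis using assms by (auto simp: test_fun_def smooth_add compact_closure)
qed

lemma test_fun_sum: "(\<And>a. a \<in> A \<Longrightarrow> test_fun \<Omega> (f a)) \<Longrightarrow> test_fun \<Omega> (\<lambda>x. \<Sum>a\<in>A. f a x)"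
  by (induction A rule: infinite_finite_induct) (auto intro: test_fun_zero test_fun_add)

lemma test_fun_cmult: "test_fun \<Omega> f \<Longrightarrow> test_fun \<Omega> (\<lambda>x. c * f x)"
  by (rule test_fun_mult) (auto intro: smooth_const)

text \<open>By translation invariance the difference quotients have integral zero. They are bounded, have a common
  bounded support and converge to the partial derivative.\<close>

lemma integral_partial_deriv:
  fixes f :: "real^'d::finite \<Rightarrow> complex"
  assumes f: "test_fun UNIV f"
  shows "(LINT x|lborel. partial_deriv i f x) = 0"
proof -
  let ?e = "axis i (1::real) :: real^'d"
  have cf: "cc f" and cp: "cc (partial_deriv i f)" using f by (auto intro: test_fun_cc test_fun_partial)
  obtain B where B: "B > 0" "\<And>x. cmod (partial_deriv i f x) \<le> B" using cc_bounded[OF cp] by blast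
  have "bounded {x. f x \<noteq> 0}" using cf by (simp add: cc_def)
  then obtain R where R: "\<And>x. f x \<noteq> 0 \<Longrightarrow> norm x \<le> R" unfolding bounded_iff by blast
  define t where "t k = 1 / real (Suc k)" for k
  have t: "t k > 0" "t k \<le> 1" for k by (auto simp: t_def)
  have t0: "t \<longlonglongrightarrow> 0" unfolding t_def[abs_def] using LIMSEQ_inverse_real_of_nat by (simp add: inverse_eq_divide)
  define q where "q k x = (f (t k *\<^sub>R ?e + x) - f x) / complex_of_real (t k)" for k x
  have lim: "(\<lambda>k. q k x) \<longlonglongrightarrow> partial_deriv i f x" for x
  proof -
    have "((\<lambda>s. f (x + s *\<^sub>R ?e)) has_vector_derivative partial_deriv i f (x + 0 *\<^sub>R ?e)) (at 0)"
      by (rule has_vector_derivative_line) (rule smooth_differentiable[OF test_fun_smooth[OF f]])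
    then have "((\<lambda>h. norm (f (x + h *\<^sub>R ?e) - f x - h *\<^sub>R partial_deriv i f x) / \<bar>h\<bar>) \<longlongrightarrow> 0) (at 0)"
      by (simp add: has_vector_derivative_def has_derivative_at)
    moreover have "filterlim t (at 0) sequentially"
      using t0 t(1) by (simp add: filterlim_at less_imp_neq[symmetric])
    ultimately have "(\<lambda>k. norm (f (x + t k *\<^sub>R ?e) - f x - t k *\<^sub>R partial_deriv i f x) / \<bar>t k\<bar>) \<longlonglongrightarrow> 0"
      by (rule filterlim_compose)
    moreover have "norm (f (x + t k *\<^sub>R ?e) - f x - t k *\<^sub>R partial_deriv i f x) / \<bar>t k\<bar> = norm (q k x - partial_deriv i f x)" for k
    proof -
      have "q k x - partial_deriv i f x = (f (x + t k *\<^sub>R ?e) - f x - t k *\<^sub>R partial_deriv i f x) / complex_of_real (t k)"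
        using t(1)[of k] by (simp add: q_def field_simps scaleR_conv_of_real)
      then show ?thesis by (simp add: norm_divide)
    qed
    ultimately have "(\<lambda>k. norm (q k x - partial_deriv i f x)) \<longlonglongrightarrow> 0" by simp
    then show ?thesis by (simp add: tendsto_norm_zero_iff LIM_zero_iff)
  qed
  have bound: "norm (q k x) \<le> B * indicat_real (cball 0 (R + 1)) x" for k x
  proof (cases "x \<in> cball 0 (R + 1)")
    case True
    have "norm (f (x + t k *\<^sub>R ?e) - f (x + 0 *\<^sub>R ?e)) \<le> B * norm (t k - 0)"
    proof (rule differentiable_bound[where S = UNIV and f = "\<lambda>s. f (x + s *\<^sub>R ?e)"])
      fix s
      show "((\<lambda>s. f (x + s *\<^sub>R ?e)) has_derivative (\<lambda>h. h *\<^sub>R partial_deriv i f (x + s *\<^sub>R ?e))) (at s)"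
        using has_vector_derivative_line[OF smooth_differentiable[OF test_fun_smooth[OF f]]]
        by (simp add: has_vector_derivative_def)
      show "onorm (\<lambda>h. h *\<^sub>R partial_deriv i f (x + s *\<^sub>R ?e)) \<le> B"
      proof (rule onorm_le)
        fix h :: real
        have "cmod (partial_deriv i f (x + s *\<^sub>R ?e)) * \<bar>h\<bar> \<le> B * \<bar>h\<bar>"
          by (rule mult_right_mono[OF B(2)]) simp
        then show "norm (h *\<^sub>R partial_deriv i f (x + s *\<^sub>R ?e)) \<le> B * norm h"
          by (simp add: mult.commute)
      qed
    qed auto
    then have "norm (f (t k *\<^sub>R ?e + x) - f x) \<le> B * t k" using t(1)[of k] by (simp add: add.commute)
    then show ?thesis using True t(1)[of k] by (simp add: q_def norm_divide divide_le_eq)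
  next
    case False
    have "f x = 0" using False R[of x] by auto
    moreover have "f (t k *\<^sub>R ?e + x) = 0"
    proof (rule ccontr)
      assume "f (t k *\<^sub>R ?e + x) \<noteq> 0"
      then have "norm (t k *\<^sub>R ?e + x) \<le> R" by (rule R)
      moreover have "norm x \<le> norm (t k *\<^sub>R ?e + x) + norm (t k *\<^sub>R ?e)"
        using norm_triangle_ineq4[of "t k *\<^sub>R ?e + x" "t k *\<^sub>R ?e"] by simp
      moreover have "norm (t k *\<^sub>R ?e) \<le> 1" using t[of k] by (simp add: less_imp_le)
      ultimately show False using False by simp
    qed
    ultimately show ?thesis using False by (simp add: q_def)
  qed
  have "(\<lambda>k. LINT x|lborel. q k x) \<longlonglongrightarrow> (LINT x|lborel. partial_deriv i f x)"
  proof (rule integral_dominated_convergence[where w = "\<lambda>x. B * indicat_real (cball 0 (R + 1)) x"])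
    show "integrable lborel (\<lambda>x :: real^'d. B * indicat_real (cball 0 (R + 1)) x)"
      by (intro integrable_mult_right integrable_real_indicator emeasure_bounded_finite) auto
    show "q k \<in> borel_measurable lborel" for k
      unfolding q_def[abs_def]
      by (auto intro!: borel_measurable_continuous_onI continuous_intros continuous_on_compose2[OF cc_continuous_on[OF cf]] cc_continuous_on[OF cf] simp: t_def)
  qed (use lim bound cc_borel_measurable[OF cp] in auto)
  moreover have "(LINT x|lborel. q k x) = 0" for k
  proof -
    have "(LINT x|lborel. f (t k *\<^sub>R ?e + x)) = (LINT x|lborel. f x)"
      by (rule LINT_translate[OF cc_borel_measurable[OF cf]])
    moreover have "integrable lborel (\<lambda>x. f (t k *\<^sub>R ?e + x))"
    proof -
      have "integrable (distr lborel borel ((+) (t k *\<^sub>R ?e))) f"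
        using cc_integrable[OF cf] by (simp add: lborel_distr_plus)
      then show ?thesis by (subst (asm) integrable_distr_eq) (use cc_borel_measurable[OF cf] in auto)
    qed
    ultimately show ?thesis unfolding q_def using cc_integrable[OF cf] by simp
  qed
  ultimately show ?thesis by (simp add: LIMSEQ_const_iff)
qed

text \<open>Integration by parts: the derivative of \<open>f(x) exp(-i z \<bullet> x)\<close> has integral zero.\<close>

lemma ft_partial:
  assumes f: "test_fun \<Omega> f"
  shows "ft (partial_deriv i f) z = \<i> * z $ i * ft f z"
proof -
  let ?e = "\<lambda>x. exp (- \<i> * zdot z x)"
  have ee: "?e = (\<lambda>x. exp (zdot (- \<i> *s z) x))"
    by (simp add: zdot_def sum_distrib_left mult_ac)
  have se: "smooth ?e" unfolding ee by (rule smooth_exp_zdot)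
  have fU: "test_fun UNIV f" using f by (simp add: test_fun_def)
  have "test_fun UNIV (\<lambda>x. ?e x * f x)" by (rule test_fun_mult[OF fU se])
  then have "(LINT x|lborel. partial_deriv i (\<lambda>x. ?e x * f x) x) = 0" by (rule integral_partial_deriv)
  moreover have "partial_deriv i (\<lambda>x. ?e x * f x) x = partial_deriv i f x * ?e x - \<i> * z $ i * (f x * ?e x)" for x
  proof -
    have "partial_deriv i ?e x = - \<i> * z $ i * ?e x"
      using partial_deriv_exp_zdot[of i "- \<i> *s z" x] fun_cong[OF ee, of x] unfolding ee[symmetric] by simp
    then show ?thesis
      using partial_deriv_mult[OF smooth_differentiable[OF se, of x] smooth_differentiable[OF test_fun_smooth[OF f], of x], of i]
      by (simp add: algebra_simps)
  qed
  ultimately have "(LINT x|lborel. partial_deriv i f x * ?e x - \<i> * z $ i * (f x * ?e x)) = 0" by simp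
  moreover have "integrable lborel (\<lambda>x. partial_deriv i f x * ?e x)" "integrable lborel (\<lambda>x. f x * ?e x)"
    by (rule cc_integrable[OF cc_ft_integrand[OF test_fun_cc[OF test_fun_partial[OF f]]]],
        rule cc_integrable[OF cc_ft_integrand[OF test_fun_cc[OF f]]])
  ultimately show ?thesis unfolding ft_def by simp
qed


lemma ft_sum:
  assumes "\<And>a. a \<in> A \<Longrightarrow> cc (f a)"
  shows "ft (\<lambda>x. \<Sum>a\<in>A. f a x) z = (\<Sum>a\<in>A. ft (f a) z)"
  unfolding ft_def sum_distrib_right
  by (rule Bochner_Integration.integral_sum) (rule cc_integrable[OF cc_ft_integrand[OF assms]])

lemma ft_cmult: "ft (\<lambda>x. c * f x) z = c * ft f z"
  unfolding ft_def mult.assoc by (rule integral_mult_right_zero)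

lemma prod_count_list_Cons:
  fixes g :: "'d::finite \<Rightarrow> complex"
  shows "(\<Prod>i\<in>UNIV. g i ^ count_list (a # xs) i) = g a * (\<Prod>i\<in>UNIV. g i ^ count_list xs i)"
proof -
  have "(\<Prod>i\<in>UNIV. g i ^ count_list (a # xs) i) = (\<Prod>i\<in>UNIV. (if i = a then g a else 1) * g i ^ count_list xs i)"
    by (rule prod.cong) auto
  then show ?thesis by (simp add: prod.distrib)
qed

lemma ft_iter:
  assumes "test_fun \<Omega> f"
  shows "ft (iter_partial_deriv is f) z = (\<Prod>i\<in>UNIV. (\<i> * z $ i) ^ count_list is i) * ft f z"
proof (induction "is")
  case (Cons i "is")
  show ?case unfolding prod_count_list_Cons iter_partial_deriv_simps
    by (subst ft_partial[OF test_fun_iter[OF assms]]) (simp add: Cons mult_ac)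
qed simp

lemma ft_mi_deriv:
  assumes "test_fun \<Omega> f"
  shows "ft (mi_deriv \<alpha> f) z = \<i> ^ mi_order \<alpha> * (\<Prod>i\<in>UNIV. (z $ i) ^ (\<alpha> $ i)) * ft f z"
  unfolding mi_deriv_mi_list ft_iter[OF assms] count_mi_list
  by (simp add: power_mult_distrib prod.distrib mi_order_def power_sum)

definition scalar_op :: "('d::finite, complex) mpolynomial \<Rightarrow> (real^'d \<Rightarrow> complex) \<Rightarrow> real^'d \<Rightarrow> complex" where
  "scalar_op p f x = (\<Sum>\<alpha>\<in>Poly_Mapping.keys p. (- \<i>) ^ mi_order \<alpha> * Poly_Mapping.lookup p \<alpha> * mi_deriv \<alpha> f x)"

lemma test_fun_scalar_op: "test_fun \<Omega> f \<Longrightarrow> test_fun \<Omega> (scalar_op p f)"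
  unfolding scalar_op_def[abs_def] mi_deriv_mi_list by (intro test_fun_sum test_fun_cmult test_fun_iter)

lemma ft_scalar_op:
  assumes "test_fun \<Omega> f"
  shows "ft (scalar_op p f) z = ceval p z * ft f z"
proof -
  have "ft (scalar_op p f) z = (\<Sum>\<alpha>\<in>Poly_Mapping.keys p. ft (\<lambda>x. (- \<i>) ^ mi_order \<alpha> * Poly_Mapping.lookup p \<alpha> * mi_deriv \<alpha> f x) z)"
    unfolding scalar_op_def[abs_def] mi_deriv_mi_list
    by (rule ft_sum) (intro test_fun_cc[where \<Omega> = \<Omega>] test_fun_cmult test_fun_iter assms)
  also have "\<dots> = (\<Sum>\<alpha>\<in>Poly_Mapping.keys p. Poly_Mapping.lookup p \<alpha> * (\<Prod>i\<in>UNIV. (z $ i) ^ (\<alpha> $ i)) * ft f z)"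
  proof (rule sum.cong[OF refl])
    fix \<alpha> :: "'a multi_index"
    have "(- \<i>) ^ mi_order \<alpha> * \<i> ^ mi_order \<alpha> = 1" by (simp add: power_mult_distrib[symmetric] del: power_minus)
    then show "ft (\<lambda>x. (- \<i>) ^ mi_order \<alpha> * Poly_Mapping.lookup p \<alpha> * mi_deriv \<alpha> f x) z = Poly_Mapping.lookup p \<alpha> * (\<Prod>i\<in>UNIV. (z $ i) ^ (\<alpha> $ i)) * ft f z"
      unfolding ft_cmult ft_mi_deriv[OF assms] by (metis (no_types, lifting) mult.assoc mult.commute mult_1)
  qed
  finally show ?thesis by (simp add: ceval_def sum_distrib_right)
qed

definition entry :: "('d::finite, complex^'n::finite^'m::finite) mpolynomial \<Rightarrow> 'm \<Rightarrow> 'n \<Rightarrow> ('d, complex) mpolynomial" where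
  "entry P i j = Poly_Mapping.map (\<lambda>A. A $ i $ j) P"

lemma lookup_entry: "Poly_Mapping.lookup (entry P i j) \<alpha> = Poly_Mapping.lookup P \<alpha> $ i $ j"
  by (simp add: entry_def Poly_Mapping.map.rep_eq when_def)

lemma keys_entry: "Poly_Mapping.keys (entry P i j) \<subseteq> Poly_Mapping.keys P"
  by (auto simp: in_keys_iff lookup_entry)

lemma mpoly_eval_nth: "mpoly_eval P \<xi> $ i $ j = mpoly_eval (entry P i j) \<xi>"
proof -
  have "mpoly_eval (entry P i j) \<xi> = (\<Sum>\<alpha>\<in>Poly_Mapping.keys P. mi_power \<xi> \<alpha> *\<^sub>R Poly_Mapping.lookup (entry P i j) \<alpha>)"
    unfolding mpoly_eval_def by (rule sum.mono_neutral_left) (use keys_entry in \<open>auto simp: in_keys_iff\<close>)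
  then show ?thesis by (simp add: mpoly_eval_def lookup_entry)
qed

text \<open>The estimate is transferred to the components, on which all operators act as scalar ones.\<close>

lemma test_functions_iff:
  "u \<in> test_functions \<Omega> \<longleftrightarrow> (\<forall>j. test_fun \<Omega> (\<lambda>x. u x $ j))"
proof
  assume u: "u \<in> test_functions \<Omega>"
  show "\<forall>j. test_fun \<Omega> (\<lambda>x. u x $ j)"
  proof
    fix j
    have s: "{x. u x $ j \<noteq> 0} \<subseteq> {x. u x \<noteq> 0}" by auto
    have "bounded {x. u x $ j \<noteq> 0}"
      using u by (intro bounded_subset[OF _ s]) (simp add: test_functions_def compact_closure)
    then show "test_fun \<Omega> (\<lambda>x. u x $ j)"
      using u closure_mono[OF s] by (auto simp: test_fun_def test_functions_def compact_closure intro: smooth_nth)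
  qed
next
  assume u: "\<forall>j. test_fun \<Omega> (\<lambda>x. u x $ j)"
  have e: "{x. u x \<noteq> 0} = (\<Union>j. {x. u x $ j \<noteq> 0})" by (auto simp: vec_eq_iff)
  have "smooth (\<lambda>x. \<chi> j. u x $ j)" by (rule smooth_chi) (use u in \<open>simp add: test_fun_def\<close>)
  then have "smooth u" by simp
  moreover have "bounded {x. u x \<noteq> 0}" unfolding e
    using u by (auto simp: test_fun_def compact_closure)
  moreover have "closure {x. u x \<noteq> 0} \<subseteq> \<Omega>"
  proof -
    have "closure {x. u x \<noteq> 0} \<subseteq> (\<Union>j. closure {x. u x $ j \<noteq> 0})" unfolding e
      by (rule closure_minimal) (auto simp: closure_subset[THEN subsetD])
    also have "\<dots> \<subseteq> \<Omega>" using u by (auto simp: test_fun_def)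
    finally show ?thesis .
  qed
  ultimately show "u \<in> test_functions \<Omega>" by (simp add: test_functions_def compact_closure)
qed

lemma diff_operator_nth:
  assumes "smooth u"
  shows "diff_operator P u x $ i = (\<Sum>j\<in>UNIV. scalar_op (entry P i j) (\<lambda>x. u x $ j) x)"
proof -
  have s: "scalar_op (entry P i j) (\<lambda>x. u x $ j) x =
      (\<Sum>\<alpha>\<in>Poly_Mapping.keys P. (- \<i>) ^ mi_order \<alpha> * Poly_Mapping.lookup P \<alpha> $ i $ j * mi_deriv \<alpha> u x $ j)" for j
  proof -
    have "scalar_op (entry P i j) (\<lambda>x. u x $ j) x =
      (\<Sum>\<alpha>\<in>Poly_Mapping.keys P. (- \<i>) ^ mi_order \<alpha> * Poly_Mapping.lookup (entry P i j) \<alpha> * mi_deriv \<alpha> (\<lambda>x. u x $ j) x)"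
      unfolding scalar_op_def by (rule sum.mono_neutral_left) (use keys_entry in \<open>auto simp: in_keys_iff\<close>)
    then show ?thesis by (simp add: lookup_entry mi_deriv_mi_list iter_partial_deriv_nth[OF assms])
  qed
  have "diff_operator P u x $ i = (\<Sum>\<alpha>\<in>Poly_Mapping.keys P. \<Sum>j\<in>UNIV. (- \<i>) ^ mi_order \<alpha> * Poly_Mapping.lookup P \<alpha> $ i $ j * mi_deriv \<alpha> u x $ j)"
    by (simp add: diff_operator_def matrix_vector_mult_def sum_distrib_left mult.assoc)
  also have "\<dots> = (\<Sum>j\<in>UNIV. scalar_op (entry P i j) (\<lambda>x. u x $ j) x)"
    unfolding s by (rule sum.swap)
  finally show ?thesis .
qed

lemma test_fun_diff_operator:
  assumes "u \<in> test_functions \<Omega>"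
  shows "test_fun \<Omega> (\<lambda>x. diff_operator P u x $ i)"
proof -
  have "smooth u" using assms by (simp add: test_functions_def)
  from diff_operator_nth[OF this] have "(\<lambda>x. diff_operator P u x $ i) = (\<lambda>x. \<Sum>j\<in>UNIV. scalar_op (entry P i j) (\<lambda>x. u x $ j) x)"
    by blast
  then show ?thesis
    using assms by (simp only: test_fun_sum test_fun_scalar_op test_functions_iff)
qed

lemma ft_diff_operator:
  assumes "u \<in> test_functions \<Omega>"
  shows "ft (\<lambda>x. diff_operator P u x $ i) z = (\<Sum>j\<in>UNIV. ceval (entry P i j) z * ft (\<lambda>x. u x $ j) z)"
proof -
  have s: "smooth u" using assms by (simp add: test_functions_def)
  have t: "test_fun \<Omega> (\<lambda>x. u x $ j)" for j using assms by (simp add: test_functions_iff)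
  have "ft (\<lambda>x. diff_operator P u x $ i) z = (\<Sum>j\<in>UNIV. ft (scalar_op (entry P i j) (\<lambda>x. u x $ j)) z)"
    unfolding diff_operator_nth[OF s] by (rule ft_sum) (rule test_fun_cc[OF test_fun_scalar_op[OF t]])
  then show ?thesis by (simp add: ft_scalar_op[OF t])
qed

definition l2_sq :: "(real^'d::finite \<Rightarrow> complex) \<Rightarrow> real" where
  "l2_sq f = (LINT x|lborel. (cmod (f x))\<^sup>2)"

lemma cc_l2_sq_integrable: assumes "cc f" shows "integrable lborel (\<lambda>x. (cmod (f x))\<^sup>2)"
proof -
  have "cc (\<lambda>x. cnj (f x) * f x)"
    by (rule cc_mult_left[OF assms]) (intro continuous_intros cc_continuous_on[OF assms])
  then have "integrable lborel (\<lambda>x. complex_of_real ((cmod (f x))\<^sup>2))"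
    unfolding complex_norm_square using cc_integrable by (metis (no_types, lifting) mult.commute ext)
  then show ?thesis by (simp only: complex_of_real_integrable_eq)
qed

lemma l2_sq_nonneg [simp]: "l2_sq f \<ge> 0"
  by (simp add: l2_sq_def)

lemma L2_norm_fun_power2:
  fixes v :: "real^'d::finite \<Rightarrow> complex^'m::finite"
  assumes "\<And>i. test_fun \<Omega> (\<lambda>x. v x $ i)"
  shows "(L2_norm_fun v)\<^sup>2 = (\<Sum>i\<in>UNIV. l2_sq (\<lambda>x. v x $ i))"
proof -
  have "(norm (v x))\<^sup>2 = (\<Sum>i\<in>UNIV. (cmod (v x $ i))\<^sup>2)" for x
    by (simp add: norm_vec_def L2_set_def sum_nonneg)
  then have "(LINT x|lborel. (norm (v x))\<^sup>2) = (\<Sum>i\<in>UNIV. l2_sq (\<lambda>x. v x $ i))"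
    unfolding l2_sq_def using cc_l2_sq_integrable[OF test_fun_cc[OF assms]] by simp
  then show ?thesis by (simp add: L2_norm_fun_def sum_nonneg)
qed

text \<open>With imaginary \<open>w\<close> a translation of the frequency, with real \<open>w\<close> a shift into the complex domain.\<close>

lemma ft_exp_mult: "ft (\<lambda>x. exp (zdot w x) * f x) z = ft f (z + \<i> *s w)"
proof -
  have e: "zdot (\<i> *s w) x = \<i> * zdot w x" for x by (simp add: zdot_def sum_distrib_left mult.assoc)
  have "exp (zdot w x) * f x * exp (- \<i> * zdot z x) = f x * exp (- \<i> * zdot (z + \<i> *s w) x)" for x
  proof -
    have "exp (zdot w x) * exp (- \<i> * zdot z x) = exp (- \<i> * zdot (z + \<i> *s w) x)"
      unfolding exp_add[symmetric] zdot_add_left e by (simp add: algebra_simps)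
    then show ?thesis by (metis mult.assoc mult.commute)
  qed
  then show ?thesis unfolding ft_def by (simp only:)
qed

lemma test_fun_exp_mult: "test_fun \<Omega> f \<Longrightarrow> test_fun \<Omega> (\<lambda>x. exp (zdot w x) * f x)"
  by (rule test_fun_mult) (auto intro: smooth_exp_zdot)

lemma exp_zdot_bound:
  fixes \<Omega> :: "(real^'d::finite) set"
  assumes "bounded \<Omega>"
  shows "\<exists>E>0. \<forall>x\<in>\<Omega>. \<forall>w. (\<forall>i. \<bar>Re (w $ i)\<bar> \<le> R) \<longrightarrow> cmod (exp (zdot w x)) \<le> E"
proof -
  obtain \<rho> where \<rho>: "\<And>x. x \<in> \<Omega> \<Longrightarrow> norm x \<le> \<rho>" using assms unfolding bounded_iff by blast
  have "cmod (exp (zdot w x)) \<le> exp (\<Sum>i\<in>(UNIV::'d set). \<bar>R\<bar> * \<bar>\<rho>\<bar>)" if x: "x \<in> \<Omega>" and w: "\<forall>i. \<bar>Re (w $ i)\<bar> \<le> R" for x and w :: "complex^'d"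
  proof -
    have "Re (zdot w x) = (\<Sum>i\<in>UNIV. Re (w $ i) * x $ i)" by (simp add: zdot_def)
    also have "\<dots> \<le> (\<Sum>i\<in>(UNIV::'d set). \<bar>R\<bar> * \<bar>\<rho>\<bar>)"
    proof (rule sum_mono)
      fix i
      have "Re (w $ i) * x $ i \<le> \<bar>Re (w $ i)\<bar> * \<bar>x $ i\<bar>" by (metis abs_ge_self abs_mult)
      also have "\<dots> \<le> \<bar>R\<bar> * \<bar>\<rho>\<bar>"
        using w[rule_format, of i] \<rho>[OF x] component_le_norm_cart[of x i] by (intro mult_mono) auto
      finally show "Re (w $ i) * x $ i \<le> \<bar>R\<bar> * \<bar>\<rho>\<bar>" .
    qed
    finally show ?thesis by simp
  qed
  then show ?thesis by (intro exI[of _ "exp (\<Sum>i\<in>(UNIV::'d set). \<bar>R\<bar> * \<bar>\<rho>\<bar>)"]) auto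
qed

lemma l2_sq_exp_mult_bound:
  fixes \<Omega> :: "(real^'d::finite) set"
  assumes "bounded \<Omega>"
  shows "\<exists>E>0. \<forall>f w. test_fun \<Omega> f \<longrightarrow> (\<forall>i. \<bar>Re (w $ i)\<bar> \<le> R) \<longrightarrow> l2_sq (\<lambda>x. exp (zdot w x) * f x) \<le> E * l2_sq f"
proof -
  obtain E where E: "E > 0" "\<And>x w. x \<in> \<Omega> \<Longrightarrow> (\<forall>i. \<bar>Re (w $ i)\<bar> \<le> R) \<Longrightarrow> cmod (exp (zdot w x)) \<le> E"
    using exp_zdot_bound[OF assms, of R] by blast
  have "l2_sq (\<lambda>x. exp (zdot w x) * f x) \<le> E\<^sup>2 * l2_sq f" if f: "test_fun \<Omega> f" and w: "\<forall>i. \<bar>Re (w $ i)\<bar> \<le> R" for f and w :: "complex^'d"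
  proof -
    have "l2_sq (\<lambda>x. exp (zdot w x) * f x) \<le> (LINT x|lborel. E\<^sup>2 * (cmod (f x))\<^sup>2)"
      unfolding l2_sq_def
    proof (rule integral_mono)
      show "integrable lborel (\<lambda>x. (cmod (exp (zdot w x) * f x))\<^sup>2)"
        by (rule cc_l2_sq_integrable[OF test_fun_cc[OF test_fun_exp_mult[OF f]]])
      show "integrable lborel (\<lambda>x. E\<^sup>2 * (cmod (f x))\<^sup>2)"
        using cc_l2_sq_integrable[OF test_fun_cc[OF f]] by simp
      fix x
      show "(cmod (exp (zdot w x) * f x))\<^sup>2 \<le> E\<^sup>2 * (cmod (f x))\<^sup>2"
      proof (cases "f x = 0")
        case False
        then have "cmod (exp (zdot w x)) \<le> E" using E(2)[OF test_fun_support[OF f] w] by blast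
        then have "(cmod (exp (zdot w x)))\<^sup>2 \<le> E\<^sup>2" by (rule power_mono) simp
        then show ?thesis unfolding norm_mult power_mult_distrib by (rule mult_right_mono) simp
      qed simp
    qed
    then show ?thesis by (simp add: l2_sq_def)
  qed
  then show ?thesis using E(1) by (intro exI[of _ "E\<^sup>2"]) auto
qed

text \<open>Cauchy-Schwarz on a bounded set, where the exponential in the Fourier integral is bounded.\<close>

lemma ft_bound:
  fixes \<Omega> :: "(real^'d::finite) set"
  assumes "bounded \<Omega>"
  shows "\<exists>E>0. \<forall>f z. test_fun \<Omega> f \<longrightarrow> (\<forall>i. \<bar>Im (z $ i)\<bar> \<le> R) \<longrightarrow> (cmod (ft f z))\<^sup>2 \<le> E * l2_sq f"
proof -
  obtain E where E: "E > 0" "\<And>x w. x \<in> \<Omega> \<Longrightarrow> (\<forall>i. \<bar>Re (w $ i)\<bar> \<le> R) \<Longrightarrow> cmod (exp (zdot w x)) \<le> E"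
    using exp_zdot_bound[OF assms, of R] by blast
  obtain \<rho> where "\<And>x. x \<in> \<Omega> \<Longrightarrow> norm x \<le> \<rho>" using assms unfolding bounded_iff by blast
  then have B: "\<Omega> \<subseteq> ball 0 (\<bar>\<rho>\<bar> + 1)" by fastforce
  let ?B = "ball (0::real^'d) (\<bar>\<rho>\<bar> + 1)"
  define V where "V = measure lborel ?B"
  have V: "V > 0" unfolding V_def using content_ball_pos[of "\<bar>\<rho>\<bar> + 1" "0::real^'d"] by simp
  have iB: "integrable lborel (indicat_real ?B)"
    by (intro integrable_real_indicator emeasure_bounded_finite) auto
  have "(cmod (ft f z))\<^sup>2 \<le> (E\<^sup>2 * V) * l2_sq f" if f: "test_fun \<Omega> f" and z: "\<forall>i. \<bar>Im (z $ i)\<bar> \<le> R" for f and z :: "complex^'d"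
  proof -
    have fi: "integrable lborel (\<lambda>x. cmod (f x))" using cc_integrable[OF test_fun_cc[OF f]] by simp
    have f2: "integrable lborel (\<lambda>x. (cmod (f x))\<^sup>2)" by (rule cc_l2_sq_integrable[OF test_fun_cc[OF f]])
    let ?I = "LINT x|lborel. cmod (f x)"
    have zz: "- \<i> * zdot z x = zdot (- \<i> *s z) x" for x by (simp add: zdot_def sum_distrib_left mult_ac)
    have "cmod (ft f z) \<le> (LINT x|lborel. cmod (f x * exp (- \<i> * zdot z x)))"
      unfolding ft_def by (rule integral_norm_bound)
    also have "\<dots> \<le> (LINT x|lborel. E * cmod (f x))"
    proof (rule integral_mono)
      show "integrable lborel (\<lambda>x. cmod (f x * exp (- \<i> * zdot z x)))"
        by (intro integrable_norm cc_integrable cc_ft_integrand test_fun_cc[OF f])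
      show "integrable lborel (\<lambda>x. E * cmod (f x))" using fi by simp
      fix x
      show "cmod (f x * exp (- \<i> * zdot z x)) \<le> E * cmod (f x)"
      proof (cases "f x = 0")
        case False
        have "cmod (exp (zdot (- \<i> *s z) x)) \<le> E"
          by (rule E(2)[OF test_fun_support[OF f False]]) (use z in simp)
        then show ?thesis unfolding norm_mult zz by (subst mult.commute) (rule mult_right_mono, auto)
      qed simp
    qed
    finally have 1: "cmod (ft f z) \<le> E * ?I" by simp
    \<comment> \<open>Subtracting from \<open>|f|\<close> its mean over a ball containing the support yields the
      Cauchy-Schwarz inequality between \<open>|f|\<close> and the constant \<open>1\<close>.\<close>
    have "0 \<le> (LINT x|lborel. (cmod (f x) - ?I / V * indicat_real ?B x)\<^sup>2)"
      by (rule Bochner_Integration.integral_nonneg) simp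
    also have "(\<lambda>x. (cmod (f x) - ?I / V * indicat_real ?B x)\<^sup>2) = (\<lambda>x. (cmod (f x))\<^sup>2 - 2 * (?I / V) * cmod (f x) + (?I / V)\<^sup>2 * indicat_real ?B x)"
    proof
      fix x
      show "(cmod (f x) - ?I / V * indicat_real ?B x)\<^sup>2 = (cmod (f x))\<^sup>2 - 2 * (?I / V) * cmod (f x) + (?I / V)\<^sup>2 * indicat_real ?B x"
      proof (cases "x \<in> ?B")
        case True
        then show ?thesis by (simp add: power2_diff)
      next
        case False
        then have "f x = 0" using test_fun_support[OF f, of x] B by blast
        then show ?thesis using False by simp
      qed
    qed
    also have "(LINT x|lborel. (cmod (f x))\<^sup>2 - 2 * (?I / V) * cmod (f x) + (?I / V)\<^sup>2 * indicat_real ?B x)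
      = l2_sq f - 2 * (?I / V) * ?I + (?I / V)\<^sup>2 * V"
      using f2 fi iB by (simp add: l2_sq_def V_def)
    also have "\<dots> = l2_sq f - ?I\<^sup>2 / V"
      using V by (simp add: field_simps power2_eq_square)
    finally have 2: "?I\<^sup>2 \<le> V * l2_sq f" using V by (simp add: field_simps)
    have "(cmod (ft f z))\<^sup>2 \<le> (E * ?I)\<^sup>2" by (rule power_mono[OF 1]) simp
    also have "\<dots> = E\<^sup>2 * ?I\<^sup>2" by (simp add: power_mult_distrib)
    also have "\<dots> \<le> E\<^sup>2 * (V * l2_sq f)" by (rule mult_left_mono[OF 2]) simp
    finally show ?thesis by (simp add: mult.assoc)
  qed
  then show ?thesis using E(1) V by (intro exI[of _ "E\<^sup>2 * V"]) auto
qed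

text \<open>Differentiation under the integral sign; the integrand is supported in a box.\<close>

lemma ft_line_holomorphic:
  assumes "cc f"
  shows "(\<lambda>s. ft f (z + s *s y)) holomorphic_on UNIV"
proof -
  obtain a where a: "\<And>x. x \<notin> cbox (- a) a \<Longrightarrow> f x = 0" using cc_box[OF assms] by blast
  have zd: "zdot (z + s *s y) x = zdot z x + s * zdot y x" for s x
    by (simp add: zdot_add_left) (simp add: zdot_def sum_distrib_left mult.assoc)
  have eq: "ft f (z + s *s y) = integral (cbox (- a) a) (\<lambda>x. f x * exp (- \<i> * (zdot z x + s * zdot y x)))" for s
    unfolding ft_def zd[symmetric]
    by (rule LINT_eq_integral_cbox[OF cc_ft_integrand[OF assms]]) (simp add: a)
  have fc: "continuous_on A f" for A
    by (rule continuous_on_subset[OF cc_continuous_on[OF assms]]) simp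
  have c: "continuous_on UNIV (\<lambda>sx :: complex \<times> (real^'a). f (snd sx))"
    by (rule continuous_on_compose2[OF fc[of UNIV]]) (auto intro!: continuous_intros)
  show ?thesis unfolding eq
  proof (rule leibniz_rule_holomorphic)
    show "((\<lambda>s. f x * exp (- \<i> * (zdot z x + s * zdot y x))) has_field_derivative f x * (exp (- \<i> * (zdot z x + s * zdot y x)) * (- \<i> * zdot y x))) (at s within UNIV)" for s x
      by (auto intro!: derivative_eq_intros)
    show "(\<lambda>x. f x * exp (- \<i> * (zdot z x + s * zdot y x))) integrable_on cbox (- a) a" for s
      by (intro integrable_continuous continuous_intros fc)
    show "continuous_on (UNIV \<times> cbox (- a) a) (\<lambda>(s, x). f x * (exp (- \<i> * (zdot z x + s * zdot y x)) * (- \<i> * zdot y x)))"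
      unfolding case_prod_beta' by (intro continuous_intros continuous_on_subset[OF c]) auto
  qed auto
qed

section \<open>The pseudoinverse of a polynomial matrix\<close>

lemma conj_transpose_nth [simp]: "conj_transpose A $ i $ j = cnj (A $ j $ i)"
  by (simp add: conj_transpose_def)

lemma conj_transpose_mult: "conj_transpose (A ** B) = conj_transpose B ** conj_transpose A"
  by (simp add: vec_eq_iff matrix_matrix_mult_def mult.commute)

lemma conj_transpose_conj_transpose [simp]: "conj_transpose (conj_transpose A) = A"
  by (simp add: vec_eq_iff)

lemma conj_transpose_mult_self_eq_0:
  assumes "conj_transpose Y ** Y = 0" shows "Y = 0"
proof -
  have "Y $ i $ j = 0" for i j
  proof -
    have "(\<Sum>k\<in>UNIV. cnj (Y $ k $ j) * Y $ k $ j) = (conj_transpose Y ** Y) $ j $ j"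
      by (simp add: matrix_matrix_mult_def)
    then have "(\<Sum>k\<in>UNIV. complex_of_real ((cmod (Y $ k $ j))\<^sup>2)) = 0"
      unfolding assms complex_norm_square by (simp add: mult.commute)
    then have "(\<Sum>k\<in>UNIV. (cmod (Y $ k $ j))\<^sup>2) = 0"
      by (metis of_real_eq_0_iff of_real_sum)
    then show ?thesis by (subst (asm) sum_nonneg_eq_0_iff) auto
  qed
  then show ?thesis by (simp add: vec_eq_iff)
qed

lemma mult_conj_transpose_self_eq_0:
  assumes "Y ** conj_transpose Y = 0" shows "Y = 0"
proof -
  have "conj_transpose Y = 0" by (rule conj_transpose_mult_self_eq_0) (simp add: assms)
  then show ?thesis by (simp add: vec_eq_iff)
qed


lemma is_pseudoinverse_unique:
  assumes X: "is_pseudoinverse A X" and Y: "is_pseudoinverse A Y"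
  shows "X = Y"
proof -
  have x: "A ** X ** A = A" "X ** A ** X = X" "conj_transpose (A ** X) = A ** X" "conj_transpose (X ** A) = X ** A"
    and y: "A ** Y ** A = A" "Y ** A ** Y = Y" "conj_transpose (A ** Y) = A ** Y" "conj_transpose (Y ** A) = Y ** A"
    using X Y by (auto simp: is_pseudoinverse_def)
  have "A ** X = (A ** Y) ** (A ** X)" by (metis matrix_mul_assoc y(1))
  also have "\<dots> = conj_transpose ((A ** X) ** (A ** Y))" by (simp only: conj_transpose_mult[of "A ** X" "A ** Y"] x(3) y(3))
  also have "(A ** X) ** (A ** Y) = A ** Y" by (metis matrix_mul_assoc x(1))
  finally have AX: "A ** X = A ** Y" by (simp only: y(3))
  have "X ** A = (X ** A) ** (Y ** A)" by (metis matrix_mul_assoc y(1))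
  also have "\<dots> = conj_transpose ((Y ** A) ** (X ** A))" by (simp only: conj_transpose_mult[of "Y ** A" "X ** A"] x(4) y(4))
  also have "(Y ** A) ** (X ** A) = Y ** A" by (metis matrix_mul_assoc x(1))
  finally have XA: "X ** A = Y ** A" by (simp only: y(4))
  show ?thesis by (metis AX XA matrix_mul_assoc x(2) y(2))
qed

lemma pseudoinverse_eqI: "is_pseudoinverse A X \<Longrightarrow> pseudoinverse A = X"
  unfolding pseudoinverse_def by (rule the_equality) (auto intro: is_pseudoinverse_unique)

lemma matrix_diff_rdistrib: "((A :: complex^'n::finite^'m::finite) - B) ** C = A ** C - B ** C"
  by (simp add: vec_eq_iff matrix_matrix_mult_def left_diff_distrib sum_subtractf)

lemma matrix_diff_ldistrib: "(C :: complex^'n::finite^'m::finite) ** (A - B) = C ** A - C ** B"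
  by (simp add: vec_eq_iff matrix_matrix_mult_def right_diff_distrib sum_subtractf)

text \<open>The hypotheses make \<open>E = H G\<close> the orthogonal projection onto the range of \<open>H\<close>: from \<open>E H = H\<close> and
  \<open>E = G H\<close> follows \<open>E = E E\<^sup>*\<close>, which is Hermitian. Then \<open>E A = A\<close>, because
  \<open>(A - E A) (A - E A)\<^sup>* = 0\<close>, and \<open>G H G\<close> is the pseudoinverse of \<open>H\<close>. The claim is the identity
  \<open>A\<^sup>+ = A\<^sup>* (A A\<^sup>*)\<^sup>+\<close>.\<close>

lemma is_pseudoinverse_from_gram:
  fixes A :: "complex^'n::finite^'m::finite" and G :: "complex^'m^'m"
  defines "H \<equiv> A ** conj_transpose A"
  assumes HHG: "H ** (H ** G) = H" and comm: "H ** G = G ** H"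
  shows "is_pseudoinverse A (conj_transpose A ** (G ** H ** G))"
proof -
  define E where "E = H ** G"
  define Y where "Y = G ** H ** G"
  have Hh: "conj_transpose H = H" by (simp add: H_def conj_transpose_mult)
  have HE: "H ** E = H" using HHG by (simp add: E_def)
  have EH: "E ** H = H" using HHG comm by (metis E_def matrix_mul_assoc)
  have "H = H ** conj_transpose E" using arg_cong[OF EH, of conj_transpose] by (simp add: conj_transpose_mult Hh)
  then have "E = E ** conj_transpose E" by (metis E_def comm matrix_mul_assoc)
  then have Eh: "conj_transpose E = E" by (metis conj_transpose_conj_transpose conj_transpose_mult)
  have EE: "E ** E = E" by (metis E_def EH matrix_mul_assoc)
  have "(A - E ** A) ** conj_transpose (A - E ** A) = 0"
  proof -
    have c: "conj_transpose (A - E ** A) = conj_transpose A - conj_transpose A ** E"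
    proof -
      have "conj_transpose (A - E ** A) = conj_transpose A - conj_transpose (E ** A)" by (simp add: vec_eq_iff)
      then show ?thesis by (simp add: conj_transpose_mult Eh)
    qed
    have "(A - E ** A) ** conj_transpose A = 0"
      using EH by (simp add: H_def matrix_mul_assoc matrix_diff_rdistrib)
    then show ?thesis unfolding c by (simp add: matrix_diff_ldistrib matrix_mul_assoc)
  qed
  then have EA: "E ** A = A" using mult_conj_transpose_self_eq_0 by fastforce
  have YH: "Y ** H = E" using comm EH by (metis E_def Y_def matrix_mul_assoc HE)
  have HY: "H ** Y = E" using comm by (metis E_def Y_def matrix_mul_assoc EE)
  have YE: "Y ** E = Y" unfolding Y_def by (metis E_def EE comm matrix_mul_assoc)
  have Yh: "conj_transpose Y = Y"
  proof -
    have 1: "H ** conj_transpose Y = E" using arg_cong[OF YH, of conj_transpose] by (simp add: conj_transpose_mult Hh Eh)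
    have "Y = E ** conj_transpose Y" using YE YH 1 by (metis matrix_mul_assoc)
    moreover have "conj_transpose Y = E ** conj_transpose Y"
      using arg_cong[OF YE, of conj_transpose] by (simp add: conj_transpose_mult Eh)
    ultimately show ?thesis by simp
  qed
  have AX: "A ** (conj_transpose A ** Y) = E" using HY by (simp add: H_def matrix_mul_assoc)
  have XA: "conj_transpose ((conj_transpose A ** Y) ** A) = (conj_transpose A ** Y) ** A"
    by (simp add: conj_transpose_mult Yh matrix_mul_assoc)
  have "(conj_transpose A ** Y) ** A ** (conj_transpose A ** Y) = conj_transpose A ** Y"
  proof -
    have "(conj_transpose A ** Y) ** A ** (conj_transpose A ** Y) = conj_transpose A ** (Y ** E)"
      by (metis AX matrix_mul_assoc)
    then show ?thesis by (simp add: YE)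
  qed
  then show ?thesis unfolding is_pseudoinverse_def Y_def[symmetric] using AX EA Eh XA by simp
qed

definition adjugate :: "'a::comm_ring_1^'m::finite^'m \<Rightarrow> 'a^'m^'m" where
  "adjugate M = (\<chi> i j. det (\<chi> k l. if l = i then (if k = j then 1 else 0) else M $ k $ l))"

lemma mult_mat_nth:
  "((N :: 'a::comm_ring_1^'m::finite^'m) ** mat c) $ i $ j = N $ i $ j * c"
  "(mat c ** (N :: 'a::comm_ring_1^'m::finite^'m)) $ i $ j = c * N $ i $ j"
proof -
  have "((N :: 'a::comm_ring_1^'m::finite^'m) ** mat c) $ i $ j = (\<Sum>k\<in>UNIV. if k = j then N $ i $ j * c else 0)"
    unfolding matrix_matrix_mult_def vec_lambda_beta by (rule sum.cong) (auto simp: mat_def)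
  then show "((N :: 'a::comm_ring_1^'m::finite^'m) ** mat c) $ i $ j = N $ i $ j * c" by simp
  have "(mat c ** (N :: 'a::comm_ring_1^'m::finite^'m)) $ i $ j = (\<Sum>k\<in>UNIV. if k = i then c * N $ i $ j else 0)"
    unfolding matrix_matrix_mult_def vec_lambda_beta by (rule sum.cong) (auto simp: mat_def)
  then show "(mat c ** (N :: 'a::comm_ring_1^'m::finite^'m)) $ i $ j = c * N $ i $ j" by simp
qed

text \<open>Cramer's rule, applied to the columns of the inverse.\<close>

lemma adjugate_mult:
  fixes M :: "'a::field^'m::finite^'m"
  assumes "det M \<noteq> 0"
  shows "M ** adjugate M = mat (det M)" "adjugate M ** M = mat (det M)"
proof -
  obtain N where N: "M ** N = mat 1" "N ** M = mat 1"
    using assms unfolding invertible_det_nz[symmetric] invertible_def by blast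
  have "adjugate M $ i $ j = N $ i $ j * det M" for i j
  proof -
    let ?x = "N *v axis j 1"
    have "M *v ?x = axis j 1" by (simp add: matrix_vector_mul_assoc N)
    then have "adjugate M $ i $ j = det (\<chi> k l. if l = i then (M *v ?x) $ k else M $ k $ l)"
      unfolding adjugate_def by (simp add: axis_def cong: if_cong)
    also have "\<dots> = ?x $ i * det M" by (rule cramer_lemma)
    also have "?x $ i = N $ i $ j"
      by (simp add: matrix_vector_mult_def axis_def if_distrib cong: if_cong)
    finally show ?thesis .
  qed
  then have a: "adjugate M = N ** mat (det M)" "adjugate M = mat (det M) ** N"
    by (auto simp: vec_eq_iff mult_mat_nth mult.commute)
  show "M ** adjugate M = mat (det M)" unfolding a(1) by (simp add: matrix_mul_assoc N)
  show "adjugate M ** M = mat (det M)" unfolding a(2) by (simp add: matrix_mul_assoc[symmetric] N)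
qed

text \<open>The matrix \<open>H + t I\<close> over the polynomial ring in \<open>t\<close>.\<close>

definition pencil :: "complex^'m::finite^'m \<Rightarrow> complex poly^'m^'m" where
  "pencil H = (\<chi> i j. [:H $ i $ j, if i = j then 1 else 0:])"

lemma poly_det: "poly (det M) t = det (\<chi> i j. poly (M $ i $ j) t)"
  by (simp add: det_def poly_sum poly_prod)

lemma poly_adjugate: "poly (adjugate M $ i $ j) t = adjugate (\<chi> i j. poly (M $ i $ j) t) $ i $ j"
  unfolding adjugate_def by (simp add: poly_det) (rule arg_cong[where f = det], simp add: vec_eq_iff)

text \<open>The matrix \<open>A A\<^sup>* + t I\<close> is positive definite.\<close>

lemma det_gram_shift_nonzero:
  fixes A :: "complex^'n::finite^'m::finite" and t :: real
  assumes "t > 0"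
  shows "det (\<chi> i j. poly (pencil (A ** conj_transpose A) $ i $ j) (complex_of_real t)) \<noteq> 0"
proof -
  let ?H = "A ** conj_transpose A"
  let ?M = "(\<chi> i j. poly (pencil ?H $ i $ j) (complex_of_real t)) :: complex^'m^'m"
  have Mv: "(?M *v v) $ i = (A *v (conj_transpose A *v v)) $ i + complex_of_real t * v $ i" for v i
  proof -
    have "(?M *v v) $ i = (\<Sum>j\<in>UNIV. ?H $ i $ j * v $ j + (if i = j then complex_of_real t * v $ j else 0))"
      unfolding matrix_vector_mult_def vec_lambda_beta by (rule sum.cong) (auto simp: pencil_def algebra_simps)
    then show ?thesis by (simp add: sum.distrib matrix_vector_mul_assoc) (simp add: matrix_vector_mult_def)
  qed
  have ker: "v = 0" if "?M *v v = 0" for v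
  proof -
    let ?w = "conj_transpose A *v v"
    have "(\<Sum>i\<in>UNIV. cnj (v $ i) * (A *v ?w) $ i) = (\<Sum>k\<in>UNIV. cnj (?w $ k) * ?w $ k)"
    proof -
      have "(\<Sum>i\<in>UNIV. cnj (v $ i) * (A *v ?w) $ i) = (\<Sum>i\<in>UNIV. \<Sum>k\<in>UNIV. cnj (v $ i) * (A $ i $ k * ?w $ k))"
        by (simp add: matrix_vector_mult_def[of A] sum_distrib_left)
      also have "\<dots> = (\<Sum>k\<in>UNIV. \<Sum>i\<in>UNIV. cnj (v $ i) * (A $ i $ k * ?w $ k))" by (rule sum.swap)
      also have "\<dots> = (\<Sum>k\<in>UNIV. cnj (?w $ k) * ?w $ k)"
      proof (rule sum.cong[OF refl])
        fix k
        have "cnj (?w $ k) = (\<Sum>i\<in>UNIV. A $ i $ k * cnj (v $ i))" by (simp add: matrix_vector_mult_def)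
        moreover have "(\<Sum>i\<in>UNIV. cnj (v $ i) * (A $ i $ k * ?w $ k)) = (\<Sum>i\<in>UNIV. A $ i $ k * cnj (v $ i)) * ?w $ k"
          unfolding sum_distrib_right by (rule sum.cong) (simp_all only: mult_ac)
        ultimately show "(\<Sum>i\<in>UNIV. cnj (v $ i) * (A $ i $ k * ?w $ k)) = cnj (?w $ k) * ?w $ k"
          by (simp only:)
      qed
      finally show ?thesis .
    qed
    moreover have "(\<Sum>i\<in>UNIV. cnj (v $ i) * (?M *v v) $ i) = 0" by (simp add: that)
    ultimately have "(\<Sum>k\<in>UNIV. cnj (?w $ k) * ?w $ k) + complex_of_real t * (\<Sum>i\<in>UNIV. cnj (v $ i) * v $ i) = 0"
      unfolding Mv by (simp add: algebra_simps sum.distrib sum_distrib_left)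
    then have "complex_of_real ((\<Sum>k\<in>UNIV. (cmod (?w $ k))\<^sup>2) + t * (\<Sum>i\<in>UNIV. (cmod (v $ i))\<^sup>2)) = 0"
      by (simp add: complex_norm_square mult.commute del: of_real_power)
    then have "(\<Sum>k\<in>UNIV. (cmod (?w $ k))\<^sup>2) + t * (\<Sum>i\<in>UNIV. (cmod (v $ i))\<^sup>2) = 0"
      by (simp only: of_real_eq_0_iff)
    moreover have "(\<Sum>k\<in>UNIV. (cmod (?w $ k))\<^sup>2) \<ge> 0" "(\<Sum>i\<in>UNIV. (cmod (v $ i))\<^sup>2) \<ge> 0"
      by (simp_all add: sum_nonneg)
    ultimately have "t * (\<Sum>i\<in>UNIV. (cmod (v $ i))\<^sup>2) = 0"
      using mult_nonneg_nonneg[of t "\<Sum>i\<in>UNIV. (cmod (v $ i))\<^sup>2"] assms by linarith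
    then have "(\<Sum>i\<in>UNIV. (cmod (v $ i))\<^sup>2) = 0" using assms by simp
    then show "v = 0" by (subst (asm) sum_nonneg_eq_0_iff) (auto simp: vec_eq_iff)
  qed
  have "inj ((*v) ?M)"
  proof (rule injI)
    fix x y assume "?M *v x = ?M *v y"
    then have "?M *v (x - y) = 0" by (simp only: matrix_vector_mult_diff_distrib diff_self)
    from ker[OF this] show "x = y" by simp
  qed
  then have "invertible ?M" unfolding invertible_left_inverse matrix_left_invertible_injective .
  then show ?thesis by (simp add: invertible_det_nz)
qed

lemma poly_eq_0_if_real_zeros:
  assumes "\<And>t. t > 0 \<Longrightarrow> poly p (complex_of_real t) = 0"
  shows "p = 0"
proof (rule ccontr)
  assume "p \<noteq> 0"
  then have "finite {z. poly p z = 0}" by (rule poly_roots_finite)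
  then have "finite (complex_of_real ` {0<..})"
    by (rule finite_subset[rotated]) (use assms in auto)
  then have "finite {0::real<..}" by (rule finite_imageD) (simp add: inj_on_def)
  then show False using infinite_Ioi by blast
qed

text \<open>At positive real \<open>t\<close> the matrix is invertible and Cramer's rule applies. Infinitely many
  values of \<open>t\<close> determine the polynomials.\<close>

lemma pencil_adjugate:
  fixes A :: "complex^'n::finite^'m::finite"
  defines "M \<equiv> pencil (A ** conj_transpose A)"
  shows "M ** adjugate M = mat (det M)" "adjugate M ** M = mat (det M)" "det M \<noteq> 0"
proof -
  let ?M = "\<lambda>t. (\<chi> i j. poly (M $ i $ j) (complex_of_real t)) :: complex^'m^'m"
  have nz: "det (?M t) \<noteq> 0" if "t > 0" for t
    using det_gram_shift_nonzero[OF that, of A] by (simp add: M_def)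
  have eqI: "p = q" if "\<And>t. t > 0 \<Longrightarrow> poly p (complex_of_real t) = poly q (complex_of_real t)" for p q :: "complex poly"
    using poly_eq_0_if_real_zeros[of "p - q"] that by simp
  have ev: "poly ((M ** adjugate M) $ i $ j) (complex_of_real t) = (?M t ** adjugate (?M t)) $ i $ j"
       "poly ((adjugate M ** M) $ i $ j) (complex_of_real t) = (adjugate (?M t) ** ?M t) $ i $ j"
       "poly (mat (det M) $ i $ j) (complex_of_real t) = mat (det (?M t)) $ i $ j" for i j t
    by (simp_all add: matrix_matrix_mult_def poly_sum poly_adjugate mat_def poly_det)
  show "M ** adjugate M = mat (det M)"
    unfolding vec_eq_iff by (intro allI eqI) (simp add: ev adjugate_mult nz)
  show "adjugate M ** M = mat (det M)"
    unfolding vec_eq_iff by (intro allI eqI) (simp add: ev adjugate_mult nz)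
  show "det M \<noteq> 0" using nz[of 1] poly_det[of M "complex_of_real 1"] by auto
qed

text \<open>Let \<open>C\<^sub>k\<close> and \<open>d\<^sub>k\<close> be the coefficients of the adjugate and of the determinant of \<open>H + t I\<close>. The
  coefficient of \<open>t\<^sup>k\<close> in \<open>(H + t I) adj(H + t I) = det(H + t I) I\<close> is \<open>H C\<^sub>k + C\<^bsub>k-1\<^esub> = d\<^sub>k I\<close>. While the \<open>d\<^sub>j\<close>
  vanish, \<open>H C\<^sub>j = - C\<^bsub>j-1\<^esub>\<close>, and inductively \<open>H C\<^sub>j = 0\<close>, because \<open>H\<^sup>2 X = 0\<close> implies \<open>H X = 0\<close> for Hermitian
  \<open>H\<close>. Multiplying the equation for \<open>k\<close> by \<open>H\<close> then removes \<open>C\<^bsub>k-1\<^esub>\<close>.\<close>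

lemma gram_adjugate_coeffs:
  fixes A :: "complex^'n::finite^'m::finite"
  defines "H \<equiv> A ** conj_transpose A"
  defines "C \<equiv> \<lambda>k. (\<chi> i j. coeff (adjugate (pencil H) $ i $ j) k)"
  assumes low: "\<And>j. j < k \<Longrightarrow> coeff (det (pencil H)) j = 0"
  shows "H ** (H ** C k) = (\<chi> i j. coeff (det (pencil H)) k * H $ i $ j)" "H ** C k = C k ** H"
proof -
  let ?d = "coeff (det (pencil H))"
  have Hh: "conj_transpose H = H" by (simp add: H_def conj_transpose_mult)
  define S where "S k = (if k = 0 then 0 else C (k - 1))" for k
  have cp: "coeff ([:a, b:] * p) k = a * coeff p k + b * (if k = 0 then 0 else coeff p (k - 1))" for a b :: complex and p k
    by (cases k) auto
  define D where "D = adjugate (pencil H)"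
  have C: "C k $ i $ j = coeff (D $ i $ j) k" for k i j by (simp add: C_def D_def)
  have S: "S k $ i $ j = (if k = 0 then 0 else coeff (D $ i $ j) (k - 1))" for k i j by (simp add: S_def C)
  have m: "coeff (mat (det (pencil H)) $ i $ j) k = mat (?d k) $ i $ j" for i j k by (simp add: mat_def)
  have L: "H ** C k + S k = mat (?d k)" for k
  proof -
    have "(H ** C k + S k) $ i $ j = mat (?d k) $ i $ j" for i j
    proof -
      have "coeff ((pencil H ** D) $ i $ j) k = (\<Sum>l\<in>UNIV. coeff ([:H $ i $ l, if i = l then 1 else 0:] * D $ l $ j) k)"
        by (simp only: matrix_matrix_mult_def vec_lambda_beta coeff_sum pencil_def)
      also have "\<dots> = (\<Sum>l\<in>UNIV. H $ i $ l * C k $ l $ j + (if i = l then S k $ l $ j else 0))"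
        by (rule sum.cong[OF refl]) (simp only: cp C S, simp)
      also have "\<dots> = (H ** C k + S k) $ i $ j"
        by (simp add: sum.distrib matrix_matrix_mult_def)
      finally show ?thesis
        using pencil_adjugate(1)[of A] unfolding D_def H_def[symmetric] by (simp only: m)
    qed
    then show ?thesis by (simp add: vec_eq_iff)
  qed
  have R: "C k ** H + S k = mat (?d k)" for k
  proof -
    have "(C k ** H + S k) $ i $ j = mat (?d k) $ i $ j" for i j
    proof -
      have "coeff ((D ** pencil H) $ i $ j) k = (\<Sum>l\<in>UNIV. coeff ([:H $ l $ j, if l = j then 1 else 0:] * D $ i $ l) k)"
        by (simp only: matrix_matrix_mult_def vec_lambda_beta coeff_sum pencil_def mult.commute)
      also have "\<dots> = (\<Sum>l\<in>UNIV. C k $ i $ l * H $ l $ j + (if l = j then S k $ i $ l else 0))"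
        by (rule sum.cong[OF refl]) (simp only: cp C S, simp)
      also have "\<dots> = (C k ** H + S k) $ i $ j"
        by (simp add: sum.distrib matrix_matrix_mult_def)
      finally show ?thesis
        using pencil_adjugate(2)[of A] unfolding D_def H_def[symmetric] by (simp only: m)
    qed
    then show ?thesis by (simp add: vec_eq_iff)
  qed
  show "H ** C k = C k ** H" using L[of k] R[of k] by (metis add_right_cancel)
  have can: "H ** X = 0" if "H ** (H ** X) = 0" for X :: "complex^'m^'m"
  proof (rule conj_transpose_mult_self_eq_0)
    show "conj_transpose (H ** X) ** (H ** X) = 0"
      using that by (simp add: conj_transpose_mult Hh flip: matrix_mul_assoc)
  qed
  have z: "H ** C j = 0" if "j < k" for j
    using that
  proof (induction j)
    case 0
    then show ?case using L[of 0] low[of 0] by (simp add: S_def mat_def vec_eq_iff)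
  next
    case (Suc j)
    have "H ** C (Suc j) = - C j"
      using L[of "Suc j"] low[OF Suc.prems] by (simp add: S_def mat_def vec_eq_iff add_eq_0_iff)
    then have "H ** (H ** C (Suc j)) = - (H ** C j)"
      by (simp add: vec_eq_iff matrix_matrix_mult_def sum_negf)
    then show ?case using can Suc by simp
  qed
  have "H ** S k = 0" using z[of "k - 1"] by (cases k) (auto simp: S_def)
  then have "H ** (H ** C k) = H ** mat (?d k)"
    using L[of k] by (metis add.right_neutral matrix_add_ldistrib)
  then show "H ** (H ** C k) = (\<chi> i j. ?d k * H $ i $ j)"
    by (simp add: vec_eq_iff matrix_matrix_mult_def mat_def if_distrib mult.commute cong: if_cong)
qed


text \<open>For polynomials in an auxiliary variable whose coefficients depend on \<open>\<xi>\<close>: the dependence is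
  polynomial.\<close>

definition polycoeffs :: "(real^'d::finite \<Rightarrow> complex poly) \<Rightarrow> bool" where
  "polycoeffs F \<longleftrightarrow> (\<forall>k. polyfun (\<lambda>\<xi>. coeff (F \<xi>) k))"

lemma polycoeffs_const: "polycoeffs (\<lambda>\<xi>. c)"
  by (auto simp: polycoeffs_def)

lemma polycoeffs_add: "polycoeffs F \<Longrightarrow> polycoeffs G \<Longrightarrow> polycoeffs (\<lambda>\<xi>. F \<xi> + G \<xi>)"
  by (auto simp: polycoeffs_def)

lemma polycoeffs_mult: "polycoeffs F \<Longrightarrow> polycoeffs G \<Longrightarrow> polycoeffs (\<lambda>\<xi>. F \<xi> * G \<xi>)"
  unfolding polycoeffs_def coeff_mult by (intro allI polyfun_sum polyfun_mult) auto

lemma polycoeffs_sum: "(\<And>a. a \<in> A \<Longrightarrow> polycoeffs (F a)) \<Longrightarrow> polycoeffs (\<lambda>\<xi>. \<Sum>a\<in>A. F a \<xi>)"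
  by (induction A rule: infinite_finite_induct) (auto intro: polycoeffs_const polycoeffs_add)

lemma polycoeffs_prod: "(\<And>a. a \<in> A \<Longrightarrow> polycoeffs (F a)) \<Longrightarrow> polycoeffs (\<lambda>\<xi>. \<Prod>a\<in>A. F a \<xi>)"
  by (induction A rule: infinite_finite_induct) (auto intro: polycoeffs_const polycoeffs_mult)

lemma polycoeffs_det:
  fixes M :: "real^'d::finite \<Rightarrow> complex poly^'m::finite^'m"
  assumes "\<And>i j. polycoeffs (\<lambda>\<xi>. M \<xi> $ i $ j)" shows "polycoeffs (\<lambda>\<xi>. det (M \<xi>))"
  unfolding det_def by (intro polycoeffs_sum polycoeffs_mult polycoeffs_const polycoeffs_prod assms)

lemma polycoeffs_adjugate:
  fixes M :: "real^'d::finite \<Rightarrow> complex poly^'m::finite^'m"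
  assumes "\<And>i j. polycoeffs (\<lambda>\<xi>. M \<xi> $ i $ j)" shows "polycoeffs (\<lambda>\<xi>. adjugate (M \<xi>) $ i $ j)"
  unfolding adjugate_def vec_lambda_beta
proof (rule polycoeffs_det)
  fix k l
  show "polycoeffs (\<lambda>\<xi>. (\<chi> k l. if l = i then if k = j then 1 else 0 else M \<xi> $ k $ l) $ k $ l)"
    by (cases "l = i"; cases "k = j") (simp_all add: polycoeffs_const assms)
qed

lemma matrix_mult_div_right: "(A :: complex^'n::finite^'m::finite) ** (\<chi> i j. B $ i $ j / c) = (\<chi> i j. (A ** B) $ i $ j / (c::complex))"
  by (simp add: vec_eq_iff matrix_matrix_mult_def sum_divide_distrib)

lemma matrix_mult_div_left: "(\<chi> i j. (B :: complex^'n::finite^'m::finite) $ i $ j / c) ** A = (\<chi> i j. (B ** A) $ i $ j / (c::complex))"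
  by (simp add: vec_eq_iff matrix_matrix_mult_def sum_divide_distrib)

lemma polyfun_matrix_mult:
  fixes A :: "real^'d::finite \<Rightarrow> complex^'n::finite^'m::finite" and B :: "real^'d \<Rightarrow> complex^'k::finite^'n"
  assumes "\<And>i j. polyfun (\<lambda>\<xi>. A \<xi> $ i $ j)" "\<And>i j. polyfun (\<lambda>\<xi>. B \<xi> $ i $ j)"
  shows "polyfun (\<lambda>\<xi>. (A \<xi> ** B \<xi>) $ i $ j)"
  unfolding matrix_matrix_mult_def vec_lambda_beta by (intro polyfun_sum polyfun_mult assms)

lemma polyfun_conj_transpose:
  fixes A :: "real^'d::finite \<Rightarrow> complex^'n::finite^'m::finite"
  assumes "\<And>i j. polyfun (\<lambda>\<xi>. A \<xi> $ i $ j)"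
  shows "polyfun (\<lambda>\<xi>. conj_transpose (A \<xi>) $ i $ j)"
  unfolding conj_transpose_nth by (intro polyfun_cnj assms)

text \<open>Let \<open>d\<^sub>k\<close> be the lowest coefficient of \<open>det(P P\<^sup>* + t I)\<close> that does not vanish identically in \<open>\<xi>\<close>, and \<open>C\<^sub>k\<close>
  the corresponding coefficient of the adjugate. Where \<open>d\<^sub>k \<noteq> 0\<close>, the matrix \<open>G = C\<^sub>k / d\<^sub>k\<close> is as
  required in \<open>is_pseudoinverse_from_gram\<close>, so \<open>P\<^sup>+ = P\<^sup>* C\<^sub>k P P\<^sup>* C\<^sub>k / d\<^sub>k\<^sup>2\<close>.\<close>

theorem pseudoinverse_rational:
  fixes P :: "('d::finite, complex^'n::finite^'m::finite) mpolynomial"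
  shows "\<exists>s \<delta>. (\<forall>n m. polyfun (s n m)) \<and> polyfun \<delta> \<and> (\<exists>\<xi>. \<delta> \<xi> \<noteq> 0) \<and>
    (\<forall>\<xi>. \<delta> \<xi> \<noteq> 0 \<longrightarrow> is_pseudoinverse (mpoly_eval P \<xi>) (\<chi> n m. s n m \<xi> / \<delta> \<xi>))"
proof -
  let ?A = "\<lambda>\<xi>. mpoly_eval P \<xi>"
  let ?H = "\<lambda>\<xi>. ?A \<xi> ** conj_transpose (?A \<xi>)"
  let ?d = "\<lambda>k \<xi>. coeff (det (pencil (?H \<xi>))) k"
  let ?C = "\<lambda>k \<xi>. (\<chi> i j. coeff (adjugate (pencil (?H \<xi>)) $ i $ j) k)"
  have A: "polyfun (\<lambda>\<xi>. ?A \<xi> $ i $ j)" for i j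
    unfolding mpoly_eval_nth by (rule polyfun_mpoly_eval)
  have H: "polyfun (\<lambda>\<xi>. ?H \<xi> $ i $ j)" for i j
    by (intro polyfun_matrix_mult polyfun_conj_transpose A)
  have "polycoeffs (\<lambda>\<xi>. pencil (?H \<xi>) $ i $ j)" for i j
    unfolding polycoeffs_def
  proof
    fix k
    show "polyfun (\<lambda>\<xi>. coeff (pencil (?H \<xi>) $ i $ j) k)"
      using H[of i j] by (cases k; cases "k - 1") (auto simp: pencil_def coeff_pCons split: nat.splits)
  qed
  then have d: "polyfun (?d k)" and C: "polyfun (\<lambda>\<xi>. ?C k \<xi> $ i $ j)" for k i j
    using polycoeffs_det[of "\<lambda>\<xi>. pencil (?H \<xi>)"] polycoeffs_adjugate[of "\<lambda>\<xi>. pencil (?H \<xi>)"]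
    by (auto simp: polycoeffs_def)
  have "det (pencil (?H 0)) \<noteq> 0" by (rule pencil_adjugate(3))
  then have "\<exists>k \<xi>. ?d k \<xi> \<noteq> 0" by (metis leading_coeff_0_iff)
  then have "\<exists>\<xi>. ?d (LEAST k. \<exists>\<xi>. ?d k \<xi> \<noteq> 0) \<xi> \<noteq> 0" by (rule LeastI_ex)
  then obtain k where k: "\<exists>\<xi>. ?d k \<xi> \<noteq> 0" "\<And>j \<xi>. j < k \<Longrightarrow> ?d j \<xi> = 0"
    using not_less_Least[of _ "\<lambda>k. \<exists>\<xi>. ?d k \<xi> \<noteq> 0"] by blast
  let ?S = "\<lambda>\<xi>. conj_transpose (?A \<xi>) ** (?C k \<xi> ** ?H \<xi> ** ?C k \<xi>)"
  have "is_pseudoinverse (?A \<xi>) (\<chi> n m. ?S \<xi> $ n $ m / (?d k \<xi> * ?d k \<xi>))" if nz: "?d k \<xi> \<noteq> 0" for \<xi>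
  proof -
    let ?G = "(\<chi> i j. ?C k \<xi> $ i $ j / ?d k \<xi>)"
    have co: "?H \<xi> ** (?H \<xi> ** ?C k \<xi>) = (\<chi> i j. ?d k \<xi> * ?H \<xi> $ i $ j)" "?H \<xi> ** ?C k \<xi> = ?C k \<xi> ** ?H \<xi>"
      by (rule gram_adjugate_coeffs[where A = "?A \<xi>" and k = k, OF k(2)], assumption)+
    have "?H \<xi> ** (?H \<xi> ** ?G) = ?H \<xi>"
      unfolding matrix_mult_div_right co(1) using nz by (simp add: vec_eq_iff)
    moreover have "?H \<xi> ** ?G = ?G ** ?H \<xi>"
      unfolding matrix_mult_div_right matrix_mult_div_left co(2) ..
    ultimately have "is_pseudoinverse (?A \<xi>) (conj_transpose (?A \<xi>) ** (?G ** ?H \<xi> ** ?G))"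
      by (rule is_pseudoinverse_from_gram)
    moreover have "conj_transpose (?A \<xi>) ** (?G ** ?H \<xi> ** ?G) = (\<chi> n m. ?S \<xi> $ n $ m / (?d k \<xi> * ?d k \<xi>))"
      unfolding matrix_mult_div_right matrix_mult_div_left by (simp add: vec_eq_iff)
    ultimately show ?thesis by simp
  qed
  moreover have "polyfun (\<lambda>\<xi>. ?S \<xi> $ n $ m)" for n m
    by (intro polyfun_matrix_mult polyfun_conj_transpose A H C)
  moreover have "polyfun (\<lambda>\<xi>. ?d k \<xi> * ?d k \<xi>)" using d by auto
  ultimately show ?thesis using k(1)
    by (intro exI[of _ "\<lambda>n m \<xi>. ?S \<xi> $ n $ m"] exI[of _ "\<lambda>\<xi>. ?d k \<xi> * ?d k \<xi>"]) auto
qed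

section \<open>Malgrange's inequality in several variables\<close>

lemma coeff_1_line_poly: "coeff (line_poly p z (axis i 1)) 1 = ceval (pd i p) z"
proof -
  have "coeff (line_poly p z (axis i 1)) 1 = poly (pderiv (line_poly p z (axis i 1))) 0"
    by (simp add: poly_0_coeff_0 coeff_pderiv)
  then show ?thesis by (simp add: pderiv_line_poly poly_line_poly)
qed

lemma pd_circle_nn:
  assumes "cc f" "deg_le m p"
  shows "ennreal ((cmod (ft f z * ceval (pd i p) z))\<^sup>2) \<le> 4 ^ m *
    (\<integral>\<^sup>+t. indicator {0..1} t * ennreal ((cmod (ft f (z + cis (2 * pi * t) *s axis i 1) * ceval p (z + cis (2 * pi * t) *s axis i 1)))\<^sup>2) \<partial>lborel)"
  using poly_coeff_circle_nn[OF ft_line_holomorphic[OF assms(1), of z "axis i 1"] degree_line_poly[OF assms(2), of z "axis i 1"], of 1]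
  by (simp add: coeff_1_line_poly[unfolded One_nat_def] poly_line_poly)

lemma pd_circle_sup:
  assumes "cc f" "deg_le m p"
  shows "\<exists>c. cmod c = 1 \<and> (cmod (ft f z * ceval (pd i p) z))\<^sup>2 \<le> 4 ^ m * (cmod (ft f (z + c *s axis i 1) * ceval p (z + c *s axis i 1)))\<^sup>2"
  using poly_coeff_circle_sup[OF ft_line_holomorphic[OF assms(1), of z "axis i 1"] degree_line_poly[OF assms(2), of z "axis i 1"], of 1]
  by (simp add: coeff_1_line_poly[unfolded One_nat_def] poly_line_poly)

text \<open>Each derivative costs one step of length one in a coordinate direction of complex space.\<close>

lemma pdl_polydisc_sup:
  fixes p :: "('d::finite, complex) mpolynomial"
  assumes "cc f" "deg_le m p"
  shows "\<exists>\<zeta>. (\<forall>k. cmod (\<zeta> $ k) \<le> real (length is)) \<and>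
    (cmod (ft f z * ceval (pdl is p) z))\<^sup>2 \<le> (4 ^ m) ^ length is * (cmod (ft f (z + \<zeta>) * ceval p (z + \<zeta>)))\<^sup>2"
proof (induction "is" arbitrary: z)
  case Nil
  show ?case by (intro exI[of _ 0]) simp
next
  case (Cons i js)
  obtain c where c: "cmod c = 1" "(cmod (ft f z * ceval (pd i (pdl js p)) z))\<^sup>2 \<le> 4 ^ m * (cmod (ft f (z + c *s axis i 1) * ceval (pdl js p) (z + c *s axis i 1)))\<^sup>2"
    using pd_circle_sup[OF assms(1) deg_le_pdl[OF assms(2)]] by blast
  obtain \<zeta> :: "complex^'d" where \<zeta>: "\<forall>k. cmod (\<zeta> $ k) \<le> real (length js)"
     "(cmod (ft f (z + c *s axis i 1) * ceval (pdl js p) (z + c *s axis i 1)))\<^sup>2 \<le> (4 ^ m) ^ length js * (cmod (ft f (z + c *s axis i 1 + \<zeta>) * ceval p (z + c *s axis i 1 + \<zeta>)))\<^sup>2"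
    using Cons.IH[of "z + c *s axis i 1"] by blast
  have b: "cmod ((c *s axis i 1 + \<zeta>) $ k) \<le> real (length (i # js))" for k
  proof -
    have "cmod ((c *s axis i 1 + \<zeta>) $ k) \<le> cmod (c * axis i 1 $ k) + cmod (\<zeta> $ k)"
      using norm_triangle_ineq[of "c * axis i 1 $ k" "\<zeta> $ k"] by simp
    moreover have "cmod (c * axis i 1 $ k) \<le> 1" using c(1) by (simp add: axis_def norm_mult)
    ultimately show ?thesis using \<zeta>(1)[rule_format, of k] by simp
  qed
  have "(cmod (ft f z * ceval (pdl (i # js) p) z))\<^sup>2 \<le> 4 ^ m * ((4 ^ m) ^ length js * (cmod (ft f (z + c *s axis i 1 + \<zeta>) * ceval p (z + c *s axis i 1 + \<zeta>)))\<^sup>2)"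
    using order_trans[OF c(2) mult_left_mono[OF \<zeta>(2), of "4 ^ m"]] by simp
  then show ?case
    using b by (intro exI[of _ "c *s axis i 1 + \<zeta>"]) (simp add: add.assoc mult.assoc)
qed

lemma nn_integral_translate:
  fixes g :: "'a::euclidean_space \<Rightarrow> ennreal"
  assumes "g \<in> borel_measurable borel"
  shows "(\<integral>\<^sup>+x. g (a + x) \<partial>lborel) = (\<integral>\<^sup>+x. g x \<partial>lborel)"
proof -
  have "(\<integral>\<^sup>+x. g x \<partial>lborel) = (\<integral>\<^sup>+x. g x \<partial>distr lborel borel ((+) a))"
    by (simp add: lborel_distr_plus)
  also have "\<dots> = (\<integral>\<^sup>+x. g (a + x) \<partial>lborel)"
    by (rule nn_integral_distr) (use assms in auto)
  finally show ?thesis by simp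
qed

text \<open>The square of a weighted \<open>L\<^sup>2\<close> norm over the copy of real space with imaginary part \<open>y\<close>.\<close>

definition weighted :: "(real^'d::finite \<Rightarrow> real) \<Rightarrow> (real^'d \<Rightarrow> complex) \<Rightarrow> ('d, complex) mpolynomial \<Rightarrow> real^'d \<Rightarrow> ennreal" where
  "weighted W f p y = (\<integral>\<^sup>+\<xi>. ennreal (W \<xi> * (cmod (ft f (cvec \<xi> + \<i> *s cvec y) * ceval p (cvec \<xi> + \<i> *s cvec y)))\<^sup>2) \<partial>lborel)"

lemma continuous_on_ft_comp [continuous_intros]:
  "cc f \<Longrightarrow> continuous_on A g \<Longrightarrow> continuous_on A (\<lambda>x. ft f (g x))"
  by (rule continuous_on_compose2[OF continuous_on_ft]) auto

lemma continuous_on_smult [continuous_intros]: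
  "continuous_on A c \<Longrightarrow> continuous_on A g \<Longrightarrow> continuous_on A (\<lambda>x. (c x :: complex) *s (g x :: complex^'d::finite))"
  unfolding vector_scalar_mult_def by (intro continuous_intros)

lemma borel_measurable_ennreal_continuous:
  "continuous_on UNIV (g :: 'a::topological_space \<Rightarrow> real) \<Longrightarrow> (\<lambda>x. ennreal (g x)) \<in> borel_measurable borel"
  by (intro measurable_compose[OF _ measurable_ennreal] borel_measurable_continuous_onI)

text \<open>Malgrange's inequality on the circle about \<open>\<xi> + i y\<close> in the \<open>i\<close>-th direction, integrated over
  \<open>\<xi>\<close>. The real part of the point on the circle is removed by translating \<open>\<xi>\<close>, which costs the
  factor \<open>K\<close> in the weight; its imaginary part changes \<open>y\<close> by at most one.\<close>

lemma weighted_pd: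
  fixes W :: "real^'d::finite \<Rightarrow> real"
  assumes f: "cc f" and p: "deg_le m p"
    and W0: "\<And>\<xi>. W \<xi> \<ge> 0" and Wc: "continuous_on UNIV W"
    and Wslow: "\<And>\<xi> s i. \<bar>s\<bar> \<le> 1 \<Longrightarrow> W (\<xi> + s *\<^sub>R axis i 1) \<le> K * W \<xi>"
    and B: "\<And>s. \<bar>s\<bar> \<le> 1 \<Longrightarrow> weighted W f p (y + s *\<^sub>R axis i 1) \<le> B"
  shows "weighted W f (pd i p) y \<le> ennreal (4 ^ m * K) * B"
proof -
  have K0: "K \<ge> 0" if "W \<xi> \<noteq> 0" for \<xi>
    using W0[of \<xi>] W0[of "\<xi> + 0 *\<^sub>R axis i 1"] Wslow[of 0 \<xi> i] that by (simp add: zero_le_mult_iff)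
  define F where "F z = (cmod (ft f z * ceval p z))\<^sup>2" for z
  have Fc: "continuous_on A (\<lambda>x. F (g x))" if "continuous_on A g" for A and g :: "_ \<Rightarrow> complex^'d"
    unfolding F_def by (intro continuous_intros that f)
  define Z where "Z \<xi> t = cvec \<xi> + \<i> *s cvec y + cis (2 * pi * t) *s axis i 1" for \<xi> t
  define G where "G \<xi> t = indicator {0..1} t * ennreal (W \<xi> * F (Z \<xi> t))" for \<xi> and t :: real
  have psf: "pair_sigma_finite (lborel :: (real^'d) measure) (lborel :: real measure)" ..
  have Gm: "(\<lambda>(\<xi>, t). G \<xi> t) \<in> borel_measurable (lborel \<Otimes>\<^sub>M lborel)"
  proof -
    have "continuous_on UNIV (\<lambda>xt :: (real^'d) \<times> real. W (fst xt) * F (Z (fst xt) (snd xt)))"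
      unfolding Z_def by (intro continuous_intros Fc continuous_on_compose2[OF Wc]) auto
    then have "(\<lambda>xt :: (real^'d) \<times> real. ennreal (W (fst xt) * F (Z (fst xt) (snd xt)))) \<in> borel_measurable (lborel \<Otimes>\<^sub>M lborel)"
      unfolding lborel_prod by (simp add: borel_measurable_ennreal_continuous)
    then show ?thesis unfolding G_def case_prod_beta' by measurable
  qed
  have "weighted W f (pd i p) y \<le> (\<integral>\<^sup>+\<xi>. 4 ^ m * (\<integral>\<^sup>+t. G \<xi> t \<partial>lborel) \<partial>lborel)"
    unfolding weighted_def
  proof (rule nn_integral_mono)
    fix \<xi>
    have "ennreal (W \<xi> * (cmod (ft f (cvec \<xi> + \<i> *s cvec y) * ceval (pd i p) (cvec \<xi> + \<i> *s cvec y)))\<^sup>2)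
      \<le> ennreal (W \<xi>) * (4 ^ m * (\<integral>\<^sup>+t. indicator {0..1} t * ennreal (F (Z \<xi> t)) \<partial>lborel))"
      unfolding ennreal_mult'[OF W0] F_def Z_def
      by (rule mult_left_mono[OF pd_circle_nn[OF f p]]) simp
    also have "\<dots> = 4 ^ m * (ennreal (W \<xi>) * (\<integral>\<^sup>+t. indicator {0..1} t * ennreal (F (Z \<xi> t)) \<partial>lborel))"
      by (simp add: mult_ac)
    also have "ennreal (W \<xi>) * (\<integral>\<^sup>+t. indicator {0..1} t * ennreal (F (Z \<xi> t)) \<partial>lborel) = (\<integral>\<^sup>+t. G \<xi> t \<partial>lborel)"
    proof (subst nn_integral_cmult[symmetric])
      have "continuous_on UNIV (\<lambda>t. F (Z \<xi> t))" unfolding Z_def by (intro continuous_intros Fc)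
      then show "(\<lambda>t. indicator {0..1} t * ennreal (F (Z \<xi> t))) \<in> borel_measurable lborel"
        using borel_measurable_ennreal_continuous by measurable
    qed (simp add: G_def[abs_def] ennreal_mult'[OF W0] mult_ac)
    finally show "ennreal (W \<xi> * (cmod (ft f (cvec \<xi> + \<i> *s cvec y) * ceval (pd i p) (cvec \<xi> + \<i> *s cvec y)))\<^sup>2) \<le> 4 ^ m * (\<integral>\<^sup>+t. G \<xi> t \<partial>lborel)" .
  qed
  also have "\<dots> = 4 ^ m * (\<integral>\<^sup>+\<xi>. (\<integral>\<^sup>+t. G \<xi> t \<partial>lborel) \<partial>lborel)"
  proof (rule nn_integral_cmult)
    show "(\<lambda>\<xi>. \<integral>\<^sup>+t. G \<xi> t \<partial>lborel) \<in> borel_measurable lborel"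
      using sigma_finite_measure.borel_measurable_nn_integral[OF sigma_finite_lborel Gm] by simp
  qed
  also have "(\<integral>\<^sup>+\<xi>. (\<integral>\<^sup>+t. G \<xi> t \<partial>lborel) \<partial>lborel) = (\<integral>\<^sup>+t. (\<integral>\<^sup>+\<xi>. G \<xi> t \<partial>lborel) \<partial>lborel)"
    by (rule pair_sigma_finite.Fubini'[OF psf Gm, symmetric])
  also have "\<dots> \<le> (\<integral>\<^sup>+(t::real). indicator {0..1} t * (ennreal K * B) \<partial>lborel)"
  proof (rule nn_integral_mono)
    fix t :: real
    let ?c = "cos (2 * pi * t)" and ?s = "sin (2 * pi * t)"
    have z: "Z \<xi> t = cvec (?c *\<^sub>R axis i 1 + \<xi>) + \<i> *s cvec (y + ?s *\<^sub>R axis i 1)" for \<xi>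
      by (auto simp: Z_def vec_eq_iff axis_def complex_eq_iff)
    let ?g = "\<lambda>\<xi>. ennreal (W (\<xi> - ?c *\<^sub>R axis i 1) * F (cvec \<xi> + \<i> *s cvec (y + ?s *\<^sub>R axis i 1)))"
    have gm: "?g \<in> borel_measurable borel"
      by (intro borel_measurable_ennreal_continuous continuous_intros Fc continuous_on_compose2[OF Wc]) auto
    have "(\<integral>\<^sup>+\<xi>. ennreal (W \<xi> * F (Z \<xi> t)) \<partial>lborel) = (\<integral>\<^sup>+\<xi>. ?g (?c *\<^sub>R axis i 1 + \<xi>) \<partial>lborel)"
      by (simp add: z)
    also have "\<dots> = (\<integral>\<^sup>+\<xi>. ?g \<xi> \<partial>lborel)" by (rule nn_integral_translate[OF gm])
    also have "\<dots> \<le> (\<integral>\<^sup>+\<xi>. ennreal K * ennreal (W \<xi> * F (cvec \<xi> + \<i> *s cvec (y + ?s *\<^sub>R axis i 1))) \<partial>lborel)"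
    proof (rule nn_integral_mono)
      fix \<xi>
      let ?F = "F (cvec \<xi> + \<i> *s cvec (y + ?s *\<^sub>R axis i 1))"
      have "W (\<xi> - ?c *\<^sub>R axis i 1) \<le> K * W \<xi>"
        using Wslow[of "- ?c" \<xi> i] by simp
      then have "W (\<xi> - ?c *\<^sub>R axis i 1) * ?F \<le> K * (W \<xi> * ?F)"
        using mult_right_mono[of _ _ ?F] by (fastforce simp: F_def mult.assoc)
      then have "?g \<xi> \<le> ennreal (K * (W \<xi> * ?F))" by (rule ennreal_leI)
      also have "\<dots> = ennreal K * ennreal (W \<xi> * ?F)"
        by (rule ennreal_mult'') (simp add: W0 F_def)
      finally show "?g \<xi> \<le> ennreal K * ennreal (W \<xi> * ?F)" .
    qed
    also have "\<dots> = ennreal K * (\<integral>\<^sup>+\<xi>. ennreal (W \<xi> * F (cvec \<xi> + \<i> *s cvec (y + ?s *\<^sub>R axis i 1))) \<partial>lborel)"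
      by (rule nn_integral_cmult)
         (auto intro!: borel_measurable_ennreal_continuous continuous_intros Fc Wc)
    also have "\<dots> = ennreal K * weighted W f p (y + ?s *\<^sub>R axis i 1)"
      by (simp add: weighted_def F_def)
    also have "\<dots> \<le> ennreal K * B"
      by (rule mult_left_mono[OF B]) auto
    finally have "(\<integral>\<^sup>+\<xi>. ennreal (W \<xi> * F (Z \<xi> t)) \<partial>lborel) \<le> ennreal K * B" .
    then show "(\<integral>\<^sup>+\<xi>. G \<xi> t \<partial>lborel) \<le> indicator {0..1} t * (ennreal K * B)"
      by (cases "t \<in> {0..1}") (simp_all add: G_def)
  qed
  also have "\<dots> = ennreal K * B"
    by (simp add: nn_integral_multc)
  finally have "weighted W f (pd i p) y \<le> 4 ^ m * (ennreal K * B)" by (simp add: mult_left_mono)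
  then show ?thesis by (simp add: ennreal_mult' ennreal_power[symmetric] mult.assoc)
qed

lemma weighted_pdl:
  fixes W :: "real^'d::finite \<Rightarrow> real" and y :: "real^'d"
  assumes f: "cc f" and p: "deg_le m p"
    and W0: "\<And>\<xi>. W \<xi> \<ge> 0" and Wc: "continuous_on UNIV W"
    and Wslow: "\<And>\<xi> s i. \<bar>s\<bar> \<le> 1 \<Longrightarrow> W (\<xi> + s *\<^sub>R axis i 1) \<le> K * W \<xi>"
    and B: "\<And>y' :: real^'d. (\<And>k. \<bar>y' $ k\<bar> \<le> R + real (length is)) \<Longrightarrow> weighted W f p y' \<le> B"
    and y: "\<And>k. \<bar>y $ k\<bar> \<le> R"
  shows "weighted W f (pdl is p) y \<le> ennreal (4 ^ m * K) ^ length is * B"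
  using B y
proof (induction "is" arbitrary: R y)
  case Nil
  then show ?case by simp
next
  case (Cons i js)
  have "weighted W f (pd i (pdl js p)) y \<le> ennreal (4 ^ m * K) * (ennreal (4 ^ m * K) ^ length js * B)"
  proof (rule weighted_pd[OF f deg_le_pdl[OF p] W0 Wc Wslow])
    fix s :: real assume s: "\<bar>s\<bar> \<le> 1"
    show "weighted W f (pdl js p) (y + s *\<^sub>R axis i 1) \<le> ennreal (4 ^ m * K) ^ length js * B"
    proof (rule Cons.IH[of "R + 1"])
      show "weighted W f p y' \<le> B" if "\<And>k. \<bar>y' $ k\<bar> \<le> R + 1 + real (length js)" for y' :: "real^'d"
        by (rule Cons.prems(1)) (use that in \<open>simp add: add.assoc\<close>)
      fix k
      have "\<bar>(s *\<^sub>R axis i (1::real)) $ k\<bar> \<le> 1" using s by (simp add: axis_def)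
      then show "\<bar>(y + s *\<^sub>R axis i 1) $ k\<bar> \<le> R + 1"
        using Cons.prems(2)[of k] abs_triangle_ineq[of "y $ k" "(s *\<^sub>R axis i (1::real)) $ k"] by simp
    qed
  qed auto
  then show ?case by (simp add: mult.assoc)
qed


lemma plancherel_l2_sq:
  fixes f :: "real^'d::finite \<Rightarrow> complex"
  assumes "test_fun \<Omega> f"
  shows "(\<integral>\<^sup>+\<xi>. ennreal ((cmod (ft f (cvec \<xi>)))\<^sup>2) \<partial>lborel) = ennreal ((2 * pi) ^ CARD('d) * l2_sq f)"
  unfolding l2_sq_def by (rule plancherel[OF test_fun_cc[OF assms]])

lemma cvec_add: "cvec (x + y) = cvec x + cvec y"
  by (simp add: vec_eq_iff)

text \<open>On the Fourier side the norm on the left is that of \<open>p(\<xi> + \<eta>)\<close> times the transform of \<open>\<phi>\<close>. Taylor's formula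
  at \<open>\<eta>\<close> bounds \<open>|p(\<xi> + \<eta>)|\<close> by \<open>deriv_sum m p \<eta>\<close> times a power of the \<open>1 + |\<xi>\<^sub>i|\<close>, which is dominated by the
  modulus of a polynomial \<open>r\<close>; and \<open>r(D) \<phi>\<close> is square integrable.\<close>

lemma modulated_upper_bound:
  fixes \<phi> :: "real^'d::finite \<Rightarrow> complex"
  assumes \<phi>: "test_fun \<Omega> \<phi>" and p: "deg_le m p"
  shows "\<exists>C\<ge>0. \<forall>\<eta>. l2_sq (scalar_op p (\<lambda>x. exp (zdot (\<i> *s cvec \<eta>) x) * \<phi> x)) \<le> C * (deriv_sum m p (cvec \<eta>))\<^sup>2"
proof -
  obtain K where K: "K > 0" "\<And>p z y. deg_le m p \<Longrightarrow>
    deriv_sum m (p::('d, complex) mpolynomial) (z + y) \<le> K * (\<Prod>i\<in>UNIV. (1 + cmod (y $ i)) ^ m) * deriv_sum m p z"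
    using deriv_sum_shift[where 'd = 'd, of m] by blast
  have "polyfun (\<lambda>\<xi>::real^'d. \<Prod>i\<in>UNIV. (1 + \<i> * complex_of_real (\<xi> $ i)) ^ m)"
    by (intro polyfun_prod polyfun_power polyfun_add polyfun_mult polyfun_const polyfun_coord)
  then obtain r where "(\<lambda>\<xi>::real^'d. \<Prod>i\<in>UNIV. (1 + \<i> * complex_of_real (\<xi> $ i)) ^ m) = mpoly_eval r"
    by (rule polyfunE)
  then have r: "ceval r (cvec \<xi>) = (\<Prod>i\<in>UNIV. (1 + \<i> * complex_of_real (\<xi> $ i)) ^ m)" for \<xi>
    by (metis mpoly_eval_eq_ceval)
  \<comment> \<open>From \<open>(1 + |t|)\<^sup>2 \<le> 2 (1 + t\<^sup>2) = 2 |1 + i t|\<^sup>2\<close>.\<close>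
  have weight: "(\<Prod>i\<in>UNIV. (1 + \<bar>\<xi> $ i\<bar>) ^ m)\<^sup>2 \<le> (2 ^ m) ^ CARD('d) * (cmod (ceval r (cvec \<xi>)))\<^sup>2" for \<xi> :: "real^'d"
  proof -
    have "(\<Prod>i\<in>UNIV. (1 + \<bar>\<xi> $ i\<bar>) ^ m)\<^sup>2 = (\<Prod>i\<in>UNIV. ((1 + \<bar>\<xi> $ i\<bar>)\<^sup>2) ^ m)"
      by (simp add: prod_power_distrib power_mult[symmetric] mult.commute)
    also have "\<dots> \<le> (\<Prod>i\<in>UNIV. (2 * (cmod (1 + \<i> * complex_of_real (\<xi> $ i)))\<^sup>2) ^ m)"
    proof (intro prod_mono conjI power_mono)
      fix i
      have "(1 + \<bar>\<xi> $ i\<bar>)\<^sup>2 \<le> 2 * (1 + (\<xi> $ i)\<^sup>2)"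
        using sum_squares_bound[of 1 "\<bar>\<xi> $ i\<bar>"] by (simp add: power2_sum)
      then show "(1 + \<bar>\<xi> $ i\<bar>)\<^sup>2 \<le> 2 * (cmod (1 + \<i> * complex_of_real (\<xi> $ i)))\<^sup>2"
        by (simp add: cmod_def)
    qed auto
    also have "\<dots> = (2 ^ m) ^ CARD('d) * (cmod (ceval r (cvec \<xi>)))\<^sup>2"
      unfolding r by (simp add: power_mult_distrib prod.distrib prod_norm[symmetric] norm_power prod_power_distrib power_mult[symmetric] mult.commute[of 2 m])
    finally show ?thesis .
  qed
  define C where "C = K\<^sup>2 * (2 ^ m) ^ CARD('d) * l2_sq (scalar_op r \<phi>)"
  have "l2_sq (scalar_op p (\<lambda>x. exp (zdot (\<i> *s cvec \<eta>) x) * \<phi> x)) \<le> C * (deriv_sum m p (cvec \<eta>))\<^sup>2" for \<eta>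
  proof -
    let ?w = "\<lambda>x. exp (zdot (\<i> *s cvec \<eta>) x) * \<phi> x"
    let ?T = "deriv_sum m p (cvec \<eta>)"
    let ?M = "K\<^sup>2 * (2 ^ m) ^ CARD('d) * ?T\<^sup>2"
    have w: "test_fun \<Omega> ?w" by (rule test_fun_exp_mult[OF \<phi>])
    let ?g = "\<lambda>\<xi>. ennreal ((cmod (ceval p (cvec \<xi>) * ft \<phi> (cvec (\<xi> - \<eta>))))\<^sup>2)"
    have "cvec \<xi> + \<i> *s (\<i> *s cvec \<eta>) = cvec (\<xi> - \<eta>)" for \<xi> :: "real^'d" by (simp add: vec_eq_iff)
    then have ftw: "ft ?w (cvec \<xi>) = ft \<phi> (cvec (\<xi> - \<eta>))" for \<xi> by (simp add: ft_exp_mult)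
    have "ennreal ((2 * pi) ^ CARD('d) * l2_sq (scalar_op p ?w)) = (\<integral>\<^sup>+\<xi>. ?g \<xi> \<partial>lborel)"
      unfolding plancherel_l2_sq[OF test_fun_scalar_op[OF w], symmetric] ft_scalar_op[OF w] ftw ..
    also have "\<dots> = (\<integral>\<^sup>+\<xi>. ?g (\<eta> + \<xi>) \<partial>lborel)"
      by (rule nn_integral_translate[symmetric])
         (intro borel_measurable_ennreal_continuous continuous_intros test_fun_cc[OF \<phi>])
    also have "\<dots> \<le> (\<integral>\<^sup>+\<xi>. ennreal ?M * ennreal ((cmod (ft (scalar_op r \<phi>) (cvec \<xi>)))\<^sup>2) \<partial>lborel)"
    proof (rule nn_integral_mono)
      fix \<xi> :: "real^'d"
      let ?f = "cmod (ft \<phi> (cvec \<xi>))"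
      have "cmod (ceval p (cvec (\<eta> + \<xi>))) \<le> deriv_sum m p (cvec \<eta> + cvec \<xi>)"
        using pdl_le_deriv_sum[OF p, of "[]"] by (simp add: cvec_add)
      also have "\<dots> \<le> K * (\<Prod>i\<in>UNIV. (1 + \<bar>\<xi> $ i\<bar>) ^ m) * ?T"
        using K(2)[OF p, of "cvec \<eta>" "cvec \<xi>"] by simp
      finally have "(cmod (ceval p (cvec (\<eta> + \<xi>))))\<^sup>2 \<le> (K * (\<Prod>i\<in>UNIV. (1 + \<bar>\<xi> $ i\<bar>) ^ m) * ?T)\<^sup>2"
        by (rule power_mono) simp
      also have "\<dots> = K\<^sup>2 * (\<Prod>i\<in>UNIV. (1 + \<bar>\<xi> $ i\<bar>) ^ m)\<^sup>2 * ?T\<^sup>2"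
        by (simp only: power_mult_distrib)
      also have "\<dots> \<le> K\<^sup>2 * ((2 ^ m) ^ CARD('d) * (cmod (ceval r (cvec \<xi>)))\<^sup>2) * ?T\<^sup>2"
        by (intro mult_right_mono mult_left_mono weight) auto
      finally have "(cmod (ceval p (cvec (\<eta> + \<xi>))))\<^sup>2 * ?f\<^sup>2 \<le> (K\<^sup>2 * ((2 ^ m) ^ CARD('d) * (cmod (ceval r (cvec \<xi>)))\<^sup>2) * ?T\<^sup>2) * ?f\<^sup>2"
        by (rule mult_right_mono) simp
      then have "(cmod (ceval p (cvec (\<eta> + \<xi>)) * ft \<phi> (cvec \<xi>)))\<^sup>2 \<le> ?M * (cmod (ft (scalar_op r \<phi>) (cvec \<xi>)))\<^sup>2"
        by (simp add: ft_scalar_op[OF \<phi>] norm_mult power_mult_distrib mult_ac)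
      then have "?g (\<eta> + \<xi>) \<le> ennreal (?M * (cmod (ft (scalar_op r \<phi>) (cvec \<xi>)))\<^sup>2)"
        by (intro ennreal_leI) simp
      then show "?g (\<eta> + \<xi>) \<le> ennreal ?M * ennreal ((cmod (ft (scalar_op r \<phi>) (cvec \<xi>)))\<^sup>2)"
        by (simp add: ennreal_mult'')
    qed
    also have "\<dots> = ennreal ?M * (\<integral>\<^sup>+\<xi>. ennreal ((cmod (ft (scalar_op r \<phi>) (cvec \<xi>)))\<^sup>2) \<partial>lborel)"
    proof (rule nn_integral_cmult)
      have "(\<lambda>\<xi>. (cmod (ft (scalar_op r \<phi>) (cvec \<xi>)))\<^sup>2) \<in> borel_measurable borel"
        by (intro borel_measurable_continuous_onI continuous_intros test_fun_cc[OF test_fun_scalar_op[OF \<phi>]])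
      then show "(\<lambda>\<xi>. ennreal ((cmod (ft (scalar_op r \<phi>) (cvec \<xi>)))\<^sup>2)) \<in> borel_measurable lborel" by simp
    qed
    also have "\<dots> = ennreal (?M * ((2 * pi) ^ CARD('d) * l2_sq (scalar_op r \<phi>)))"
      unfolding plancherel_l2_sq[OF test_fun_scalar_op[OF \<phi>]] by (rule ennreal_mult''[symmetric]) simp
    finally have "(2 * pi) ^ CARD('d) * l2_sq (scalar_op p ?w) \<le> ?M * ((2 * pi) ^ CARD('d) * l2_sq (scalar_op r \<phi>))"
      by (subst (asm) ennreal_le_iff) auto
    also have "\<dots> = (2 * pi) ^ CARD('d) * (C * ?T\<^sup>2)" by (simp add: C_def mult_ac)
    finally show ?thesis by (subst (asm) mult_le_cancel_left_pos) auto
  qed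
  moreover have "C \<ge> 0" by (simp add: C_def)
  ultimately show ?thesis by blast
qed

text \<open>Let \<open>w(x) = exp(i x \<bullet> \<eta>) \<phi>(x)\<close> where \<open>\<phi>\<close> has nonzero integral, so that the transform of \<open>w\<close> at \<open>\<eta>\<close> is
  this integral. Malgrange's inequality bounds its product with any derivative of \<open>q\<close> at \<open>\<eta>\<close> by the
  transform of \<open>q(D) w\<close> at a complex frequency near \<open>\<eta>\<close>, hence by the norm of \<open>q(D) w\<close>. The norm of
  \<open>p(D) w\<close> is bounded by \<open>modulated_upper_bound\<close>.\<close>

theorem scalar_dominates_necessary:
  fixes \<Omega> :: "(real^'d::finite) set"
  assumes \<Omega>: "bounded \<Omega>" "open \<Omega>" "\<Omega> \<noteq> {}"
    and est: "\<And>w. test_fun \<Omega> w \<Longrightarrow> l2_sq (scalar_op q w) \<le> C * l2_sq (scalar_op p w)" and C: "C \<ge> 0"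
  shows "scalar_dominates p q"
proof -
  obtain m where p: "deg_le m p" using deg_le_exists by blast
  obtain n where q: "deg_le n q" using deg_le_exists by blast
  obtain \<phi> where \<phi>: "test_fun \<Omega> \<phi>" "ft \<phi> 0 \<noteq> 0" using exists_test_fun_integral_nonzero[OF \<Omega>(2,3)] by blast
  obtain A where A: "A \<ge> 0" "\<And>\<eta>. l2_sq (scalar_op p (\<lambda>x. exp (zdot (\<i> *s cvec \<eta>) x) * \<phi> x)) \<le> A * (deriv_sum m p (cvec \<eta>))\<^sup>2"
    using modulated_upper_bound[OF \<phi>(1) p] by blast
  obtain E where E: "E > 0" "\<And>f z. test_fun \<Omega> f \<Longrightarrow> (\<forall>i. \<bar>Im (z $ i)\<bar> \<le> real n) \<Longrightarrow> (cmod (ft f z))\<^sup>2 \<le> E * l2_sq f"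
    using ft_bound[OF \<Omega>(1), of "real n"] by blast
  let ?a = "cmod (ft \<phi> 0)"
  define B where "B = sqrt ((4 ^ n) ^ n * (E * (C * A))) / ?a"
  have a: "?a > 0" using \<phi>(2) by simp
  have main: "cmod (ceval (pdl is q) (cvec \<eta>)) \<le> B * deriv_sum m p (cvec \<eta>)" if "is": "is \<in> lists_le n" for "is" \<eta>
  proof -
    let ?w = "\<lambda>x. exp (zdot (\<i> *s cvec \<eta>) x) * \<phi> x"
    let ?T = "deriv_sum m p (cvec \<eta>)"
    have w: "test_fun \<Omega> ?w" by (rule test_fun_exp_mult[OF \<phi>(1)])
    have g: "test_fun \<Omega> (scalar_op q ?w)" by (rule test_fun_scalar_op[OF w])
    have len: "length is \<le> n" using "is" by (simp add: lists_le_def)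
    have "cvec \<eta> + \<i> *s (\<i> *s cvec \<eta>) = 0" by (simp add: vec_eq_iff)
    then have ftw: "ft ?w (cvec \<eta>) = ft \<phi> 0" by (simp add: ft_exp_mult)
    obtain \<zeta> :: "complex^'d" where \<zeta>: "\<forall>k. cmod (\<zeta> $ k) \<le> real (length is)"
      "(cmod (ft ?w (cvec \<eta>) * ceval (pdl is q) (cvec \<eta>)))\<^sup>2 \<le> (4 ^ n) ^ length is * (cmod (ft ?w (cvec \<eta> + \<zeta>) * ceval q (cvec \<eta> + \<zeta>)))\<^sup>2"
      using pdl_polydisc_sup[OF test_fun_cc[OF w] q] by blast
    have im: "\<forall>i. \<bar>Im ((cvec \<eta> + \<zeta>) $ i)\<bar> \<le> real n"
      using \<zeta>(1) len abs_Im_le_cmod by (simp, meson of_nat_mono order_trans)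
    have "(?a * cmod (ceval (pdl is q) (cvec \<eta>)))\<^sup>2 \<le> (4 ^ n) ^ length is * (cmod (ft (scalar_op q ?w) (cvec \<eta> + \<zeta>)))\<^sup>2"
      using \<zeta>(2) unfolding ftw ft_scalar_op[OF w] by (simp add: norm_mult mult.commute)
    also have "\<dots> \<le> (4 ^ n) ^ n * (E * l2_sq (scalar_op q ?w))"
      by (intro mult_mono power_increasing len E(2)[OF g im]) auto
    also have "\<dots> \<le> (4 ^ n) ^ n * (E * (C * l2_sq (scalar_op p ?w)))"
      using est[OF w] E(1) by (intro mult_left_mono) auto
    also have "\<dots> \<le> (4 ^ n) ^ n * (E * (C * (A * ?T\<^sup>2)))"
      using A(2) C E(1) by (intro mult_left_mono) auto
    also have "\<dots> = (B * ?a * ?T)\<^sup>2"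
      using a A(1) C E(1) by (simp add: B_def power_mult_distrib)
    finally have "?a * cmod (ceval (pdl is q) (cvec \<eta>)) \<le> B * ?a * ?T"
      by (rule power2_le_imp_le) (use A(1) C E(1) in \<open>simp add: B_def\<close>)
    then have "?a * cmod (ceval (pdl is q) (cvec \<eta>)) \<le> ?a * (B * ?T)" by (simp add: mult_ac)
    then show ?thesis using a by (subst (asm) mult_le_cancel_left_pos) auto
  qed
  have "deriv_sum n q (cvec \<eta>) \<le> (real (card (lists_le n :: 'd list set)) * B) * deriv_sum m p (cvec \<eta>)" for \<eta>
  proof -
    have "deriv_sum n q (cvec \<eta>) \<le> (\<Sum>is\<in>(lists_le n :: 'd list set). B * deriv_sum m p (cvec \<eta>))"
      unfolding deriv_sum_def[of n] by (rule sum_mono) (rule main)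
    then show ?thesis by simp
  qed
  then have "deriv_sum n q (cvec \<eta>) \<le> (\<bar>real (card (lists_le n :: 'd list set)) * B\<bar> + 1) * deriv_sum m p (cvec \<eta>)" for \<eta>
    by (rule order_trans) (intro mult_right_mono, auto)
  then show ?thesis unfolding scalar_dominates_iff_deriv_sum[OF p q]
    by (intro exI[of _ "\<bar>real (card (lists_le n :: 'd list set)) * B\<bar> + 1"]) auto
qed

section \<open>Sufficiency and necessity of domination\<close>

text \<open>On the complex line through \<open>\<xi>\<close> in the direction \<open>y\<close> the difference of the two sides is a polynomial in
  the parameter that vanishes at all real values, hence also at \<open>i\<close>.\<close>

lemma ceval_identity_complexify:
  fixes a b :: "('d::finite, complex) mpolynomial" and c e :: "'m::finite \<Rightarrow> ('d, complex) mpolynomial"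
  assumes "\<And>\<xi>. ceval a (cvec \<xi>) * ceval b (cvec \<xi>) = (\<Sum>j\<in>UNIV. ceval (c j) (cvec \<xi>) * ceval (e j) (cvec \<xi>))"
  shows "ceval a (cvec \<xi> + \<i> *s cvec y) * ceval b (cvec \<xi> + \<i> *s cvec y) =
    (\<Sum>j\<in>UNIV. ceval (c j) (cvec \<xi> + \<i> *s cvec y) * ceval (e j) (cvec \<xi> + \<i> *s cvec y))"
proof -
  let ?L = "\<lambda>p. line_poly p (cvec \<xi>) (cvec y)"
  let ?r = "?L a * ?L b - (\<Sum>j\<in>UNIV. ?L (c j) * ?L (e j))"
  have "?r = 0"
  proof (rule poly_eq_0_if_real_zeros)
    fix t :: real
    have "cvec \<xi> + complex_of_real t *s cvec y = cvec (\<xi> + t *\<^sub>R y)" by (simp add: vec_eq_iff)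
    then show "poly ?r (complex_of_real t) = 0"
      by (simp add: poly_line_poly poly_sum assms)
  qed
  then have "poly ?r \<i> = 0" by simp
  then show ?thesis by (simp add: poly_line_poly poly_sum)
qed

text \<open>The matrix \<open>1 - X A\<close> takes values in the kernel of \<open>A\<close>.\<close>

lemma pseudoinverse_factor:
  fixes A :: "complex^'n::finite^'m::finite" and B :: "complex^'n^'l::finite"
  assumes X: "is_pseudoinverse A X" and k: "kernel A \<subseteq> kernel B"
  shows "B ** X ** A = B"
proof (rule matrix_eq[THEN iffD2], rule allI)
  fix v
  have "A *v (v - (X ** A) *v v) = 0"
    using X by (simp add: is_pseudoinverse_def matrix_vector_mult_diff_distrib matrix_vector_mul_assoc matrix_mul_assoc)
  then have "B *v (v - (X ** A) *v v) = 0" using k by (auto simp: kernel_def)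
  then show "(B ** X ** A) *v v = B *v v"
    by (simp add: matrix_vector_mult_diff_distrib matrix_vector_mul_assoc matrix_mul_assoc)
qed

lemma AE_pseudoinverse_rational:
  fixes P :: "('d::finite, complex^'n::finite^'m::finite) mpolynomial"
  obtains S \<Delta> where "\<exists>\<xi>. mpoly_eval \<Delta> \<xi> \<noteq> 0" "AE \<xi> in lborel. mpoly_eval \<Delta> \<xi> \<noteq> 0"
    "\<And>\<xi>. mpoly_eval \<Delta> \<xi> \<noteq> 0 \<Longrightarrow> is_pseudoinverse (mpoly_eval P \<xi>) (\<chi> n m. mpoly_eval (S n m) \<xi> / mpoly_eval \<Delta> \<xi>)"
proof -
  obtain s \<delta> where s: "\<And>n m. polyfun (s n m)" "polyfun \<delta>" "\<exists>\<xi>. \<delta> \<xi> \<noteq> 0"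
    "\<And>\<xi>. \<delta> \<xi> \<noteq> 0 \<Longrightarrow> is_pseudoinverse (mpoly_eval P \<xi>) (\<chi> n m. s n m \<xi> / \<delta> \<xi>)"
    using pseudoinverse_rational[of P] by blast
  obtain \<Delta> where \<Delta>: "\<delta> = mpoly_eval \<Delta>" using s(2) by (rule polyfunE)
  have "\<exists>S. \<forall>n m. s n m = mpoly_eval (S n m)" using s(1) unfolding polyfun_def by metis
  then obtain S where S: "\<And>n m. s n m = mpoly_eval (S n m)" by blast
  obtain \<xi>0 where "mpoly_eval \<Delta> \<xi>0 \<noteq> 0" using s(3) \<Delta> by blast
  then show ?thesis using s(4) unfolding \<Delta> S by (intro that[of \<Delta> S] AE_mpoly_eval_nonzero) auto
qed

lemma cmod_sum_power2_le:
  "(cmod (\<Sum>j\<in>A. f j))\<^sup>2 \<le> real (card A) * (\<Sum>j\<in>A. (cmod (f j))\<^sup>2)"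
proof -
  have "(cmod (\<Sum>j\<in>A. f j))\<^sup>2 \<le> (\<Sum>j\<in>A. 1 * cmod (f j))\<^sup>2"
    by (rule power_mono) (simp_all add: norm_sum)
  also have "\<dots> \<le> (\<Sum>j\<in>A. 1\<^sup>2) * (\<Sum>j\<in>A. (cmod (f j))\<^sup>2)" by (rule Cauchy_Schwarz_ineq_sum)
  finally show ?thesis by simp
qed

lemma continuous_on_deriv_sum [continuous_intros]:
  "continuous_on A g \<Longrightarrow> continuous_on A (\<lambda>x. deriv_sum m p (g x))"
  unfolding deriv_sum_def by (intro continuous_intros)

text \<open>Take the weight \<open>W = 1 / T\<^sup>2\<close> with \<open>T = deriv_sum m \<Delta>\<close>. Domination and the slow variation of \<open>deriv_sum\<close> give
  \<open>|q\<^sub>j(\<xi> + i y)| \<le> D T(\<xi>)\<close> for bounded \<open>y\<close>, so the weighted norm of \<open>\<Delta> v^ = \<Sum> q\<^sub>j f\<^sub>j^\<close> is at most a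
  constant times the norms of the \<open>f\<^sub>j\<close>. By \<open>weighted_pdl\<close> the same holds with any derivative of \<open>\<Delta>\<close> in place of
  \<open>\<Delta>\<close>. Summing the squares over all derivatives reproduces \<open>T\<^sup>2\<close> up to a constant and cancels the weight.\<close>

theorem quotient_estimate:
  fixes \<Omega> :: "(real^'d::finite) set" and q :: "'m::finite \<Rightarrow> ('d, complex) mpolynomial"
  assumes \<Omega>: "bounded \<Omega>" and nz: "\<exists>\<xi>. mpoly_eval \<Delta> \<xi> \<noteq> 0"
    and dom: "\<And>j. scalar_dominates \<Delta> (q j)"
  shows "\<exists>C\<ge>0. \<forall>v f. test_fun \<Omega> v \<longrightarrow> (\<forall>j. test_fun \<Omega> (f j)) \<longrightarrow>
    (\<forall>\<xi> y. ceval \<Delta> (cvec \<xi> + \<i> *s cvec y) * ft v (cvec \<xi> + \<i> *s cvec y) =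
      (\<Sum>j\<in>UNIV. ceval (q j) (cvec \<xi> + \<i> *s cvec y) * ft (f j) (cvec \<xi> + \<i> *s cvec y))) \<longrightarrow>
    l2_sq v \<le> C * (\<Sum>j\<in>UNIV. l2_sq (f j))"
proof -
  obtain m0 where m0: "deg_le m0 \<Delta>" using deg_le_exists by blast
  have "\<forall>j. \<exists>n. deg_le n (q j)" using deg_le_exists by blast
  then obtain n where n: "\<And>j. deg_le (n j) (q j)" by metis
  define m where "m = m0 + (\<Sum>j\<in>UNIV. n j)"
  have \<Delta>: "deg_le m \<Delta>" by (rule deg_le_mono[OF m0]) (simp add: m_def)
  have q: "deg_le m (q j)" for j
    using member_le_sum[of j UNIV n] by (intro deg_le_mono[OF n]) (simp add: m_def)
  have "\<forall>j. \<exists>c>0. \<forall>\<xi>. deriv_sum m (q j) (cvec \<xi>) \<le> c * deriv_sum m \<Delta> (cvec \<xi>)"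
    using dom scalar_dominates_iff_deriv_sum[OF \<Delta> q] by blast
  then obtain c where c: "\<And>j. c j > 0" "\<And>j \<xi>. deriv_sum m (q j) (cvec \<xi>) \<le> c j * deriv_sum m \<Delta> (cvec \<xi>)" by metis
  define C where "C = (\<Sum>j\<in>UNIV. c j)"
  have C0: "C \<ge> 0" unfolding C_def using c(1) by (simp add: sum_nonneg less_imp_le)
  have C: "deriv_sum m (q j) (cvec \<xi>) \<le> C * deriv_sum m \<Delta> (cvec \<xi>)" for j \<xi>
  proof -
    have "c j \<le> C" unfolding C_def using c(1) by (intro member_le_sum) (auto simp: less_imp_le)
    then show ?thesis using c(2)[of j \<xi>] by (meson mult_right_mono order_trans deriv_sum_nonneg)
  qed
  obtain K where K: "K > 0" "\<And>p z y. deg_le m p \<Longrightarrow>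
    deriv_sum m (p::('d, complex) mpolynomial) (z + y) \<le> K * (\<Prod>i\<in>UNIV. (1 + cmod (y $ i)) ^ m) * deriv_sum m p z"
    using deriv_sum_shift[where 'd = 'd, of m] by blast
  define T where "T \<xi> = deriv_sum m \<Delta> (cvec \<xi>)" for \<xi>
  \<comment> \<open>If all derivatives vanished at one point, \<open>\<Delta>\<close> would vanish identically.\<close>
  have T0: "T \<xi> > 0" for \<xi>
  proof (rule ccontr)
    assume "\<not> T \<xi> > 0"
    then have z: "deriv_sum m \<Delta> (cvec \<xi>) = 0" using deriv_sum_nonneg[of m \<Delta> "cvec \<xi>"] by (simp add: T_def)
    obtain \<xi>0 where \<xi>0: "mpoly_eval \<Delta> \<xi>0 \<noteq> 0" using nz by blast
    have "cmod (mpoly_eval \<Delta> \<xi>0) \<le> deriv_sum m \<Delta> (cvec \<xi> + cvec (\<xi>0 - \<xi>))"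
      using pdl_le_deriv_sum[OF \<Delta>, of "[]" "cvec \<xi>0"] by (simp add: mpoly_eval_eq_ceval flip: cvec_add)
    also have "\<dots> \<le> 0" using K(2)[OF \<Delta>, of "cvec \<xi>" "cvec (\<xi>0 - \<xi>)"] by (simp add: z)
    finally show False using \<xi>0 by simp
  qed
  define W where "W \<xi> = 1 / (T \<xi>)\<^sup>2" for \<xi>
  have W0: "W \<xi> \<ge> 0" for \<xi> by (simp add: W_def)
  have Wc: "continuous_on UNIV W"
    unfolding W_def[abs_def] T_def using T0 by (intro continuous_intros) (auto simp: T_def less_imp_neq[symmetric])
  define L where "L = K * (2 ^ m) ^ CARD('d)"
  have L0: "L > 0" using K(1) by (simp add: L_def)
  have Wslow: "W (\<xi> + s *\<^sub>R axis i 1) \<le> L\<^sup>2 * W \<xi>" if s: "\<bar>s\<bar> \<le> 1" for \<xi> s i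
  proof -
    let ?\<xi> = "\<xi> + s *\<^sub>R axis i 1" and ?y = "cvec ((- s) *\<^sub>R axis i 1) :: complex^'d"
    have "cvec ?\<xi> + ?y = cvec \<xi>" by (simp flip: cvec_add)
    then have "T \<xi> \<le> K * (\<Prod>k\<in>UNIV. (1 + cmod (?y $ k)) ^ m) * T ?\<xi>"
      using K(2)[OF \<Delta>, of "cvec ?\<xi>" ?y] by (simp add: T_def)
    also have "\<dots> \<le> K * (\<Prod>k\<in>(UNIV :: 'd set). 2 ^ m) * T ?\<xi>"
    proof (intro mult_right_mono mult_left_mono prod_mono conjI power_mono)
      fix k show "1 + cmod (?y $ k) \<le> 2" using s by (simp add: axis_def)
    qed (use K(1) T0[of ?\<xi>] in auto)
    finally have "T \<xi> \<le> L * T ?\<xi>" by (simp add: L_def)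
    then have "(T \<xi>)\<^sup>2 \<le> (L * T ?\<xi>)\<^sup>2" by (rule power_mono) (use T0[of \<xi>] in simp)
    then show ?thesis using T0[of \<xi>] T0[of ?\<xi>] by (simp add: W_def field_simps power_mult_distrib)
  qed
  define D where "D = K * ((1 + real m) ^ m) ^ CARD('d) * C"
  have D0: "D \<ge> 0" using K(1) C0 by (simp add: D_def)
  have qD: "cmod (ceval (q j) (cvec \<xi> + \<i> *s cvec y)) \<le> D * T \<xi>" if y: "\<And>k. \<bar>y $ k\<bar> \<le> real m" for j \<xi> and y :: "real^'d"
  proof -
    have "cmod (ceval (q j) (cvec \<xi> + \<i> *s cvec y)) \<le> deriv_sum m (q j) (cvec \<xi> + \<i> *s cvec y)"
      using pdl_le_deriv_sum[OF q, of "[]"] by simp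
    also have "\<dots> \<le> K * (\<Prod>k\<in>UNIV. (1 + cmod ((\<i> *s cvec y) $ k)) ^ m) * deriv_sum m (q j) (cvec \<xi>)"
      by (rule K(2)[OF q])
    also have "\<dots> \<le> K * (\<Prod>k\<in>(UNIV :: 'd set). (1 + real m) ^ m) * (C * T \<xi>)"
    proof (intro mult_mono prod_mono conjI power_mono)
      fix k show "1 + cmod ((\<i> *s cvec y) $ k) \<le> 1 + real m" using y[of k] by (simp add: norm_mult)
    qed (use K(1) C in \<open>auto simp: T_def intro!: mult_nonneg_nonneg prod_nonneg\<close>)
    finally show ?thesis by (simp add: D_def mult_ac)
  qed
  obtain E where E: "E > 0" "\<And>f w. test_fun \<Omega> f \<Longrightarrow> (\<forall>i. \<bar>Re (w $ i)\<bar> \<le> real m) \<Longrightarrow> l2_sq (\<lambda>x. exp (zdot w x) * f x) \<le> E * l2_sq f"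
    using l2_sq_exp_mult_bound[OF \<Omega>, of "real m"] by blast
  define N where "N = real (card (lists_le m :: 'd list set))"
  define B0 where "B0 = real CARD('m) * D\<^sup>2 * ((2 * pi) ^ CARD('d) * E)"
  have B00: "B0 \<ge> 0" using E(1) by (simp add: B0_def)
  define S where "S = N * (\<Sum>is\<in>(lists_le m :: 'd list set). (4 ^ m * L\<^sup>2) ^ length is)"
  have S0: "S \<ge> 0" by (simp add: S_def N_def sum_nonneg)
  have main: "l2_sq v \<le> S * B0 / (2 * pi) ^ CARD('d) * (\<Sum>j\<in>UNIV. l2_sq (f j))"
    if v: "test_fun \<Omega> v" and f: "\<And>j. test_fun \<Omega> (f j)"
      and eq: "\<And>\<xi> y. ceval \<Delta> (cvec \<xi> + \<i> *s cvec y) * ft v (cvec \<xi> + \<i> *s cvec y) =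
      (\<Sum>j\<in>UNIV. ceval (q j) (cvec \<xi> + \<i> *s cvec y) * ft (f j) (cvec \<xi> + \<i> *s cvec y))" for v f
  proof -
    let ?F = "\<Sum>j\<in>UNIV. l2_sq (f j)"
    have F0: "?F \<ge> 0" by (simp add: sum_nonneg)
    \<comment> \<open>Shifting the frequency by \<open>i y\<close> amounts to multiplying \<open>f\<^sub>j\<close> by \<open>exp(y \<bullet> x)\<close>.\<close>
    have base: "weighted W v \<Delta> y \<le> ennreal (B0 * ?F)" if y: "\<And>k. \<bar>y $ k\<bar> \<le> real m" for y :: "real^'d"
    proof -
      let ?z = "\<lambda>\<xi>. cvec \<xi> + \<i> *s cvec y"
      let ?e = "\<lambda>j x. exp (zdot (cvec y) x) * f j x"
      let ?MD = "real CARD('m) * D\<^sup>2"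
      have e: "test_fun \<Omega> (?e j)" for j by (rule test_fun_exp_mult[OF f])
      have fe: "ft (f j) (?z \<xi>) = ft (?e j) (cvec \<xi>)" for j \<xi> by (simp add: ft_exp_mult)
      have pt: "W \<xi> * (cmod (ft v (?z \<xi>) * ceval \<Delta> (?z \<xi>)))\<^sup>2 \<le> ?MD * (\<Sum>j\<in>UNIV. (cmod (ft (?e j) (cvec \<xi>)))\<^sup>2)" for \<xi>
      proof -
        have "(cmod (ft v (?z \<xi>) * ceval \<Delta> (?z \<xi>)))\<^sup>2 = (cmod (\<Sum>j\<in>UNIV. ceval (q j) (?z \<xi>) * ft (f j) (?z \<xi>)))\<^sup>2"
          using eq[of \<xi> y] by (simp add: mult.commute)
        also have "\<dots> \<le> real CARD('m) * (\<Sum>j\<in>UNIV. (cmod (ceval (q j) (?z \<xi>) * ft (f j) (?z \<xi>)))\<^sup>2)"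
          by (rule cmod_sum_power2_le)
        also have "\<dots> \<le> real CARD('m) * (\<Sum>j\<in>UNIV. (D * T \<xi>)\<^sup>2 * (cmod (ft (?e j) (cvec \<xi>)))\<^sup>2)"
        proof (intro mult_left_mono sum_mono)
          fix j :: 'm
          have "(cmod (ceval (q j) (?z \<xi>)))\<^sup>2 \<le> (D * T \<xi>)\<^sup>2" by (rule power_mono[OF qD[OF y]]) simp
          then show "(cmod (ceval (q j) (?z \<xi>) * ft (f j) (?z \<xi>)))\<^sup>2 \<le> (D * T \<xi>)\<^sup>2 * (cmod (ft (?e j) (cvec \<xi>)))\<^sup>2"
            unfolding fe norm_mult power_mult_distrib[of "cmod _" "cmod _"] by (rule mult_right_mono) simp
        qed simp
        also have "\<dots> = (T \<xi>)\<^sup>2 * (?MD * (\<Sum>j\<in>UNIV. (cmod (ft (?e j) (cvec \<xi>)))\<^sup>2))"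
          by (simp add: power_mult_distrib sum_distrib_left mult_ac)
        finally have "W \<xi> * (cmod (ft v (?z \<xi>) * ceval \<Delta> (?z \<xi>)))\<^sup>2 \<le> W \<xi> * ((T \<xi>)\<^sup>2 * (?MD * (\<Sum>j\<in>UNIV. (cmod (ft (?e j) (cvec \<xi>)))\<^sup>2)))"
          by (rule mult_left_mono[OF _ W0])
        then show ?thesis using T0[of \<xi>] by (simp add: W_def)
      qed
      have gm: "(\<lambda>\<xi>. ennreal ((cmod (ft (?e j) (cvec \<xi>)))\<^sup>2)) \<in> borel_measurable lborel" for j
      proof -
        have "(\<lambda>\<xi>. (cmod (ft (?e j) (cvec \<xi>)))\<^sup>2) \<in> borel_measurable borel"
          by (intro borel_measurable_continuous_onI continuous_intros test_fun_cc[OF e])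
        then show ?thesis by simp
      qed
      have "weighted W v \<Delta> y \<le> (\<integral>\<^sup>+\<xi>. ennreal ?MD * (\<Sum>j\<in>UNIV. ennreal ((cmod (ft (?e j) (cvec \<xi>)))\<^sup>2)) \<partial>lborel)"
        unfolding weighted_def
      proof (rule nn_integral_mono)
        fix \<xi> :: "real^'d"
        have "ennreal (W \<xi> * (cmod (ft v (?z \<xi>) * ceval \<Delta> (?z \<xi>)))\<^sup>2) \<le> ennreal (?MD * (\<Sum>j\<in>UNIV. (cmod (ft (?e j) (cvec \<xi>)))\<^sup>2))"
          by (rule ennreal_leI[OF pt])
        also have "\<dots> = ennreal ?MD * (\<Sum>j\<in>UNIV. ennreal ((cmod (ft (?e j) (cvec \<xi>)))\<^sup>2))"
          by (subst ennreal_mult') (simp_all add: sum_ennreal)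
        finally show "ennreal (W \<xi> * (cmod (ft v (?z \<xi>) * ceval \<Delta> (?z \<xi>)))\<^sup>2) \<le> ennreal ?MD * (\<Sum>j\<in>UNIV. ennreal ((cmod (ft (?e j) (cvec \<xi>)))\<^sup>2))" .
      qed
      also have "\<dots> = ennreal ?MD * (\<integral>\<^sup>+\<xi>. (\<Sum>j\<in>UNIV. ennreal ((cmod (ft (?e j) (cvec \<xi>)))\<^sup>2)) \<partial>lborel)"
        by (rule nn_integral_cmult) (intro borel_measurable_sum gm)
      also have "(\<integral>\<^sup>+\<xi>. (\<Sum>j\<in>UNIV. ennreal ((cmod (ft (?e j) (cvec \<xi>)))\<^sup>2)) \<partial>lborel) = (\<Sum>j\<in>UNIV. ennreal ((2 * pi) ^ CARD('d) * l2_sq (?e j)))"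
        by (subst nn_integral_sum) (simp_all only: gm plancherel_l2_sq[OF e])
      also have "\<dots> = ennreal (\<Sum>j\<in>UNIV. (2 * pi) ^ CARD('d) * l2_sq (?e j))" by (simp add: sum_ennreal)
      also have "\<dots> \<le> ennreal (\<Sum>j\<in>UNIV. (2 * pi) ^ CARD('d) * (E * l2_sq (f j)))"
        by (intro ennreal_leI sum_mono mult_left_mono E(2)[OF f]) (use y in auto)
      finally have "weighted W v \<Delta> y \<le> ennreal ?MD * ennreal (\<Sum>j\<in>UNIV. (2 * pi) ^ CARD('d) * (E * l2_sq (f j)))"
        by (simp add: mult_left_mono)
      also have "\<dots> = ennreal (B0 * ?F)"
      proof -
        have "?MD * (\<Sum>j\<in>UNIV. (2 * pi) ^ CARD('d) * (E * l2_sq (f j))) = B0 * ?F"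
          unfolding B0_def sum_distrib_left[symmetric] by (simp only: mult_ac)
        then show ?thesis by (subst ennreal_mult'[symmetric]) (simp, simp only:)
      qed
      finally show ?thesis .
    qed
    have each: "weighted W v (pdl is \<Delta>) 0 \<le> ennreal ((4 ^ m * L\<^sup>2) ^ length is * (B0 * ?F))" if "is": "is \<in> lists_le m" for "is"
    proof -
      have "weighted W v (pdl is \<Delta>) 0 \<le> ennreal (4 ^ m * L\<^sup>2) ^ length is * ennreal (B0 * ?F)"
      proof (rule weighted_pdl[OF test_fun_cc[OF v] \<Delta> W0 Wc Wslow, where R = 0])
        show "weighted W v \<Delta> y' \<le> ennreal (B0 * ?F)" if "\<And>k. \<bar>y' $ k\<bar> \<le> 0 + real (length is)" for y' :: "real^'d"
        proof (rule base)
          fix k show "\<bar>y' $ k\<bar> \<le> real m" using that[of k] "is" by (simp add: lists_le_def)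
        qed
      qed auto
      also have "\<dots> = ennreal ((4 ^ m * L\<^sup>2) ^ length is * (B0 * ?F))"
      proof -
        have "ennreal x ^ k * ennreal b = ennreal (x ^ k * b)" if "x \<ge> 0" for x b k
          using that by (simp add: ennreal_power ennreal_mult')
        then show ?thesis by simp
      qed
      finally show ?thesis .
    qed
    have "ennreal ((2 * pi) ^ CARD('d) * l2_sq v) = (\<integral>\<^sup>+\<xi>. ennreal ((cmod (ft v (cvec \<xi>)))\<^sup>2) \<partial>lborel)"
      by (rule plancherel_l2_sq[OF v, symmetric])
    also have "\<dots> \<le> (\<integral>\<^sup>+\<xi>. ennreal N * (\<Sum>is\<in>(lists_le m :: 'd list set). ennreal (W \<xi> * (cmod (ft v (cvec \<xi>) * ceval (pdl is \<Delta>) (cvec \<xi>)))\<^sup>2)) \<partial>lborel)"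
    proof (rule nn_integral_mono)
      fix \<xi> :: "real^'d"
      let ?v = "(cmod (ft v (cvec \<xi>)))\<^sup>2"
      have "(T \<xi>)\<^sup>2 = (cmod (\<Sum>is\<in>(lists_le m :: 'd list set). complex_of_real (cmod (ceval (pdl is \<Delta>) (cvec \<xi>)))))\<^sup>2"
        unfolding of_real_sum[symmetric] norm_of_real by (simp add: T_def deriv_sum_def)
      also have "\<dots> \<le> N * (\<Sum>is\<in>(lists_le m :: 'd list set). (cmod (complex_of_real (cmod (ceval (pdl is \<Delta>) (cvec \<xi>)))))\<^sup>2)"
        unfolding N_def by (rule cmod_sum_power2_le)
      finally have "(T \<xi>)\<^sup>2 * (W \<xi> * ?v) \<le> (N * (\<Sum>is\<in>(lists_le m :: 'd list set). (cmod (ceval (pdl is \<Delta>) (cvec \<xi>)))\<^sup>2)) * (W \<xi> * ?v)"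
        by (intro mult_right_mono) (simp_all add: W0)
      moreover have "(T \<xi>)\<^sup>2 * (W \<xi> * ?v) = ?v" using T0[of \<xi>] by (simp add: W_def)
      moreover have "(N * (\<Sum>is\<in>(lists_le m :: 'd list set). (cmod (ceval (pdl is \<Delta>) (cvec \<xi>)))\<^sup>2)) * (W \<xi> * ?v)
        = N * (\<Sum>is\<in>(lists_le m :: 'd list set). W \<xi> * (cmod (ft v (cvec \<xi>) * ceval (pdl is \<Delta>) (cvec \<xi>)))\<^sup>2)"
        by (simp add: norm_mult power_mult_distrib sum_distrib_left sum_distrib_right mult_ac)
      ultimately have "?v \<le> N * (\<Sum>is\<in>(lists_le m :: 'd list set). W \<xi> * (cmod (ft v (cvec \<xi>) * ceval (pdl is \<Delta>) (cvec \<xi>)))\<^sup>2)"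
        by (simp only:)
      then have "ennreal ?v \<le> ennreal (N * (\<Sum>is\<in>(lists_le m :: 'd list set). W \<xi> * (cmod (ft v (cvec \<xi>) * ceval (pdl is \<Delta>) (cvec \<xi>)))\<^sup>2))"
        by (rule ennreal_leI)
      also have "\<dots> = ennreal N * (\<Sum>is\<in>(lists_le m :: 'd list set). ennreal (W \<xi> * (cmod (ft v (cvec \<xi>) * ceval (pdl is \<Delta>) (cvec \<xi>)))\<^sup>2))"
        by (subst ennreal_mult') (simp_all add: N_def W0)
      finally show "ennreal ?v \<le> ennreal N * (\<Sum>is\<in>(lists_le m :: 'd list set). ennreal (W \<xi> * (cmod (ft v (cvec \<xi>) * ceval (pdl is \<Delta>) (cvec \<xi>)))\<^sup>2))" .
    qed
    also have "\<dots> = ennreal N * (\<Sum>is\<in>(lists_le m :: 'd list set). weighted W v (pdl is \<Delta>) 0)"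
    proof -
      have gm: "(\<lambda>\<xi>. ennreal (W \<xi> * (cmod (ft v (cvec \<xi>) * ceval (pdl is \<Delta>) (cvec \<xi>)))\<^sup>2)) \<in> borel_measurable lborel" for "is"
      proof -
        have "(\<lambda>\<xi>. ennreal (W \<xi> * (cmod (ft v (cvec \<xi>) * ceval (pdl is \<Delta>) (cvec \<xi>)))\<^sup>2)) \<in> borel_measurable borel"
          by (intro borel_measurable_ennreal_continuous continuous_intros Wc test_fun_cc[OF v])
        then show ?thesis by (simp only: measurable_lborel2)
      qed
      have z: "cvec \<xi> + \<i> *s cvec 0 = cvec \<xi>" for \<xi> :: "real^'d" by (simp add: vec_eq_iff)
      show ?thesis unfolding weighted_def z
        by (subst nn_integral_cmult) (simp_all only: borel_measurable_sum gm nn_integral_sum)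
    qed
    also have "\<dots> \<le> ennreal N * (\<Sum>is\<in>(lists_le m :: 'd list set). ennreal ((4 ^ m * L\<^sup>2) ^ length is * (B0 * ?F)))"
      by (intro mult_left_mono sum_mono each) auto
    also have "\<dots> = ennreal (N * (\<Sum>is\<in>(lists_le m :: 'd list set). (4 ^ m * L\<^sup>2) ^ length is * (B0 * ?F)))"
      using B00 F0 by (subst ennreal_mult') (simp_all add: N_def sum_ennreal)
    also have "N * (\<Sum>is\<in>(lists_le m :: 'd list set). (4 ^ m * L\<^sup>2) ^ length is * (B0 * ?F)) = S * B0 * ?F"
      unfolding S_def sum_distrib_right[symmetric] by (simp only: mult_ac)
    finally have "(2 * pi) ^ CARD('d) * l2_sq v \<le> S * B0 * ?F"
      using S0 B00 F0 by (subst (asm) ennreal_le_iff) auto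
    then show ?thesis by (simp add: field_simps)
  qed
  then show ?thesis using S0 B00 by (intro exI[of _ "S * B0 / (2 * pi) ^ CARD('d)"]) auto
qed


lemma L2_norm_fun_nonneg: "L2_norm_fun v \<ge> 0"
  by (simp add: L2_norm_fun_def)

text \<open>The polynomial identity \<open>\<Delta> Q = q P\<close> holds almost everywhere by the kernel condition, hence everywhere,
  and turns into the hypothesis of \<open>quotient_estimate\<close> after multiplication by the transform of \<open>u\<close>.\<close>

theorem estimate_if_dominates:
  fixes \<Omega> :: "(real^'d::finite) set"
    and P :: "('d, complex^'n::finite^'m::finite) mpolynomial"
    and Q :: "('d, complex^'n^'l::finite) mpolynomial"
  assumes \<Omega>: "bounded \<Omega>" and dom: "dominates P Q"
  shows "\<exists>C>0. \<forall>u\<in>test_functions \<Omega>. L2_norm_fun (diff_operator Q u) \<le> C * L2_norm_fun (diff_operator P u)"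
proof -
  obtain q \<Delta> where rep: "rational_rep P Q q \<Delta>" and sd: "\<And>l j. scalar_dominates \<Delta> (q l j)"
    and ker: "AE \<xi> in lborel. kernel (mpoly_eval P \<xi>) \<subseteq> kernel (mpoly_eval Q \<xi>)"
    using dom unfolding dominates_def by blast
  obtain \<xi>0 where nz: "mpoly_eval \<Delta> \<xi>0 \<noteq> 0" using rep unfolding rational_rep_def by blast
  have repAE: "AE \<xi> in lborel. mpoly_eval Q \<xi> ** pseudoinverse (mpoly_eval P \<xi>) = (\<chi> l j. mpoly_eval (q l j) \<xi> / mpoly_eval \<Delta> \<xi>)"
    using rep unfolding rational_rep_def by blast
  obtain S \<delta> where \<delta>: "AE \<xi> in lborel. mpoly_eval \<delta> \<xi> \<noteq> 0"
    and pinv: "\<And>\<xi>. mpoly_eval \<delta> \<xi> \<noteq> 0 \<Longrightarrow> is_pseudoinverse (mpoly_eval P \<xi>) (\<chi> n m. mpoly_eval (S n m) \<xi> / mpoly_eval \<delta> \<xi>)"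
    by (rule AE_pseudoinverse_rational[of P]) (rule that, assumption+)
  have id: "ceval \<Delta> (cvec \<xi>) * ceval (entry Q l n) (cvec \<xi>) = (\<Sum>j\<in>UNIV. ceval (q l j) (cvec \<xi>) * ceval (entry P j n) (cvec \<xi>))" for l n \<xi>
  proof -
    let ?f = "\<lambda>\<xi>. mpoly_eval \<Delta> \<xi> * mpoly_eval (entry Q l n) \<xi> - (\<Sum>j\<in>UNIV. mpoly_eval (q l j) \<xi> * mpoly_eval (entry P j n) \<xi>)"
    have "?f \<xi> = 0"
    proof (rule polyfun_eq_0_if_AE)
      show "polyfun ?f" by (intro polyfun_diff polyfun_mult polyfun_sum polyfun_mpoly_eval)
      show "AE \<xi> in lborel. ?f \<xi> = 0"
        using repAE ker \<delta> AE_mpoly_eval_nonzero[OF nz]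
      proof eventually_elim
        fix \<xi>
        assume 1: "mpoly_eval Q \<xi> ** pseudoinverse (mpoly_eval P \<xi>) = (\<chi> l j. mpoly_eval (q l j) \<xi> / mpoly_eval \<Delta> \<xi>)"
          and 2: "kernel (mpoly_eval P \<xi>) \<subseteq> kernel (mpoly_eval Q \<xi>)"
          and 3: "mpoly_eval \<delta> \<xi> \<noteq> 0" and 4: "mpoly_eval \<Delta> \<xi> \<noteq> 0"
        have "mpoly_eval Q \<xi> = (\<chi> l j. mpoly_eval (q l j) \<xi> / mpoly_eval \<Delta> \<xi>) ** mpoly_eval P \<xi>"
          using pseudoinverse_factor[OF pinv[OF 3] 2] 1 pseudoinverse_eqI[OF pinv[OF 3]] by simp
        then have "mpoly_eval Q \<xi> $ l $ n = (\<Sum>j\<in>UNIV. mpoly_eval (q l j) \<xi> * mpoly_eval P \<xi> $ j $ n) / mpoly_eval \<Delta> \<xi>"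
          by (simp add: matrix_matrix_mult_def sum_divide_distrib)
        then show "?f \<xi> = 0" using 4 by (simp add: mpoly_eval_nth)
      qed
    qed
    then show ?thesis by (simp add: mpoly_eval_eq_ceval)
  qed
  define bounds where "bounds l C \<longleftrightarrow> (\<forall>v f. test_fun \<Omega> v \<longrightarrow> (\<forall>j. test_fun \<Omega> (f j)) \<longrightarrow>
    (\<forall>\<xi> y. ceval \<Delta> (cvec \<xi> + \<i> *s cvec y) * ft v (cvec \<xi> + \<i> *s cvec y) =
      (\<Sum>j\<in>UNIV. ceval (q l j) (cvec \<xi> + \<i> *s cvec y) * ft (f j) (cvec \<xi> + \<i> *s cvec y))) \<longrightarrow>
    l2_sq v \<le> C * (\<Sum>j\<in>UNIV. l2_sq (f j)))" for l C
  have "\<forall>l. \<exists>C\<ge>0. bounds l C"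
    unfolding bounds_def by (rule allI, rule quotient_estimate[OF \<Omega> _ sd]) (use nz in blast)
  then obtain C where C: "\<And>l. C l \<ge> 0" and bC: "\<And>l. bounds l (C l)" by metis
  have est: "l2_sq v \<le> C l * (\<Sum>j\<in>UNIV. l2_sq (f j))" if "test_fun \<Omega> v" "\<And>j. test_fun \<Omega> (f j)"
    "\<And>\<xi> y. ceval \<Delta> (cvec \<xi> + \<i> *s cvec y) * ft v (cvec \<xi> + \<i> *s cvec y) =
      (\<Sum>j\<in>UNIV. ceval (q l j) (cvec \<xi> + \<i> *s cvec y) * ft (f j) (cvec \<xi> + \<i> *s cvec y))" for l v f
    using bC[of l, unfolded bounds_def, rule_format, OF that] .
  let ?D = "\<Sum>l\<in>UNIV. C l"
  have D0: "?D \<ge> 0" by (simp add: sum_nonneg C)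
  have "L2_norm_fun (diff_operator Q u) \<le> (sqrt ?D + 1) * L2_norm_fun (diff_operator P u)" if u: "u \<in> test_functions \<Omega>" for u
  proof -
    let ?v = "\<lambda>l x. diff_operator Q u x $ l" and ?f = "\<lambda>j x. diff_operator P u x $ j"
    have v: "test_fun \<Omega> (?v l)" for l by (rule test_fun_diff_operator[OF u])
    have f: "test_fun \<Omega> (?f j)" for j by (rule test_fun_diff_operator[OF u])
    have "l2_sq (?v l) \<le> C l * (\<Sum>j\<in>UNIV. l2_sq (?f j))" for l
    proof (rule est[OF v f])
      fix \<xi> y :: "real^'d"
      let ?z = "cvec \<xi> + \<i> *s cvec y"
      have "ceval \<Delta> ?z * ft (?v l) ?z = (\<Sum>n\<in>UNIV. (ceval \<Delta> ?z * ceval (entry Q l n) ?z) * ft (\<lambda>x. u x $ n) ?z)"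
        unfolding ft_diff_operator[OF u] sum_distrib_left by (simp only: mult.assoc)
      also have "\<dots> = (\<Sum>n\<in>UNIV. \<Sum>j\<in>UNIV. ceval (q l j) ?z * ceval (entry P j n) ?z * ft (\<lambda>x. u x $ n) ?z)"
        unfolding ceval_identity_complexify[OF id] sum_distrib_right ..
      also have "\<dots> = (\<Sum>j\<in>UNIV. \<Sum>n\<in>UNIV. ceval (q l j) ?z * ceval (entry P j n) ?z * ft (\<lambda>x. u x $ n) ?z)"
        by (rule sum.swap)
      also have "\<dots> = (\<Sum>j\<in>UNIV. ceval (q l j) ?z * ft (?f j) ?z)"
        unfolding ft_diff_operator[OF u] sum_distrib_left by (simp only: mult.assoc)
      finally show "ceval \<Delta> ?z * ft (?v l) ?z = (\<Sum>j\<in>UNIV. ceval (q l j) ?z * ft (?f j) ?z)" .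
    qed
    then have "(\<Sum>l\<in>UNIV. l2_sq (?v l)) \<le> (\<Sum>l\<in>UNIV. C l * (\<Sum>j\<in>UNIV. l2_sq (?f j)))" by (rule sum_mono)
    then have "(L2_norm_fun (diff_operator Q u))\<^sup>2 \<le> ?D * (L2_norm_fun (diff_operator P u))\<^sup>2"
      unfolding L2_norm_fun_power2[OF v] L2_norm_fun_power2[OF f] sum_distrib_right .
    also have "\<dots> = (sqrt ?D * L2_norm_fun (diff_operator P u))\<^sup>2"
      using D0 by (simp add: power_mult_distrib)
    finally have "L2_norm_fun (diff_operator Q u) \<le> sqrt ?D * L2_norm_fun (diff_operator P u)"
      by (rule power2_le_imp_le) (intro mult_nonneg_nonneg real_sqrt_ge_zero D0 L2_norm_fun_nonneg)
    then show ?thesis using L2_norm_fun_nonneg[of "diff_operator P u"] by (simp add: algebra_simps)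
  qed
  moreover have "sqrt ?D + 1 > 0" using D0 by (simp add: add_nonneg_pos)
  ultimately show ?thesis by blast
qed

text \<open>The square norm of the \<open>j\<close>-th column is \<open>(E\<^sup>* E)\<^sub>j\<^sub>j = E\<^sub>j\<^sub>j\<close>, and it is at least \<open>|E\<^sub>j\<^sub>j|\<^sup>2\<close>.\<close>

lemma column_norm_hermitian_idempotent:
  fixes E :: "complex^'m::finite^'m"
  assumes "conj_transpose E = E" "E ** E = E"
  shows "(\<Sum>i\<in>UNIV. (cmod (E $ i $ j))\<^sup>2) \<le> 1"
proof -
  let ?s = "\<Sum>i\<in>UNIV. (cmod (E $ i $ j))\<^sup>2"
  have "complex_of_real ?s = (conj_transpose E ** E) $ j $ j"
    by (simp add: matrix_matrix_mult_def complex_norm_square mult.commute del: of_real_power)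
  also have "\<dots> = E $ j $ j" by (simp add: assms)
  finally have s: "complex_of_real ?s = E $ j $ j" .
  have s0: "?s \<ge> 0" by (simp add: sum_nonneg)
  have "?s\<^sup>2 = (cmod (E $ j $ j))\<^sup>2" unfolding s[symmetric] norm_of_real by simp
  also have "\<dots> \<le> ?s" by (rule member_le_sum) auto
  finally have "?s * ?s \<le> ?s * 1" by (simp add: power2_eq_square)
  then show ?thesis using s0 by (cases "?s = 0") (auto simp: mult_le_cancel_left)
qed

text \<open>The test functions \<open>S(D) (w e\<^sub>j)\<close> give the scalar estimates, and the test functions \<open>K(D) (\<phi> e\<^sub>k)\<close>
  with \<open>K = \<delta> (1 - P\<^sup>+ P)\<close> the inclusion of the kernels.\<close>

theorem dominates_if_estimate:
  fixes \<Omega> :: "(real^'d::finite) set"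
    and P :: "('d, complex^'n::finite^'m::finite) mpolynomial"
    and Q :: "('d, complex^'n^'l::finite) mpolynomial"
  assumes \<Omega>: "bounded \<Omega>" "open \<Omega>" "\<Omega> \<noteq> {}"
    and C: "C > 0" and est: "\<And>u. u \<in> test_functions \<Omega> \<Longrightarrow> L2_norm_fun (diff_operator Q u) \<le> C * L2_norm_fun (diff_operator P u)"
  shows "dominates P Q"
proof -
  obtain S \<delta> where \<delta>1: "\<exists>\<xi>. mpoly_eval \<delta> \<xi> \<noteq> 0" and \<delta>: "AE \<xi> in lborel. mpoly_eval \<delta> \<xi> \<noteq> 0"
    and pinv: "\<And>\<xi>. mpoly_eval \<delta> \<xi> \<noteq> 0 \<Longrightarrow> is_pseudoinverse (mpoly_eval P \<xi>) (\<chi> n m. mpoly_eval (S n m) \<xi> / mpoly_eval \<delta> \<xi>)"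
    by (rule AE_pseudoinverse_rational[of P]) (rule that, assumption+)
  have est2: "(\<Sum>l\<in>UNIV. l2_sq (\<lambda>x. diff_operator Q u x $ l)) \<le> C\<^sup>2 * (\<Sum>i\<in>UNIV. l2_sq (\<lambda>x. diff_operator P u x $ i))" if u: "u \<in> test_functions \<Omega>" for u
  proof -
    have "(L2_norm_fun (diff_operator Q u))\<^sup>2 \<le> (C * L2_norm_fun (diff_operator P u))\<^sup>2"
      by (rule power_mono[OF est[OF u] L2_norm_fun_nonneg])
    then show ?thesis
      unfolding power_mult_distrib L2_norm_fun_power2[OF test_fun_diff_operator[OF u]] .
  qed
  have mono: "l2_sq g \<le> l2_sq h" if g: "test_fun \<Omega> g" and h: "test_fun \<Omega> h"
    and le: "AE \<xi> in lborel. cmod (ft g (cvec \<xi>)) \<le> cmod (ft h (cvec \<xi>))" for g h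
  proof -
    have "(\<integral>\<^sup>+\<xi>. ennreal ((cmod (ft g (cvec \<xi>)))\<^sup>2) \<partial>lborel) \<le> (\<integral>\<^sup>+\<xi>. ennreal ((cmod (ft h (cvec \<xi>)))\<^sup>2) \<partial>lborel)"
      by (rule nn_integral_mono_AE) (use le in \<open>eventually_elim, auto intro!: ennreal_leI power_mono\<close>)
    then show ?thesis unfolding plancherel_l2_sq[OF g] plancherel_l2_sq[OF h]
      by (subst (asm) ennreal_le_iff) auto
  qed
  have mono_sum: "(\<Sum>i\<in>UNIV. l2_sq (g i)) \<le> l2_sq h" if g: "\<And>i :: 'm. test_fun \<Omega> (g i)" and h: "test_fun \<Omega> h"
    and le: "AE \<xi> in lborel. (\<Sum>i\<in>UNIV. (cmod (ft (g i) (cvec \<xi>)))\<^sup>2) \<le> (cmod (ft h (cvec \<xi>)))\<^sup>2" for g h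
  proof -
    have gm: "(\<lambda>\<xi>. ennreal ((cmod (ft (g i) (cvec \<xi>)))\<^sup>2)) \<in> borel_measurable lborel" for i
    proof -
      have "(\<lambda>\<xi>. ennreal ((cmod (ft (g i) (cvec \<xi>)))\<^sup>2)) \<in> borel_measurable borel"
        by (intro borel_measurable_ennreal_continuous continuous_intros test_fun_cc[OF g])
      then show ?thesis by (simp only: measurable_lborel2)
    qed
    have "ennreal ((2 * pi) ^ CARD('d) * (\<Sum>i\<in>UNIV. l2_sq (g i))) = (\<Sum>i\<in>UNIV. ennreal ((2 * pi) ^ CARD('d) * l2_sq (g i)))"
      unfolding sum_distrib_left by (rule sum_ennreal[symmetric]) simp
    also have "\<dots> = (\<integral>\<^sup>+\<xi>. (\<Sum>i\<in>UNIV. ennreal ((cmod (ft (g i) (cvec \<xi>)))\<^sup>2)) \<partial>lborel)"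
      by (subst nn_integral_sum) (simp_all only: gm plancherel_l2_sq[OF g])
    also have "\<dots> \<le> (\<integral>\<^sup>+\<xi>. ennreal ((cmod (ft h (cvec \<xi>)))\<^sup>2) \<partial>lborel)"
    proof (rule nn_integral_mono_AE)
      show "AE \<xi> in lborel. (\<Sum>i\<in>UNIV. ennreal ((cmod (ft (g i) (cvec \<xi>)))\<^sup>2)) \<le> ennreal ((cmod (ft h (cvec \<xi>)))\<^sup>2)"
        using le by eventually_elim (subst sum_ennreal, simp, rule ennreal_leI)
    qed
    also have "\<dots> = ennreal ((2 * pi) ^ CARD('d) * l2_sq h)" by (rule plancherel_l2_sq[OF h])
    finally show ?thesis by (subst (asm) ennreal_le_iff) auto
  qed
  have test: "(\<lambda>x. \<chi> n. scalar_op (A n) w x) \<in> test_functions \<Omega>" if "test_fun \<Omega> w" for A :: "'n \<Rightarrow> ('d, complex) mpolynomial" and w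
    unfolding test_functions_iff using test_fun_scalar_op[OF that] by simp
  have ftR: "ft (\<lambda>x. diff_operator R (\<lambda>x. \<chi> n. scalar_op (A n) w x) x $ i) (cvec \<xi>)
      = (\<Sum>n\<in>UNIV. mpoly_eval (entry R i n) \<xi> * mpoly_eval (A n) \<xi>) * ft w (cvec \<xi>)"
    if w: "test_fun \<Omega> w" for A :: "'n \<Rightarrow> ('d, complex) mpolynomial" and w \<xi> i and R :: "('d, complex^'n^'k::finite) mpolynomial"
    unfolding ft_diff_operator[OF test[OF w]] vec_lambda_beta mpoly_eval_eq_ceval sum_distrib_right
    using ft_scalar_op[OF w] by (simp add: mult.assoc)
  define q where "q l j = poly_of (\<lambda>\<xi>. \<Sum>n\<in>UNIV. mpoly_eval (entry Q l n) \<xi> * mpoly_eval (S n j) \<xi>)" for l j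
  have q: "mpoly_eval (q l j) \<xi> = (\<Sum>n\<in>UNIV. mpoly_eval (entry Q l n) \<xi> * mpoly_eval (S n j) \<xi>)" for l j \<xi>
    unfolding q_def by (rule mpoly_eval_poly_of) (intro polyfun_sum polyfun_mult polyfun_mpoly_eval)
  have rep: "rational_rep P Q q \<delta>"
    unfolding rational_rep_def
  proof (intro conjI \<delta>1)
    show "AE \<xi> in lborel. mpoly_eval Q \<xi> ** pseudoinverse (mpoly_eval P \<xi>) = (\<chi> l j. mpoly_eval (q l j) \<xi> / mpoly_eval \<delta> \<xi>)"
      using \<delta>
    proof eventually_elim
      fix \<xi> assume "mpoly_eval \<delta> \<xi> \<noteq> 0"
      from pseudoinverse_eqI[OF pinv[OF this]]
      show "mpoly_eval Q \<xi> ** pseudoinverse (mpoly_eval P \<xi>) = (\<chi> l j. mpoly_eval (q l j) \<xi> / mpoly_eval \<delta> \<xi>)"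
        by (simp add: vec_eq_iff matrix_matrix_mult_def q mpoly_eval_nth sum_divide_distrib)
    qed
  qed
  have "scalar_dominates \<delta> (q l j)" for l j
  proof (rule scalar_dominates_necessary[OF \<Omega>, where C = "C\<^sup>2"])
    fix w assume w: "test_fun \<Omega> w"
    let ?u = "\<lambda>x. \<chi> n. scalar_op (S n j) w x"
    have "l2_sq (scalar_op (q l j) w) \<le> l2_sq (\<lambda>x. diff_operator Q ?u x $ l)"
      by (rule mono[OF test_fun_scalar_op[OF w] test_fun_diff_operator[OF test[OF w]]])
         (simp add: ft_scalar_op[OF w] ftR[OF w] q flip: mpoly_eval_eq_ceval)
    also have "\<dots> \<le> (\<Sum>l\<in>UNIV. l2_sq (\<lambda>x. diff_operator Q ?u x $ l))"
      by (rule member_le_sum) auto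
    also have "\<dots> \<le> C\<^sup>2 * (\<Sum>i\<in>UNIV. l2_sq (\<lambda>x. diff_operator P ?u x $ i))"
      by (rule est2[OF test[OF w]])
    also have "(\<Sum>i\<in>UNIV. l2_sq (\<lambda>x. diff_operator P ?u x $ i)) \<le> l2_sq (scalar_op \<delta> w)"
    proof (rule mono_sum[OF test_fun_diff_operator[OF test[OF w]] test_fun_scalar_op[OF w]])
      show "AE \<xi> in lborel. (\<Sum>i\<in>UNIV. (cmod (ft (\<lambda>x. diff_operator P ?u x $ i) (cvec \<xi>)))\<^sup>2) \<le> (cmod (ft (scalar_op \<delta> w) (cvec \<xi>)))\<^sup>2"
        using \<delta>
      proof eventually_elim
        fix \<xi> assume nz: "mpoly_eval \<delta> \<xi> \<noteq> 0"
        let ?X = "\<chi> n m. mpoly_eval (S n m) \<xi> / mpoly_eval \<delta> \<xi>"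
        let ?E = "mpoly_eval P \<xi> ** ?X"
        have X: "is_pseudoinverse (mpoly_eval P \<xi>) ?X" by (rule pinv[OF nz])
        have E: "(\<Sum>i\<in>UNIV. (cmod (?E $ i $ j))\<^sup>2) \<le> 1"
          by (rule column_norm_hermitian_idempotent) (use X in \<open>simp_all add: is_pseudoinverse_def matrix_mul_assoc\<close>)
        have PS: "(\<Sum>n\<in>UNIV. mpoly_eval (entry P i n) \<xi> * mpoly_eval (S n j) \<xi>) = mpoly_eval \<delta> \<xi> * ?E $ i $ j" for i
          using nz by (simp add: matrix_matrix_mult_def mpoly_eval_nth sum_distrib_left)
        have "(\<Sum>i\<in>UNIV. (cmod (ft (\<lambda>x. diff_operator P ?u x $ i) (cvec \<xi>)))\<^sup>2)
           = (cmod (mpoly_eval \<delta> \<xi> * ft w (cvec \<xi>)))\<^sup>2 * (\<Sum>i\<in>UNIV. (cmod (?E $ i $ j))\<^sup>2)"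
          unfolding ftR[OF w] PS sum_distrib_left by (simp only: norm_mult power_mult_distrib mult_ac)
        also have "\<dots> \<le> (cmod (mpoly_eval \<delta> \<xi> * ft w (cvec \<xi>)))\<^sup>2 * 1"
          by (rule mult_left_mono[OF E]) simp
        finally show "(\<Sum>i\<in>UNIV. (cmod (ft (\<lambda>x. diff_operator P ?u x $ i) (cvec \<xi>)))\<^sup>2) \<le> (cmod (ft (scalar_op \<delta> w) (cvec \<xi>)))\<^sup>2"
          by (simp add: ft_scalar_op[OF w] mpoly_eval_eq_ceval)
      qed
    qed
    finally show "l2_sq (scalar_op (q l j) w) \<le> C\<^sup>2 * l2_sq (scalar_op \<delta> w)" by (simp add: mult_left_mono)
  qed simp
  moreover have "AE \<xi> in lborel. kernel (mpoly_eval P \<xi>) \<subseteq> kernel (mpoly_eval Q \<xi>)"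
  proof -
    \<comment> \<open>The entries of \<open>\<delta> (1 - P\<^sup>+ P)\<close>, which \<open>P\<close> annihilates.\<close>
    define \<kappa> where "\<kappa> n k = poly_of (\<lambda>\<xi>. (if n = k then mpoly_eval \<delta> \<xi> else 0) - (\<Sum>j\<in>UNIV. mpoly_eval (S n j) \<xi> * mpoly_eval (entry P j k) \<xi>))" for n k
    have \<kappa>: "mpoly_eval (\<kappa> n k) \<xi> = (if n = k then mpoly_eval \<delta> \<xi> else 0) - (\<Sum>j\<in>UNIV. mpoly_eval (S n j) \<xi> * mpoly_eval (entry P j k) \<xi>)" for n k \<xi>
      unfolding \<kappa>_def by (rule mpoly_eval_poly_of)
        (intro polyfun_diff polyfun_sum polyfun_mult polyfun_mpoly_eval, cases "n = k"; simp add: polyfun_const)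
    let ?K = "\<lambda>\<xi>. \<chi> n k. mpoly_eval (\<kappa> n k) \<xi>"
    have Kv: "(?K \<xi> *v v) $ n = mpoly_eval \<delta> \<xi> * v $ n - (\<Sum>j\<in>UNIV. mpoly_eval (S n j) \<xi> * (mpoly_eval P \<xi> *v v) $ j)" for \<xi> v n
    proof -
      have "(?K \<xi> *v v) $ n = (\<Sum>k\<in>UNIV. (if n = k then mpoly_eval \<delta> \<xi> * v $ k else 0)) - (\<Sum>k\<in>UNIV. \<Sum>j\<in>UNIV. mpoly_eval (S n j) \<xi> * (mpoly_eval P \<xi> $ j $ k * v $ k))"
        unfolding matrix_vector_mult_def vec_lambda_beta \<kappa> left_diff_distrib sum_subtractf
        by (intro arg_cong2[where f = minus] sum.cong) (auto simp: sum_distrib_right mult.assoc mpoly_eval_nth)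
      also have "(\<Sum>k\<in>UNIV. \<Sum>j\<in>UNIV. mpoly_eval (S n j) \<xi> * (mpoly_eval P \<xi> $ j $ k * v $ k)) = (\<Sum>j\<in>UNIV. mpoly_eval (S n j) \<xi> * (mpoly_eval P \<xi> *v v) $ j)"
        unfolding matrix_vector_mult_def vec_lambda_beta sum_distrib_left by (rule sum.swap)
      finally show ?thesis by simp
    qed
    have PK: "(\<Sum>n\<in>UNIV. mpoly_eval (entry P i n) \<xi> * mpoly_eval (\<kappa> n k) \<xi>) = 0" if nz: "mpoly_eval \<delta> \<xi> \<noteq> 0" for i k \<xi>
    proof -
      let ?X = "\<chi> n m. mpoly_eval (S n m) \<xi> / mpoly_eval \<delta> \<xi>"
      let ?P = "mpoly_eval P \<xi>"
      have "?K \<xi> *v v = mpoly_eval \<delta> \<xi> *s (v - ?X *v (?P *v v))" for v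
        unfolding vec_eq_iff
      proof
        fix n
        show "(?K \<xi> *v v) $ n = (mpoly_eval \<delta> \<xi> *s (v - ?X *v (?P *v v))) $ n"
          unfolding Kv using nz by (simp add: matrix_vector_mult_def[of ?X] algebra_simps sum_distrib_left)
      qed
      then have "?P *v (?K \<xi> *v v) = mpoly_eval \<delta> \<xi> *s (?P *v v - (?P ** ?X ** ?P) *v v)" for v
        by (simp add: matrix_vector_mult_diff_distrib vector_scalar_commute matrix_vector_mul_assoc matrix_mul_assoc)
      then have "?P *v (?K \<xi> *v v) = 0" for v using pinv[OF nz] by (simp add: is_pseudoinverse_def)
      then have "(?P ** ?K \<xi>) *v axis k 1 = 0" by (simp add: matrix_vector_mul_assoc)
      moreover have "((?P ** ?K \<xi>) *v axis k 1) $ i = (?P ** ?K \<xi>) $ i $ k"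
        by (simp add: matrix_vector_mult_def axis_def if_distrib cong: if_cong)
      ultimately have "(?P ** ?K \<xi>) $ i $ k = 0" by simp
      then show ?thesis by (simp add: matrix_matrix_mult_def mpoly_eval_nth)
    qed
    have QK: "(\<Sum>n\<in>UNIV. mpoly_eval (entry Q l n) \<xi> * mpoly_eval (\<kappa> n k) \<xi>) = 0" for l k \<xi>
    proof (rule ccontr)
      let ?G = "\<lambda>\<xi>. \<Sum>n\<in>UNIV. mpoly_eval (entry Q l n) \<xi> * mpoly_eval (\<kappa> n k) \<xi>"
      assume nz: "?G \<xi> \<noteq> 0"
      have "polyfun ?G" by (intro polyfun_sum polyfun_mult polyfun_mpoly_eval)
      then obtain g where g: "?G = mpoly_eval g" by (rule polyfunE)
      have gx: "?G \<xi> = mpoly_eval g \<xi>" for \<xi> using g by (rule fun_cong)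
      have Gnz: "AE \<xi> in lborel. ?G \<xi> \<noteq> 0"
        unfolding gx by (rule AE_mpoly_eval_nonzero[of g \<xi>]) (use nz in \<open>simp only: gx not_False_eq_True\<close>)
      obtain \<phi> where \<phi>: "test_fun \<Omega> \<phi>" "ft \<phi> 0 \<noteq> 0" using exists_test_fun_integral_nonzero[OF \<Omega>(2,3)] by blast
      let ?u = "\<lambda>x. \<chi> n. scalar_op (\<kappa> n k) \<phi> x"
      have z: "l2_sq (\<lambda>x :: real^'d. 0 :: complex) = 0" by (simp add: l2_sq_def)
      have "l2_sq (\<lambda>x. diff_operator P ?u x $ i) \<le> l2_sq (\<lambda>x :: real^'d. 0)" for i
        by (rule mono[OF test_fun_diff_operator[OF test[OF \<phi>(1)]] test_fun_zero])
           (use \<delta> in \<open>eventually_elim, simp add: ftR[OF \<phi>(1)] PK\<close>)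
      then have "l2_sq (\<lambda>x. diff_operator P ?u x $ i) = 0" for i using z by (intro antisym) auto
      then have "(\<Sum>l\<in>UNIV. l2_sq (\<lambda>x. diff_operator Q ?u x $ l)) \<le> 0"
        using est2[OF test[OF \<phi>(1), of "\<lambda>n. \<kappa> n k"]] by simp
      moreover have "l2_sq (\<lambda>x. diff_operator Q ?u x $ l) \<le> (\<Sum>l\<in>UNIV. l2_sq (\<lambda>x. diff_operator Q ?u x $ l))"
        by (rule member_le_sum) auto
      ultimately have "l2_sq (\<lambda>x. diff_operator Q ?u x $ l) = 0" by (intro antisym) auto
      then have "(\<integral>\<^sup>+\<xi>. ennreal ((cmod (?G \<xi> * ft \<phi> (cvec \<xi>)))\<^sup>2) \<partial>lborel) = 0"
        using plancherel_l2_sq[OF test_fun_diff_operator[OF test[OF \<phi>(1)], of Q "\<lambda>n. \<kappa> n k" l]] by (simp add: ftR[OF \<phi>(1)])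
      moreover have "(\<lambda>\<xi>. ennreal ((cmod (?G \<xi> * ft \<phi> (cvec \<xi>)))\<^sup>2)) \<in> borel_measurable lborel"
      proof -
        have "(\<lambda>\<xi>. ennreal ((cmod (?G \<xi> * ft \<phi> (cvec \<xi>)))\<^sup>2)) \<in> borel_measurable borel"
          by (intro borel_measurable_ennreal_continuous continuous_intros test_fun_cc[OF \<phi>(1)])
        then show ?thesis by (simp only: measurable_lborel2)
      qed
      ultimately have "AE \<xi> in lborel. ennreal ((cmod (?G \<xi> * ft \<phi> (cvec \<xi>)))\<^sup>2) = 0"
        by (subst (asm) nn_integral_0_iff_AE) auto
      then have "AE \<xi> in lborel. cmod (ft \<phi> (cvec \<xi>)) \<le> cmod (ft (\<lambda>x. 0) (cvec \<xi>))"
        using Gnz by eventually_elim simp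
      then have "l2_sq \<phi> \<le> l2_sq (\<lambda>x :: real^'d. 0)" by (rule mono[OF \<phi>(1) test_fun_zero])
      then have n0: "l2_sq \<phi> = 0" using z by (intro antisym) auto
      obtain E where E: "E > 0" "\<And>f z. test_fun \<Omega> f \<Longrightarrow> (\<forall>i. \<bar>Im (z $ i)\<bar> \<le> 0) \<Longrightarrow> (cmod (ft f z))\<^sup>2 \<le> E * l2_sq f"
        using ft_bound[OF \<Omega>(1), of 0] by blast
      have "(cmod (ft \<phi> 0))\<^sup>2 \<le> E * l2_sq \<phi>" by (rule E(2)[OF \<phi>(1)]) simp
      then show False using \<phi>(2) n0 by simp
    qed
    show ?thesis using \<delta>
    proof eventually_elim
      fix \<xi> assume nz: "mpoly_eval \<delta> \<xi> \<noteq> 0"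
      show "kernel (mpoly_eval P \<xi>) \<subseteq> kernel (mpoly_eval Q \<xi>)"
      proof
        fix v assume "v \<in> kernel (mpoly_eval P \<xi>)"
        then have "?K \<xi> *v v = mpoly_eval \<delta> \<xi> *s v" by (simp add: vec_eq_iff[of "?K \<xi> *v v"] Kv kernel_def)
        moreover have "mpoly_eval Q \<xi> *v (?K \<xi> *v v) = 0"
        proof -
          have "mpoly_eval Q \<xi> ** ?K \<xi> = 0"
            using QK by (simp add: vec_eq_iff matrix_matrix_mult_def mpoly_eval_nth)
          then show ?thesis by (simp add: matrix_vector_mul_assoc)
        qed
        ultimately have "mpoly_eval \<delta> \<xi> *s (mpoly_eval Q \<xi> *v v) = 0" by (simp add: vector_scalar_commute)
        then show "v \<in> kernel (mpoly_eval Q \<xi>)" using nz by (simp add: kernel_def)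
      qed
    qed
  qed
  ultimately show ?thesis unfolding dominates_def using rep by blast
qed

theorem theorem1:
  fixes \<Omega> :: "(real^'d::finite) set"
    and P :: "('d, complex^'n::finite^'m::finite) mpolynomial"
    and Q :: "('d, complex^'n^'l::finite) mpolynomial"
  assumes "\<Omega> \<noteq> {}" and "bounded \<Omega>" and "open \<Omega>"
  shows "(\<exists>C>0. \<forall>u\<in>test_functions \<Omega>.
            L2_norm_fun (diff_operator Q u) \<le> C * L2_norm_fun (diff_operator P u))
         \<longleftrightarrow> dominates P Q"
  using estimate_if_dominates[OF assms(2)] dominates_if_estimate[OF assms(2,3,1)] by blast

end
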